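(* Fix $l\in(0,1/2)$, $0<\alpha,\beta<1$ and $\delta>0$. Then $$\lim_{N\to\infty}\max_{x\in V_N^l}\mathbf P\left(\left|\frac{\log|\mathcal H_N(\alpha)\cap D(x,N^\beta)|}{\log N}-2\beta(1-\alpha^2)\right|>\delta\ \middle|\ x\in\mathcal H_N(\alpha)\right)=0.$$
   Context: For an integer $N\ge1$ let $V_N=\{1,\dots,N\}^2\subset\mathbb Z^2$, let $\partial V_N$ be the set of points of $V_N$ having a nearest neighbour outside $V_N$, and $\mathrm{int}(V_N)=V_N\setminus\partial V_N$. The two-dimensional discrete Gaussian free field (GFF) on $V_N$ is the centered Gaussian family $\Phi=(\Phi_x)_{x\in V_N}$ (under a probability $\mathbf P$) with $\Phi_x=0$ for $x\in\partial V_N$ and covariance $\mathrm{Cov}(\Phi_x,\Phi_y)=G_N(x,y)=\mathbb E_x\big(\sum_{i=0}^{\tau_{\partial V_N}}\mathbf 1_{\{\eta_i=y\}}\big)$ for $x,y\in\mathrm{int}(V_N)$, where $(\eta_i)_{i\ge0}$ is simple random walk on $\mathbb Z^2$ started at $x$ and $\tau_{\partial V_N}=\inf\{i\ge0:\eta_i\in\partial V_N\}$. Let $g=2/\pi$ and $\log$ the natural logarithm. For $l\in(0,1/2)$, $V_N^l:=\{x\in V_N:\mathrm{dist}(x,V_N^c)\ge lN\}$, and for $\eta\in(0,1)$, $\mathcal H_N(\eta):=\{x\in V_N^l:\Phi_x\ge 2\sqrt g\,\eta\log N\}$ (the $\eta$-high points). $D(x,\rho):=\{y\in V_N:|y-x|\le\rho\}$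 (Euclidean norm). *)

theory Defs
  imports "HOL-Probability.Probability"
begin

definition nbrs :: "int \<times> int \<Rightarrow> (int \<times> int) set" where
  "nbrs x = {(fst x + 1, snd x), (fst x - 1, snd x), (fst x, snd x + 1), (fst x, snd x - 1)}"

definition box :: "nat \<Rightarrow> (int \<times> int) set" where
  "box N = {1..int N} \<times> {1..int N}"

definition bdry :: "nat \<Rightarrow> (int \<times> int) set" where
  "bdry N = {x \<in> box N. \<exists>y\<in>nbrs x. y \<notin> box N}"

definition intr :: "nat \<Rightarrow> (int \<times> int) set" where
  "intr N = box N - bdry N"

text \<open>kill_walk N i x y = P_x(eta_i = y and eta_0,...,eta_i avoid the boundary),
  for x, y interior (simple random walk killed on hitting the boundary).\<close>
fun kill_walk :: "nat \<Rightarrow> nat \<Rightarrow> int \<times> int \<Rightarrow> int \<times> int \<Rightarrow> real" where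
  "kill_walk N 0 x y = (if x = y then 1 else 0)"
| "kill_walk N (Suc i) x y = (\<Sum>z\<in>nbrs x \<inter> intr N. kill_walk N i z y) / 4"

definition green :: "nat \<Rightarrow> int \<times> int \<Rightarrow> int \<times> int \<Rightarrow> real" where
  "green N x y = (\<Sum>i. kill_walk N i x y)"

definition edist :: "int \<times> int \<Rightarrow> int \<times> int \<Rightarrow> real" where
  "edist x y = sqrt (real_of_int ((fst x - fst y)^2 + (snd x - snd y)^2))"

definition dist_compl :: "nat \<Rightarrow> int \<times> int \<Rightarrow> real" where
  "dist_compl N x = Inf {edist x y | y. y \<notin> box N}"

definition VNl :: "nat \<Rightarrow> real \<Rightarrow> (int \<times> int) set" where
  "VNl N l = {x \<in> box N. dist_compl N x \<ge> l * real N}"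

definition gconst :: real where
  "gconst = 2 / pi"

definition high :: "nat \<Rightarrow> real \<Rightarrow> real \<Rightarrow> (int \<times> int \<Rightarrow> real) \<Rightarrow> (int \<times> int) set" where
  "high N l \<eta> \<phi> = {x \<in> VNl N l. \<phi> x \<ge> 2 * sqrt gconst * \<eta> * ln (real N)}"

definition disc :: "nat \<Rightarrow> int \<times> int \<Rightarrow> real \<Rightarrow> (int \<times> int) set" where
  "disc N x \<rho> = {y \<in> box N. edist x y \<le> \<rho>}"

text \<open>Phi is a 2D discrete GFF on V_N under the probability space M: measurable,
  zero on the boundary, and the interior values form a centered Gaussian vector with
  covariance green N (every linear combination has the Gaussian characteristic function).\<close>
definition is_GFF :: "'a measure \<Rightarrow> nat \<Rightarrow> (int \<times> int \<Rightarrow> 'a \<Rightarrow> real) \<Rightarrow> bool" where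
  "is_GFF M N \<Phi> \<longleftrightarrow> prob_space M
     \<and> (\<forall>x\<in>box N. \<Phi> x \<in> borel_measurable M)
     \<and> (\<forall>x\<in>bdry N. \<forall>\<omega>\<in>space M. \<Phi> x \<omega> = 0)
     \<and> (\<forall>(c :: int \<times> int \<Rightarrow> real) (t :: real).
          char (distr M borel (\<lambda>\<omega>. \<Sum>x\<in>intr N. c x * \<Phi> x \<omega>)) t
          = complex_of_real (exp (- (t^2 * (\<Sum>x\<in>intr N. \<Sum>y\<in>intr N. c x * c y * green N x y)) / 2)))"

end

theory Submission
  imports Defs "HOL-Real_Asymp.Real_Asymp"
begin

text \<open>
  The lattice function $f(x) = \frac12 \ln(|x|^2+1)$ is subharmonic with discrete Laplacian $O(|x|^{-4})$ of total
  mass $\pi/2$. Comparing its potential with the Green function by the maximum principle gives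
  $G_N(x,y) = g\,(\ln N - \ln^+ |x-y|) + o(\ln N)$ uniformly in the bulk, and no finer information is needed.

  Local averages over a bounded number of well separated points play the role of the field at scale $N^\gamma$.
  Given that $x$ is high, these averages are close to the fraction $1-\gamma$ of the height; a first moment
  computation restricted to this event yields the upper bound.

  For the lower bound the field near $x$ is recentred by its average at scale $N^\beta$ and made orthogonal to
  $\Phi_x$, so that conditioning does not affect it. A truncated second moment shows that it has enough high points
  with probability at least $N^{-\zeta}$ for every $\zeta > 0$. The Maurey--Pisier inequality for a smooth
  surrogate of the logarithmic count turns this into a probability tending to one.
\<close>

section \<open>Discrete Green function\<close>

text \<open>Being high has probability about \<open>N powr (- 2 * \<alpha>^2)\<close>, so every
  error event must be small relative to that. For the upper bound the plain conditional first moment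
  is too large: a point at distance \<open>N powr \<gamma>\<close> from \<open>x\<close> is high
  with conditional exponent \<open>- 2 * \<alpha>^2 * \<gamma> / (2 - \<gamma>)\<close> instead of
  \<open>- 2 * \<alpha>^2 * \<gamma>\<close>, since the field may be atypically high at intermediate
  scales. Excluding that restores the exponent. For the lower bound, regression of the field at
  nearby points on its value at \<open>x\<close> has coefficient about \<open>1 - \<beta>\<close>.
  This share of the height comes from \<open>x\<close> itself, and the recentred field must supply
  only the fraction \<open>\<beta>\<close>, as in a high point problem on a square of side
  \<open>N powr \<beta>\<close>. An \<open>o(ln N)\<close> covariance error changes probabilities by
  small powers of \<open>N\<close>, so the moment method alone cannot reach probability near one.
  Concentration repairs this: the gradient of the soft count is bounded in l^1 and the largest
  variance has order \<open>ln N\<close>, so a deviation by a fixed multiple of \<open>ln N\<close>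
  costs a power of \<open>N\<close> that is independent of the error.\<close>

lemma sum_nbrs:
  "(\<Sum>z\<in>nbrs x. f z) = f (fst x + 1, snd x) + f (fst x - 1, snd x) + f (fst x, snd x + 1) + f (fst x, snd x - 1)"
  for f :: "int \<times> int \<Rightarrow> 'b::comm_monoid_add"
  unfolding nbrs_def by (simp add: add.assoc)

lemma finite_nbrs [simp]: "finite (nbrs x)"
  by (simp add: nbrs_def)

lemma nbrs_sym: "z \<in> nbrs x \<longleftrightarrow> x \<in> nbrs z"
  by (cases x; cases z) (auto simp: nbrs_def)

lemma finite_box [simp]: "finite (box N)"
  by (simp add: box_def)

lemma intr_subset_box: "intr N \<subseteq> box N"
  by (auto simp: intr_def)

lemma finite_intr [simp]: "finite (intr N)"
  using finite_subset[OF intr_subset_box] by simp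

lemma nbrs_intr: "x \<in> intr N \<Longrightarrow> nbrs x \<subseteq> box N"
  by (auto simp: intr_def bdry_def)

lemma intr_eq: "intr N = {2..int N - 1} \<times> {2..int N - 1}"
proof (intro equalityI subsetI)
  fix x assume "x \<in> intr N"
  then have "x \<in> box N" "nbrs x \<subseteq> box N"
    using intr_subset_box nbrs_intr by blast+
  then show "x \<in> {2..int N - 1} \<times> {2..int N - 1}"
    by (cases x) (auto simp: box_def nbrs_def)
qed (auto simp: intr_def bdry_def box_def nbrs_def)

section \<open>Discrete Laplacian and maximum principle\<close>

definition lap :: "(int \<times> int \<Rightarrow> real) \<Rightarrow> int \<times> int \<Rightarrow> real" where
  "lap f x = (\<Sum>z\<in>nbrs x. f z) / 4 - f x"

lemma lap_add: "lap (\<lambda>x. f x + h x) x = lap f x + lap h x"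
  by (simp add: lap_def sum.distrib add_divide_distrib)

lemma lap_diff: "lap (\<lambda>x. f x - h x) x = lap f x - lap h x"
  by (simp add: lap_def sum_subtractf diff_divide_distrib)

lemma lap_cmult: "lap (\<lambda>x. c * f x) x = c * lap f x"
  by (simp add: lap_def sum_distrib_left right_diff_distrib)

lemma lap_sq: "lap (\<lambda>x. (real_of_int (fst x))\<^sup>2) x = 1/2"
  by (simp add: lap_def sum_nbrs power2_eq_square algebra_simps)

text \<open>A small multiple of the strictly subharmonic function $x_1^2$ rules out interior maxima.\<close>

lemma subharmonic_max:
  assumes D: "D \<subseteq> intr N"
    and sub: "\<And>x. x \<in> D \<Longrightarrow> lap v x \<ge> 0"
    and out: "\<And>x. x \<in> box N - D \<Longrightarrow> v x \<le> m"
    and x: "x \<in> box N"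
  shows "v x \<le> m"
proof -
  have *: "v x \<le> m + e * (real N)\<^sup>2" if e: "e > 0" for e :: real
  proof -
    define w where "w = (\<lambda>x. v x + e * (real_of_int (fst x))\<^sup>2)"
    have "finite (w ` box N)" "w ` box N \<noteq> {}"
      using x by auto
    from Max_in[OF this] obtain y where y: "y \<in> box N" "w y = Max (w ` box N)"
      by auto
    then have ymax: "w z \<le> w y" if "z \<in> box N" for z
      using that \<open>finite (w ` box N)\<close> by auto
    have yD: "y \<notin> D"
    proof
      assume yD: "y \<in> D"
      have "lap w y = lap v y + e / 2"
        unfolding w_def by (subst lap_add, subst lap_cmult, subst lap_sq) simp
      then have pos: "lap w y > 0"
        using sub[OF yD] e by (simp add: add_nonneg_pos)
      have "w z \<le> w y" if "z \<in> nbrs y" for z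
        using ymax nbrs_intr that yD D by blast
      then have "(\<Sum>z\<in>nbrs y. w z) \<le> (\<Sum>z\<in>nbrs y. w y)"
        by (rule sum_mono)
      then have "lap w y \<le> 0"
        unfolding lap_def sum_nbrs[of "\<lambda>_. w y"] by simp
      with pos show False by simp
    qed
    have "(real_of_int (fst y))\<^sup>2 \<le> (real N)\<^sup>2"
      using y(1) by (intro power_mono) (auto simp: box_def)
    then have "w y \<le> m + e * (real N)\<^sup>2"
      unfolding w_def using out[of y] y(1) yD e by (auto intro!: add_mono)
    moreover have "v x \<le> w x"
      using e by (simp add: w_def)
    ultimately show ?thesis
      using ymax[OF x] by linarith
  qed
  show ?thesis
  proof (rule field_le_epsilon)
    fix e :: real assume e: "e > 0"
    have "e / ((real N)\<^sup>2 + 1) * (real N)\<^sup>2 \<le> e"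
      using e by (simp add: pos_divide_le_eq add_pos_nonneg algebra_simps)
    then show "v x \<le> m + e"
      using *[of "e / ((real N)\<^sup>2 + 1)"] e by (simp add: add_pos_nonneg add_nonneg_pos)
  qed
qed

lemma superharmonic_min:
  assumes "D \<subseteq> intr N"
    and "\<And>x. x \<in> D \<Longrightarrow> lap v x \<le> 0"
    and "\<And>x. x \<in> box N - D \<Longrightarrow> m \<le> v x"
    and "x \<in> box N"
  shows "m \<le> v x"
  using subharmonic_max[of D N "\<lambda>x. - v x" "-m" x] assms lap_cmult[of "-1" v] by simp

section \<open>Killed walk: finiteness, symmetry and regularity of its Green function\<close>

lemma kill_walk_nonneg: "kill_walk N i x y \<ge> 0"
  by (induction i arbitrary: x) (auto intro!: sum_nonneg)

text \<open>The bound comes from $w(x) = N^2 - x_1^2$, whose discrete Laplacian is $-1/2$.\<close>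

lemma sum_kill_walk_le:
  assumes "x \<in> intr N"
  shows "(\<Sum>i<n. kill_walk N i x y) \<le> 2 * ((real N)\<^sup>2 - (real_of_int (fst x))\<^sup>2)"
  using assms
proof (induction n arbitrary: x)
  case 0
  have "(real_of_int (fst x))\<^sup>2 \<le> (real N)\<^sup>2"
    using 0 by (intro power_mono) (auto simp: intr_eq)
  then show ?case by simp
next
  case (Suc n)
  define w where "w = (\<lambda>x::int \<times> int. 2 * ((real N)\<^sup>2 - (real_of_int (fst x))\<^sup>2))"
  have w0: "w z \<ge> 0" if "z \<in> box N" for z
  proof -
    have "(real_of_int (fst z))\<^sup>2 \<le> (real N)\<^sup>2"
      using that by (intro power_mono) (auto simp: box_def)
    then show ?thesis by (simp add: w_def)
  qed
  have "(\<Sum>i<Suc n. kill_walk N i x y) = (if x = y then 1 else 0) + (\<Sum>i<n. (\<Sum>z\<in>nbrs x \<inter> intr N. kill_walk N i z y) / 4)"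
    by (subst sum.lessThan_Suc_shift) simp
  also have "\<dots> = (if x = y then 1 else 0) + (\<Sum>z\<in>nbrs x \<inter> intr N. (\<Sum>i<n. kill_walk N i z y)) / 4"
    by (subst sum.swap) (simp add: sum_divide_distrib)
  also have "\<dots> \<le> 1 + (\<Sum>z\<in>nbrs x \<inter> intr N. w z) / 4"
    unfolding w_def by (intro add_mono divide_right_mono sum_mono Suc.IH) auto
  also have "\<dots> \<le> 1 + (\<Sum>z\<in>nbrs x. w z) / 4"
    using nbrs_intr[OF Suc.prems] w0 by (intro add_mono divide_right_mono sum_mono2) auto
  also have "\<dots> = w x"
    unfolding sum_nbrs w_def by (simp add: power2_eq_square field_simps)
  finally show ?case by (simp add: w_def)
qed

lemma summable_kill_walk_intr: "x \<in> intr N \<Longrightarrow> summable (\<lambda>i. kill_walk N i x y)"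
  by (rule summableI_nonneg_bounded[OF kill_walk_nonneg sum_kill_walk_le])

lemma green_step:
  assumes "x \<in> intr N"
  shows "green N x y = (if x = y then 1 else 0) + (\<Sum>z\<in>nbrs x \<inter> intr N. green N z y) / 4"
proof -
  have "green N x y = (\<Sum>i. kill_walk N (Suc i) x y) + kill_walk N 0 x y"
    unfolding green_def by (subst suminf_split_head[OF summable_kill_walk_intr[OF assms]]) simp
  also have "(\<Sum>i. kill_walk N (Suc i) x y) = (\<Sum>z\<in>nbrs x \<inter> intr N. green N z y) / 4"
    unfolding green_def kill_walk.simps
    by (subst suminf_divide)
       (auto intro!: summable_sum summable_kill_walk_intr suminf_sum simp del: kill_walk.simps)
  finally show ?thesis by simp
qed

text \<open>\<open>kill_walk\<close> recurses on the first step. Decomposing at the last step is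
  what makes symmetry provable by induction, because reversal exchanges the two
  decompositions.\<close>

lemma kill_walk_Suc_right:
  assumes "x \<in> intr N" "y \<in> intr N"
  shows "kill_walk N (Suc i) x y = (\<Sum>w\<in>nbrs y \<inter> intr N. kill_walk N i x w) / 4"
  using assms(1)
proof (induction i arbitrary: x)
  case 0
  have "(\<Sum>z\<in>nbrs x \<inter> intr N. if z = y then 1 else 0 :: real) = (if y \<in> nbrs x then 1 else 0)"
    using assms(2) by (subst sum.delta) auto
  moreover have "(\<Sum>w\<in>nbrs y \<inter> intr N. if x = w then 1 else 0 :: real) = (if x \<in> nbrs y then 1 else 0)"
    using 0 by (subst sum.delta') auto
  ultimately show ?case
    using nbrs_sym[of x y] by simp
next
  case (Suc i)
  have "kill_walk N (Suc (Suc i)) x y = (\<Sum>z\<in>nbrs x \<inter> intr N. (\<Sum>w\<in>nbrs y \<inter> intr N. kill_walk N i z w) / 4) / 4"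
    using Suc.IH by (subst kill_walk.simps(2)) (auto intro!: sum.cong simp del: kill_walk.simps)
  also have "\<dots> = (\<Sum>w\<in>nbrs y \<inter> intr N. (\<Sum>z\<in>nbrs x \<inter> intr N. kill_walk N i z w) / 4) / 4"
    by (subst sum_divide_distrib[symmetric], subst sum.swap) (simp add: sum_divide_distrib)
  finally show ?case by simp
qed

lemma kill_walk_sym:
  assumes "x \<in> intr N" "y \<in> intr N"
  shows "kill_walk N i x y = kill_walk N i y x"
  using assms
proof (induction i arbitrary: x y)
  case (Suc i)
  have "kill_walk N (Suc i) x y = (\<Sum>z\<in>nbrs x \<inter> intr N. kill_walk N i y z) / 4"
    using Suc by (subst kill_walk.simps(2)) (auto intro!: sum.cong)
  also have "\<dots> = kill_walk N (Suc i) y x"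
    using kill_walk_Suc_right[OF Suc.prems(2,1)] by simp
  finally show ?case .
qed auto

lemma green_sym: "x \<in> intr N \<Longrightarrow> y \<in> intr N \<Longrightarrow> green N x y = green N y x"
  unfolding green_def using kill_walk_sym by presburger

text \<open>Off the interior \<^const>\<open>green\<close> need not vanish: there the recursion of \<^const>\<open>kill_walk\<close>
  still lets the walk step inside.\<close>

definition green0 :: "nat \<Rightarrow> int \<times> int \<Rightarrow> int \<times> int \<Rightarrow> real" where
  "green0 N x y = (if x \<in> intr N then green N x y else 0)"

lemma green0_nonneg: "green0 N x y \<ge> 0"
  unfolding green0_def green_def
  using suminf_nonneg[OF summable_kill_walk_intr kill_walk_nonneg] by auto

lemma lap_green0:
  assumes "x \<in> intr N"
  shows "lap (\<lambda>z. green0 N z y) x = (if x = y then - 1 else 0)"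
proof -
  have "(\<Sum>z\<in>nbrs x. green0 N z y) = (\<Sum>z\<in>nbrs x \<inter> intr N. green N z y)"
    unfolding green0_def by (simp add: sum.If_cases Int_def)
  then show ?thesis
    using green_step[OF assms, of y] assms by (simp add: lap_def green0_def)
qed

text \<open>In its first argument the Green function is harmonic off the pole and zero off the
  interior, so the maximum principle leaves only the pole.\<close>

lemma green0_le_diag:
  assumes "y \<in> intr N" "z \<in> box N"
  shows "green0 N z y \<le> green0 N y y"
proof (rule subharmonic_max[where v="\<lambda>z. green0 N z y", OF _ _ _ assms(2)])
  show "intr N - {y} \<subseteq> intr N" by auto
  show "0 \<le> lap (\<lambda>z. green0 N z y) x" if "x \<in> intr N - {y}" for x
    using that by (simp add: lap_green0)
  show "green0 N x y \<le> green0 N y y" if "x \<in> box N - (intr N - {y})" for x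
    using that green0_nonneg[of N y y] by (cases "x = y") (auto simp: green0_def)
qed

text \<open>The four differences are nonnegative by \<open>green0_le_diag\<close>, and their average
  is the unit charge at the pole; hence each is at most 4.\<close>

lemma green0_nbr_diag:
  assumes "y \<in> intr N" "z \<in> nbrs y"
  shows "green0 N y y - green0 N z y \<le> 4"
proof -
  define d where "d = (\<lambda>z. green0 N y y - green0 N z y)"
  have "(\<Sum>w\<in>nbrs y. d w) / 4 = 1"
    using lap_green0[OF assms(1), of y] unfolding lap_def d_def sum_nbrs by (simp add: field_simps)
  moreover have "d z \<le> (\<Sum>w\<in>nbrs y. d w)"
    using green0_le_diag[OF assms(1)] nbrs_intr[OF assms(1)] assms(2)
    by (intro member_le_sum) (auto simp: d_def)
  ultimately show ?thesis by (simp add: d_def)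
qed

text \<open>In \<open>x\<close> the difference is subharmonic away from \<open>w\<close>, since the
  pole at \<open>w'\<close> enters with the favourable sign, and it vanishes off the interior. So
  the value at \<open>w\<close> decides, and symmetry reduces it to \<open>green0_nbr_diag\<close>.
  The bound is uniform in \<open>N\<close>, which makes it useful against a Green function of order
  \<open>ln N\<close>.\<close>

lemma green0_nbr_diff_le:
  assumes w: "w \<in> intr N" "w' \<in> intr N" "w' \<in> nbrs w" and x: "x \<in> box N"
  shows "green0 N x w - green0 N x w' \<le> 4"
proof (rule subharmonic_max[where v="\<lambda>x. green0 N x w - green0 N x w'", OF _ _ _ x])
  show "intr N - {w} \<subseteq> intr N" by auto
  show "0 \<le> lap (\<lambda>x. green0 N x w - green0 N x w') x" if "x \<in> intr N - {w}" for x
    using that by (simp add: lap_diff lap_green0)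
  show "green0 N x w - green0 N x w' \<le> 4" if "x \<in> box N - (intr N - {w})" for x
  proof (cases "x = w")
    case True
    then show ?thesis
      using green0_nbr_diag[OF w(1,3)] green_sym[OF w(1,2)] w by (simp add: green0_def)
  qed (use that in \<open>auto simp: green0_def\<close>)
qed

lemma green0_nbr_abs:
  assumes "w \<in> intr N" "w' \<in> intr N" "w' \<in> nbrs w" "x \<in> box N"
  shows "\<bar>green0 N x w - green0 N x w'\<bar> \<le> 4"
  using green0_nbr_diff_le[OF assms] green0_nbr_diff_le[OF assms(2,1) _ assms(4)] assms(3) nbrs_sym[of w w']
  by linarith

lemma green0_horiz:
  assumes "x \<in> box N" "(a, b) \<in> intr N" "(a + int n, b) \<in> intr N"
  shows "\<bar>green0 N x (a + int n, b) - green0 N x (a, b)\<bar> \<le> 4 * real n"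
  using assms(3)
proof (induction n)
  case (Suc n)
  have i: "(a + int n, b) \<in> intr N"
    using Suc.prems assms(2) by (auto simp: intr_eq)
  have "\<bar>green0 N x (a + int (Suc n), b) - green0 N x (a + int n, b)\<bar> \<le> 4"
    using green0_nbr_abs[OF Suc.prems i _ assms(1)] by (simp add: nbrs_def)
  with Suc.IH[OF i] show ?case by simp
qed simp

lemma green0_vert:
  assumes "x \<in> box N" "(a, b) \<in> intr N" "(a, b + int n) \<in> intr N"
  shows "\<bar>green0 N x (a, b + int n) - green0 N x (a, b)\<bar> \<le> 4 * real n"
  using assms(3)
proof (induction n)
  case (Suc n)
  have i: "(a, b + int n) \<in> intr N"
    using Suc.prems assms(2) by (auto simp: intr_eq)
  have "\<bar>green0 N x (a, b + int (Suc n)) - green0 N x (a, b + int n)\<bar> \<le> 4"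
    using green0_nbr_abs[OF Suc.prems i _ assms(1)] by (simp add: nbrs_def)
  with Suc.IH[OF i] show ?case by simp
qed simp

text \<open>The interior is a product of intervals, so an axis-parallel path from \<open>y\<close>
  to \<open>z\<close> with one corner stays inside it, and the unit-step bounds add up along the
  path.\<close>

lemma green0_lipschitz:
  assumes x: "x \<in> box N" and y: "y \<in> intr N" and z: "z \<in> intr N"
  shows "\<bar>green0 N x z - green0 N x y\<bar> \<le> 4 * real_of_int (\<bar>fst z - fst y\<bar> + \<bar>snd z - snd y\<bar>)"
proof -
  obtain a b where yab: "y = (a, b)" by (cases y)
  obtain c d where zcd: "z = (c, d)" by (cases z)
  have m: "(c, b) \<in> intr N"
    using y z by (auto simp: intr_eq yab zcd)
  have 1: "\<bar>green0 N x (c, b) - green0 N x (a, b)\<bar> \<le> 4 * real_of_int \<bar>c - a\<bar>"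
  proof (cases "a \<le> c")
    case True
    then show ?thesis
      using green0_horiz[OF x, of a b "nat (c - a)"] y m by (simp add: yab)
  next
    case False
    then show ?thesis
      using green0_horiz[OF x, of c b "nat (a - c)"] y m by (simp add: yab abs_minus_commute)
  qed
  have 2: "\<bar>green0 N x (c, d) - green0 N x (c, b)\<bar> \<le> 4 * real_of_int \<bar>d - b\<bar>"
  proof (cases "b \<le> d")
    case True
    then show ?thesis
      using green0_vert[OF x, of c b "nat (d - b)"] z m by (simp add: zcd)
  next
    case False
    then show ?thesis
      using green0_vert[OF x, of c d "nat (b - d)"] z m by (simp add: zcd abs_minus_commute)
  qed
  from 1 2 show ?thesis
    unfolding yab zcd fst_conv snd_conv of_int_add distrib_left by linarith
qed

section \<open>The lattice logarithm\<close>

text \<open>The 1 under the logarithm removes the singularity at the origin and makes the Laplacian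
  nonnegative at every site, so its values can be read as charges of one sign.\<close>

definition logw :: "int \<times> int \<Rightarrow> real" where
  "logw w = ln ((real_of_int (fst w))\<^sup>2 + (real_of_int (snd w))\<^sup>2 + 1) / 2"

lemma sq_sum_pos: "(a::real)\<^sup>2 + b\<^sup>2 + 1 > 0"
  by (simp add: add_nonneg_pos)

text \<open>The four logarithms merge into the logarithm of one polynomial. It is \<open>r^4\<close>
  plus lower terms without a cubic one; this cancellation reflects the harmonicity of ln|x| in the
  plane and makes the Laplacian of order \<open>r^-2\<close> instead of \<open>r^-1\<close>.\<close>

lemma lap_logw_eq:
  fixes w defines "a \<equiv> real_of_int (fst w)" and "b \<equiv> real_of_int (snd w)"
  defines "r \<equiv> a\<^sup>2 + b\<^sup>2 + 1"
  shows "lap logw w = (ln (r^4 + 2 * r\<^sup>2 + 8 * r + 5 + 16 * a\<^sup>2 * b\<^sup>2) - 4 * ln r) / 8"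
proof -
  have r: "r > 0" unfolding r_def by (rule sq_sum_pos)
  let ?p = "\<lambda>a b. a\<^sup>2 + b\<^sup>2 + 1 :: real"
  have "lap logw w = (ln (?p (a+1) b) + ln (?p (a-1) b) + ln (?p a (b+1)) + ln (?p a (b-1)) - 4 * ln r) / 8"
    by (simp add: lap_def sum_nbrs logw_def a_def b_def r_def field_simps)
  also have "ln (?p (a+1) b) + ln (?p (a-1) b) + ln (?p a (b+1)) + ln (?p a (b-1))
      = ln (?p (a+1) b * ?p (a-1) b * ?p a (b+1) * ?p a (b-1))"
    by (simp add: ln_mult sq_sum_pos less_imp_neq[OF sq_sum_pos, symmetric])
  also have "?p (a+1) b * ?p (a-1) b * ?p a (b+1) * ?p a (b-1) = r^4 + 2 * r\<^sup>2 + 8 * r + 5 + 16 * a\<^sup>2 * b\<^sup>2"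
    unfolding r_def by algebra
  finally show ?thesis .
qed

lemma lap_logw_bounds:
  fixes w defines "r \<equiv> (real_of_int (fst w))\<^sup>2 + (real_of_int (snd w))\<^sup>2 + 1"
  shows "0 \<le> lap logw w" "lap logw w \<le> 3 / r\<^sup>2"
proof -
  define a b where "a = real_of_int (fst w)" and "b = real_of_int (snd w)"
  define P where "P = r^4 + 2 * r\<^sup>2 + 8 * r + 5 + 16 * a\<^sup>2 * b\<^sup>2"
  have eq: "lap logw w = (ln P - 4 * ln r) / 8"
    unfolding P_def r_def a_def b_def by (rule lap_logw_eq)
  have r1: "r \<ge> 1" by (simp add: r_def)
  have "r^4 \<le> P" using r1 by (simp add: P_def)
  moreover have r4: "r^4 > 0" using r1 by simp
  ultimately have "ln (r^4) \<le> ln P" by (subst ln_le_cancel_iff) linarith+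
  also have "ln (r^4) = 4 * ln r" using r1 by (simp add: ln_realpow)
  finally show "0 \<le> lap logw w" by (simp add: eq)
  have ab: "16 * a\<^sup>2 * b\<^sup>2 \<le> 4 * r\<^sup>2"
  proof -
    have "4 * (a\<^sup>2 * b\<^sup>2) \<le> (a\<^sup>2 + b\<^sup>2)\<^sup>2"
      using zero_le_power2[of "a\<^sup>2 - b\<^sup>2"] by (simp add: power2_eq_square algebra_simps)
    also have "\<dots> \<le> r\<^sup>2" unfolding r_def a_def b_def by (intro power_mono) auto
    finally show ?thesis by simp
  qed
  have rr: "r \<le> r\<^sup>2" "1 \<le> r\<^sup>2" using r1 by (auto simp: power2_eq_square mult_le_cancel_left1 mult_ge1_I)
  have "P > 0" using \<open>r^4 \<le> P\<close> r4 by linarith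
  have "ln P - 4 * ln r = ln (P / r^4)"
    using \<open>P > 0\<close> r4 r1 by (simp add: ln_div ln_realpow)
  also have "\<dots> \<le> P / r^4 - 1"
    using \<open>P > 0\<close> r4 by (intro ln_le_minus_one) simp
  also have "\<dots> = (P - r^4) / r^4" using r4 by (simp add: field_simps)
  \<comment> \<open>As \<open>r\<close> is at least 1, the lower terms total at most
    \<open>(2 + 8 + 5 + 4) * r^2\<close>; 24 is a round bound that the division by 8 turns into
    3.\<close>
  also have "\<dots> \<le> 24 * r\<^sup>2 / r^4"
    using r4 ab rr by (intro divide_right_mono) (auto simp: P_def)
  also have "\<dots> = 24 / r\<^sup>2" using r1 by (simp add: power2_eq_square power4_eq_xxxx field_simps)
  finally show "lap logw w \<le> 3 / r\<^sup>2" by (simp add: eq)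
qed

section \<open>Total mass and first moment of the Laplacian of the lattice logarithm\<close>

lemma sum_telescope_sym:
  fixes F :: "int \<Rightarrow> real"
  shows "(\<Sum>a=-int n..int n. F (a + 1) - F a) = F (int n + 1) - F (- int n)"
proof (induction n)
  case (Suc n)
  have "{- int (Suc n)..int (Suc n)} = insert (- int n - 1) (insert (int n + 1) {- int n..int n})"
    by auto
  moreover have "F (- 1 - int n) = F (- int n - 1)"
    by (rule arg_cong[of _ _ F]) simp
  ultimately show ?case using Suc by (simp add: algebra_simps)
qed simp

text \<open>Discrete divergence theorem on a square: second differences telescope in each direction
  and leave the boundary flux. By reflection all four sides contribute equally, and this factor
  cancels the 1/4 in \<open>lap\<close>.\<close>

lemma sum_lap_logw:
  "(\<Sum>w\<in>{-int n..int n} \<times> {-int n..int n}. lap logw w)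
     = (\<Sum>j=-int n..int n. logw (int n + 1, j) - logw (int n, j))"
proof -
  let ?I = "{-int n..int n}"
  let ?T = "\<Sum>j\<in>?I. logw (int n + 1, j) - logw (int n, j)"
  have s: "logw (a, b) = logw (b, a)" "logw (- a, b) = logw (a, b)" "logw (-a - 1, b) = logw (a + 1, b)" for a b
    by (simp_all add: logw_def power2_eq_square algebra_simps)
  have 1: "(\<Sum>a\<in>?I. (logw (a + 1, b) - logw (a, b)) - (logw (a, b) - logw (a - 1, b)))
      = 2 * (logw (int n + 1, b) - logw (int n, b))" for b
  proof -
    have "logw (- int n, b) = logw (int n, b)" "logw (- int n - 1, b) = logw (int n + 1, b)"
      by (rule s)+
    then show ?thesis
      using sum_telescope_sym[where F="\<lambda>a. logw (a, b) - logw (a - 1, b)" and n=n] by simp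
  qed
  have "4 * (\<Sum>w\<in>?I \<times> ?I. lap logw w)
      = (\<Sum>a\<in>?I. \<Sum>b\<in>?I. ((logw (a + 1, b) - logw (a, b)) - (logw (a, b) - logw (a - 1, b)))
         + ((logw (b + 1, a) - logw (b, a)) - (logw (b, a) - logw (b - 1, a))))"
    unfolding sum.cartesian_product sum_distrib_left
  proof (intro sum.cong refl)
    fix w :: "int \<times> int"
    obtain a b where w: "w = (a, b)" by (cases w)
    have "logw (a + 1, b) + logw (a - 1, b) + logw (a, b + 1) + logw (a, b - 1) - 4 * logw (a, b)
       = logw (a + 1, b) - logw (a, b) - (logw (a, b) - logw (a - 1, b)) +
           (logw (b + 1, a) - logw (b, a) - (logw (b, a) - logw (b - 1, a)))"
      using s(1)[of a "b+1"] s(1)[of a "b-1"] s(1)[of a b] by simp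
    then show "4 * lap logw w = (case w of (a, b) \<Rightarrow> ((logw (a + 1, b) - logw (a, b)) - (logw (a, b) - logw (a - 1, b)))
         + ((logw (b + 1, a) - logw (b, a)) - (logw (b, a) - logw (b - 1, a))))"
      by (simp add: w lap_def sum_nbrs)
  qed
  also have "\<dots> = (\<Sum>b\<in>?I. \<Sum>a\<in>?I. (logw (a + 1, b) - logw (a, b)) - (logw (a, b) - logw (a - 1, b)))
      + (\<Sum>a\<in>?I. \<Sum>b\<in>?I. (logw (b + 1, a) - logw (b, a)) - (logw (b, a) - logw (b - 1, a)))"
    by (subst sum.swap) (simp only: sum.distrib)
  also have "\<dots> = 4 * ?T"
    unfolding 1 by (simp add: sum_distrib_left)
  finally show ?thesis by simp
qed

text \<open>Mean value theorem for \<open>arctan (t / m)\<close>, whose derivative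
  \<open>m / (m^2 + t^2)\<close> is decreasing on \<open>[j, j + 1]\<close>.\<close>

lemma arctan_step:
  fixes m j :: real
  assumes "m > 0" "j \<ge> 0"
  shows "arctan ((j + 1) / m) - arctan (j / m) \<le> m / (m\<^sup>2 + j\<^sup>2)"
    and "m / (m\<^sup>2 + (j + 1)\<^sup>2) \<le> arctan ((j + 1) / m) - arctan (j / m)"
proof -
  have lt: "j / m < (j + 1) / m" using assms by (simp add: divide_strict_right_mono)
  have "\<exists>z. j / m < z \<and> z < (j + 1) / m \<and>
      arctan ((j + 1) / m) - arctan (j / m) = ((j + 1) / m - j / m) * inverse (1 + z\<^sup>2)"
    by (rule MVT2[OF lt]) (rule DERIV_arctan)
  then obtain z where z: "j / m < z" "z < (j + 1) / m"
      "arctan ((j + 1) / m) - arctan (j / m) = ((j + 1) / m - j / m) * inverse (1 + z\<^sup>2)"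
    by blast
  have d: "arctan ((j + 1) / m) - arctan (j / m) = (1 / m) / (1 + z\<^sup>2)"
    unfolding z(3) using assms by (simp add: field_simps)
  have z0: "j / m \<ge> 0" using assms by simp
  with z(1) have "z \<ge> 0" by linarith
  have "(1 / m) / (1 + z\<^sup>2) \<le> (1 / m) / (1 + (j / m)\<^sup>2)"
    using z z0 \<open>z \<ge> 0\<close> assms by (intro divide_left_mono add_mono power_mono mult_pos_pos) (auto simp: add_pos_nonneg)
  also have "\<dots> = m / (m\<^sup>2 + j\<^sup>2)"
    using assms by (simp add: field_simps power2_eq_square)
  finally show "arctan ((j + 1) / m) - arctan (j / m) \<le> m / (m\<^sup>2 + j\<^sup>2)" by (simp add: d)
  have "m / (m\<^sup>2 + (j + 1)\<^sup>2) = (1 / m) / (1 + ((j + 1) / m)\<^sup>2)"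
    using assms by (simp add: field_simps power2_eq_square)
  also have "\<dots> \<le> (1 / m) / (1 + z\<^sup>2)"
    using z z0 \<open>z \<ge> 0\<close> assms by (intro divide_left_mono add_mono power_mono mult_pos_pos) (auto simp: add_pos_nonneg)
  finally show "m / (m\<^sup>2 + (j + 1)\<^sup>2) \<le> arctan ((j + 1) / m) - arctan (j / m)" by (simp add: d)
qed

text \<open>The steps telescope to \<open>arctan 1\<close>, the angle that half a side of the square
  subtends at its centre.\<close>

lemma riemann_arctan:
  assumes "m > 0"
  shows "pi / 4 \<le> (\<Sum>j<m. real m / ((real m)\<^sup>2 + (real j)\<^sup>2))"
    and "(\<Sum>j<m. real m / ((real m)\<^sup>2 + (real (Suc j))\<^sup>2)) \<le> pi / 4"
proof -
  have t: "(\<Sum>j<m. arctan ((real j + 1) / m) - arctan (real j / m)) = pi / 4"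
    using sum_lessThan_telescope[of "\<lambda>j. arctan (real j / m)" m] assms
    by (simp add: add.commute arctan_one)
  have "(\<Sum>j<m. arctan ((real j + 1) / m) - arctan (real j / m)) \<le> (\<Sum>j<m. real m / ((real m)\<^sup>2 + (real j)\<^sup>2))"
    using assms by (intro sum_mono arctan_step) auto
  with t show "pi / 4 \<le> (\<Sum>j<m. real m / ((real m)\<^sup>2 + (real j)\<^sup>2))" by simp
  have "(\<Sum>j<m. real m / ((real m)\<^sup>2 + (real j + 1)\<^sup>2)) \<le> (\<Sum>j<m. arctan ((real j + 1) / m) - arctan (real j / m))"
    using assms by (intro sum_mono arctan_step) auto
  with t show "(\<Sum>j<m. real m / ((real m)\<^sup>2 + (real (Suc j))\<^sup>2)) \<le> pi / 4"
    by (simp add: add.commute)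
qed

text \<open>Both bounds are \<open>ln t <= t - 1\<close>, for a quotient and for its inverse. The
  upper one is expressed through \<open>n\<close> and the lower one through \<open>n + 1\<close>, so
  that each meets a Riemann sum of \<open>riemann_arctan\<close> with \<open>m = n\<close> or
  \<open>m = n + 1\<close>.\<close>

lemma logw_diff_bounds:
  assumes "n > 0"
  shows "logw (int n + 1, j) - logw (int n, j) \<le> (real n + 1/2) / ((real n)\<^sup>2 + (real_of_int j)\<^sup>2)"
    and "((real n + 1) - 1/2) / ((real n + 1)\<^sup>2 + (real_of_int j)\<^sup>2 + 1) \<le> logw (int n + 1, j) - logw (int n, j)"
proof -
  define A where "A = (real n)\<^sup>2 + (real_of_int j)\<^sup>2 + 1"
  define B where "B = (real n + 1)\<^sup>2 + (real_of_int j)\<^sup>2 + 1"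
  define D where "D = (real n)\<^sup>2 + (real_of_int j)\<^sup>2"
  have A: "A > 0" and B: "B > 0" unfolding A_def B_def by (rule sq_sum_pos)+
  have BA: "B - A = 2 * real n + 1" by (simp add: A_def B_def power2_eq_square algebra_simps)
  have eq: "logw (int n + 1, j) - logw (int n, j) = (ln B - ln A) / 2"
    by (simp add: logw_def A_def B_def diff_divide_distrib add.commute)
  have "ln B - ln A = ln (B / A)" using A B by (simp add: ln_div)
  also have "\<dots> \<le> B / A - 1" using A B by (intro ln_le_minus_one) simp
  also have "\<dots> = (2 * real n + 1) / A" using A BA by (simp add: field_simps)
  also have "\<dots> \<le> (2 * real n + 1) / D"
    unfolding D_def using assms A by (intro divide_left_mono mult_pos_pos) (auto simp: A_def add_pos_nonneg)
  finally show "logw (int n + 1, j) - logw (int n, j) \<le> (real n + 1/2) / ((real n)\<^sup>2 + (real_of_int j)\<^sup>2)"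
    unfolding eq D_def[symmetric] by (simp add: add_divide_distrib mult.commute)
  have "ln A - ln B = ln (A / B)" using A B by (simp add: ln_div)
  also have "\<dots> \<le> A / B - 1" using A B by (intro ln_le_minus_one) simp
  also have "\<dots> = - (2 * real n + 1) / B" using B BA by (simp add: field_simps)
  finally show "((real n + 1) - 1/2) / ((real n + 1)\<^sup>2 + (real_of_int j)\<^sup>2 + 1) \<le> logw (int n + 1, j) - logw (int n, j)"
    unfolding eq B_def[symmetric] by (simp add: add_divide_distrib diff_divide_distrib)
qed

lemma sum_sym_int:
  fixes T :: "int \<Rightarrow> real"
  assumes "\<And>j. T (-j) = T j"
  shows "(\<Sum>j=-int n..int n. T j) = T 0 + 2 * (\<Sum>j<n. T (int (Suc j)))"
proof (induction n)
  case (Suc n)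
  have "{- int (Suc n)..int (Suc n)} = insert (- (int n + 1)) (insert (int n + 1) {- int n..int n})"
    by auto
  moreover have "T (- 1 - int n) = T (1 + int n)"
    using assms[of "1 + int n"] by simp
  ultimately show ?case using Suc by (simp add: algebra_simps)
qed simp

text \<open>By \<open>sum_lap_logw\<close> the mass is the flux through one side, that is, through
  two half sides of angle pi/4 each. Its reciprocal is the constant \<open>gconst\<close>.\<close>

lemma lap_logw_mass:
  "(\<lambda>n. \<Sum>w\<in>{-int n..int n} \<times> {-int n..int n}. lap logw w) \<longlonglongrightarrow> pi / 2"
proof (rule real_tendsto_sandwich)
  let ?S = "\<lambda>n. \<Sum>w\<in>{-int n..int n} \<times> {-int n..int n}. lap logw w"
  define T where "T = (\<lambda>n j. logw (int n + 1, j) - logw (int n, j))"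
  have S: "?S n = T n 0 + 2 * (\<Sum>j<n. T n (int (Suc j)))" for n
    unfolding sum_lap_logw T_def by (rule sum_sym_int) (simp add: logw_def)
  define U where "U = (\<lambda>n::nat. (1 + 1 / (2 * real n)) * (1 / real n + pi / 2))"
  \<comment> \<open>The lower Riemann estimate bounds \<open>T n 0\<close> plus one half of the
    remaining sum. Doubling it counts \<open>T n 0\<close> once too often, so the upper bound for
    \<open>T n 0\<close> is subtracted.\<close>
  define V where "V = (\<lambda>n::nat. (1 - 1 / (2 * (real n + 1))) * ((real n + 1)\<^sup>2 / ((real n + 1)\<^sup>2 + 1)) * (pi / 2)
      - (real n + 1/2) / (real n)\<^sup>2)"
  have T0: "T n 0 \<le> (real n + 1/2) / (real n)\<^sup>2" if "n > 0" for n
    using logw_diff_bounds(1)[OF that, of 0] by (simp add: T_def)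
  show "\<forall>\<^sub>F n in sequentially. ?S n \<le> U n"
    using eventually_gt_at_top[of 0]
  proof eventually_elim
    case (elim n)
    have "(\<Sum>j<n. T n (int (Suc j))) \<le> (\<Sum>j<n. (1 + 1 / (2 * real n)) * (real n / ((real n)\<^sup>2 + (real (Suc j))\<^sup>2)))"
    proof (rule sum_mono)
      fix j
      have "T n (int (Suc j)) \<le> (real n + 1/2) / ((real n)\<^sup>2 + (real (Suc j))\<^sup>2)"
        unfolding T_def using logw_diff_bounds(1)[OF elim, of "int (Suc j)"] by simp
      also have "real n + 1/2 = (1 + 1 / (2 * real n)) * real n" using elim by (simp add: field_simps)
      finally show "T n (int (Suc j)) \<le> (1 + 1 / (2 * real n)) * (real n / ((real n)\<^sup>2 + (real (Suc j))\<^sup>2))" by simp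
    qed
    also have "\<dots> \<le> (1 + 1 / (2 * real n)) * (pi / 4)"
      unfolding sum_distrib_left[symmetric] by (intro mult_left_mono riemann_arctan elim) simp
    finally have "2 * (\<Sum>j<n. T n (int (Suc j))) \<le> (1 + 1 / (2 * real n)) * (pi / 2)" by simp
    moreover have "(real n + 1/2) / (real n)\<^sup>2 = (1 + 1 / (2 * real n)) * (1 / real n)"
      using elim by (simp add: field_simps power2_eq_square)
    ultimately show ?case
      using T0[OF elim] unfolding S U_def distrib_left by (metis add_mono)
  qed
  show "\<forall>\<^sub>F n in sequentially. V n \<le> ?S n"
    using eventually_gt_at_top[of 0]
  proof eventually_elim
    case (elim n)
    define m where "m = Suc n"
    have m: "real n + 1 = real m" "m > 0" by (simp_all add: m_def)
    have "(1 - 1 / (2 * real m)) * ((real m)\<^sup>2 / ((real m)\<^sup>2 + 1)) * (pi / 4)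
       \<le> (1 - 1 / (2 * real m)) * ((real m)\<^sup>2 / ((real m)\<^sup>2 + 1)) * (\<Sum>j<m. real m / ((real m)\<^sup>2 + (real j)\<^sup>2))"
    proof (intro mult_left_mono riemann_arctan(1) mult_nonneg_nonneg m)
      show "0 \<le> 1 - 1 / (2 * real m)" using m by (simp add: field_simps)
    qed simp
    also have "\<dots> \<le> (\<Sum>j<m. T n (int j))"
      unfolding sum_distrib_left
    proof (rule sum_mono)
      fix j
      let ?q = "(real m)\<^sup>2 + (real j)\<^sup>2"
      have q: "?q \<ge> (real m)\<^sup>2" "(real m)\<^sup>2 > 0" using m by auto
      \<comment> \<open>The factor \<open>q / (q + 1)\<close> removes the 1 from the denominator in
        \<open>logw_diff_bounds\<close>. It increases with \<open>q\<close>, so its value at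
        \<open>j = 0\<close> bounds it below and can leave the sum.\<close>
      have "(real m)\<^sup>2 / ((real m)\<^sup>2 + 1) \<le> ?q / (?q + 1)"
      proof -
        have "x / (x + 1) \<le> y / (y + 1)" if "0 < x" "x \<le> y" for x y :: real
          using that by (simp add: divide_simps) (simp add: algebra_simps)
        then show ?thesis using q by blast
      qed
      then have "(1 - 1 / (2 * real m)) * real m / ?q * ((real m)\<^sup>2 / ((real m)\<^sup>2 + 1)) \<le>
         (1 - 1 / (2 * real m)) * real m / ?q * (?q / (?q + 1))"
      proof (rule mult_left_mono)
        have "0 \<le> 1 - 1 / (2 * real m)" using m by (simp add: field_simps)
        then show "0 \<le> (1 - 1 / (2 * real m)) * real m / ?q" by simp
      qed
      also have "\<dots> = (real m - 1/2) / (?q + 1)"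
      proof -
        have "?q \<noteq> 0" using q by linarith
        have e: "(1 - 1 / (2 * real m)) * real m = real m - 1/2" using m by (simp add: field_simps)
        show ?thesis unfolding e using \<open>?q \<noteq> 0\<close> by simp
      qed
      also have "\<dots> \<le> T n (int j)"
        using logw_diff_bounds(2)[OF elim, of "int j"] unfolding T_def m by simp
      finally show "(1 - 1 / (2 * real m)) * ((real m)\<^sup>2 / ((real m)\<^sup>2 + 1)) * (real m / ?q) \<le> T n (int j)"
        by (simp add: mult_ac)
    qed
    also have "\<dots> = T n 0 + (\<Sum>j<n. T n (int (Suc j)))"
      unfolding m_def by (subst sum.lessThan_Suc_shift) simp
    finally have finale: "(1 - 1 / (2 * real m)) * ((real m)\<^sup>2 / ((real m)\<^sup>2 + 1)) * (pi / 4)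
       \<le> T n 0 + (\<Sum>j<n. T n (int (Suc j)))" .
    show ?case
    proof -
      have "k * (pi / 2) - t \<le> a + 2 * s" if "k * (pi / 4) \<le> a + s" "a \<le> t" for k t a s :: real
        using that by linarith
      from this[OF _ T0[OF elim]] show ?thesis
        using finale unfolding S V_def m by blast
    qed
  qed
  show "U \<longlonglongrightarrow> pi / 2" unfolding U_def by real_asymp
  show "V \<longlonglongrightarrow> pi / 2" unfolding V_def by real_asymp
qed

text \<open>Bounds the cost of moving the whole charge to its centre when it acts on a Lipschitz
  function. The summand is at most \<open>6 * r powr (- 3/2)\<close>, and
  \<open>r^2 >= (1 + a^2) * (1 + b^2)\<close> separates the variables, leaving the square of a
  convergent one-dimensional sum.\<close>

lemma lap_logw_first_moment:
  "\<exists>C. \<forall>n. (\<Sum>w\<in>{-int n..int n} \<times> {-int n..int n}. real_of_int (\<bar>fst w\<bar> + \<bar>snd w\<bar>) * lap logw w) \<le> C"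
proof -
  define p where "p = (\<lambda>a::int. (1 + (real_of_int a)\<^sup>2) powr (- 3/4))"
  have sm: "summable (\<lambda>k. real k powr (- 3/2))"
    by (simp add: summable_real_powr_iff)
  define s where "s = (\<Sum>k. real k powr (- 3/2))"
  have ps: "(\<Sum>a=-int n..int n. p a) \<le> 1 + 2 * s" for n
  proof -
    have "(\<Sum>a=-int n..int n. p a) = 1 + 2 * (\<Sum>j<n. p (int (Suc j)))"
      by (subst sum_sym_int) (auto simp: p_def)
    also have "(\<Sum>j<n. p (int (Suc j))) \<le> (\<Sum>j<n. real (Suc j) powr (- 3/2))"
    proof (rule sum_mono)
      fix j
      have "p (int (Suc j)) \<le> ((real (Suc j))\<^sup>2) powr (- 3/4)"
        unfolding p_def by (intro powr_mono2') auto
      also have "\<dots> = real (Suc j) powr (- 3/2)"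
      proof -
        have "(real (Suc j))\<^sup>2 = real (Suc j) powr 2" by (subst powr_numeral) auto
        then show ?thesis by (simp only: powr_powr) simp
      qed
      finally show "p (int (Suc j)) \<le> real (Suc j) powr (- 3/2)" .
    qed
    also have "\<dots> \<le> (\<Sum>j<Suc n. real j powr (- 3/2))"
      by (subst sum.lessThan_Suc_shift) simp
    also have "\<dots> \<le> s"
      unfolding s_def by (intro sum_le_suminf sm) auto
    finally show ?thesis by simp
  qed
  have "(\<Sum>w\<in>{-int n..int n} \<times> {-int n..int n}. real_of_int (\<bar>fst w\<bar> + \<bar>snd w\<bar>) * lap logw w)
      \<le> 6 * (1 + 2 * s)\<^sup>2" for n
  proof -
    have t: "real_of_int (\<bar>fst w\<bar> + \<bar>snd w\<bar>) * lap logw w \<le> 6 * (p (fst w) * p (snd w))" for w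
    proof -
      define a b where "a = real_of_int (fst w)" and "b = real_of_int (snd w)"
      define r where "r = a\<^sup>2 + b\<^sup>2 + 1"
      have r1: "r \<ge> 1" by (simp add: r_def)
      have "\<bar>a\<bar> \<le> sqrt r" "\<bar>b\<bar> \<le> sqrt r"
        unfolding r_def by (auto intro!: real_le_rsqrt)
      then have n: "\<bar>a\<bar> + \<bar>b\<bar> \<le> 2 * sqrt r" by simp
      have "real_of_int (\<bar>fst w\<bar> + \<bar>snd w\<bar>) * lap logw w \<le> (\<bar>a\<bar> + \<bar>b\<bar>) * (3 / r\<^sup>2)"
        using lap_logw_bounds[of w] unfolding r_def a_def b_def by (intro mult_mono) auto
      also have "\<dots> \<le> (2 * sqrt r) * (3 / r\<^sup>2)"
        using n by (intro mult_right_mono) auto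
      also have "\<dots> = 6 * (r powr (1/2) * r powr (-2))"
      proof -
        have "r powr (1/2) = sqrt r" "r powr (-2) = 1 / r\<^sup>2"
          using r1 by (simp_all add: powr_half_sqrt powr_minus_divide)
        then show ?thesis by simp
      qed
      also have "r powr (1/2) * r powr (-2) = (r powr 2) powr (- 3/4)"
        unfolding powr_powr powr_add[symmetric] by simp
      also have "r powr 2 = r\<^sup>2" using r1 by simp
      also have "(r\<^sup>2) powr (- 3/4) \<le> ((1 + a\<^sup>2) * (1 + b\<^sup>2)) powr (- 3/4)"
      proof (rule powr_mono2')
        have "(1 + a\<^sup>2) * (1 + b\<^sup>2) \<le> r * r"
          unfolding r_def by (intro mult_mono) auto
        then show "(1 + a\<^sup>2) * (1 + b\<^sup>2) \<le> r\<^sup>2" by (simp add: power2_eq_square)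
      qed (auto intro!: mult_pos_pos add_pos_nonneg)
      also have "\<dots> = p (fst w) * p (snd w)"
        unfolding p_def a_def b_def by (rule powr_mult)
      finally show ?thesis by simp
    qed
    have "(\<Sum>w\<in>{-int n..int n} \<times> {-int n..int n}. real_of_int (\<bar>fst w\<bar> + \<bar>snd w\<bar>) * lap logw w)
        \<le> (\<Sum>w\<in>{-int n..int n} \<times> {-int n..int n}. 6 * (p (fst w) * p (snd w)))"
      by (rule sum_mono[OF t])
    also have "\<dots> = 6 * (\<Sum>a=-int n..int n. p a)\<^sup>2"
    proof -
      have "(\<Sum>a=-int n..int n. p a)\<^sup>2 = (\<Sum>w\<in>{-int n..int n} \<times> {-int n..int n}. p (fst w) * p (snd w))"
        by (simp add: power2_eq_square sum_product sum.cartesian_product split_def)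
      then show ?thesis by (simp add: sum_distrib_left)
    qed
    also have "\<dots> \<le> 6 * (1 + 2 * s)\<^sup>2"
      using ps[of n] by (intro mult_left_mono power_mono) (auto intro!: sum_nonneg simp: p_def)
    finally show ?thesis .
  qed
  then show ?thesis by blast
qed

section \<open>Logarithmic asymptotics of the Green function\<close>

definition logd :: "int \<times> int \<Rightarrow> int \<times> int \<Rightarrow> real" where
  "logd x y = ln ((edist x y)\<^sup>2 + 1) / 2"

lemma edist_sq: "(edist x y)\<^sup>2 = (real_of_int (fst x - fst y))\<^sup>2 + (real_of_int (snd x - snd y))\<^sup>2"
  by (simp add: edist_def)

lemma edist_nonneg: "edist x y \<ge> 0"
  by (simp add: edist_def)

lemma logd_logw: "logd x y = logw (fst x - fst y, snd x - snd y)"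
  by (simp add: logd_def logw_def edist_sq)

lemma logd_nonneg: "logd x y \<ge> 0"
  by (simp add: logd_def)

lemma edist_sym: "edist x y = edist y x"
  by (simp add: edist_def power2_commute)

lemma lap_logd: "lap (\<lambda>z. logd z y) x = lap logw (fst x - fst y, snd x - snd y)"
  by (simp add: lap_def sum_nbrs logd_logw algebra_simps)

text \<open>The region for the covariance asymptotics: coordinate inequalities replace the infimum
  in \<open>dist_compl\<close>, and its points are interior by definition.\<close>

definition bulk :: "nat \<Rightarrow> real \<Rightarrow> (int \<times> int) set" where
  "bulk N l = {y \<in> intr N. l * real N \<le> real_of_int (fst y) \<and> real_of_int (fst y) \<le> real N - l * real N
                   \<and> l * real N \<le> real_of_int (snd y) \<and> real_of_int (snd y) \<le> real N - l * real N}"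

lemma bulk_intr: "bulk N l \<subseteq> intr N"
  by (auto simp: bulk_def)

text \<open>The sum is the potential of the charges \<open>lap logw\<close> centred at
  \<open>y\<close>. Added to \<open>logd x y\<close> it is harmonic in the interior, since the
  charges cancel. On the boundary only \<open>logd\<close> remains, which is
  \<open>ln N + O(1)\<close> because \<open>y\<close> is in the bulk; the maximum principle carries
  this inside.\<close>

lemma green_potential:
  assumes N: "l * real N \<ge> 1" and l: "0 < l" and y: "y \<in> bulk N l" and x: "x \<in> box N"
  shows "\<bar>(\<Sum>z\<in>intr N. green0 N x z * lap logw (fst z - fst y, snd z - snd y)) - (ln (real N) - logd x y)\<bar>
          \<le> ln 2 + \<bar>ln l\<bar>"
proof -
  define u where "u = (\<lambda>x. \<Sum>z\<in>intr N. green0 N x z * lap logw (fst z - fst y, snd z - snd y))"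
  define c where "c = ln 2 + \<bar>ln l\<bar>"
  have N0: "real N > 0" using N l by (cases N) auto
  have lapu: "lap u x = - lap logw (fst x - fst y, snd x - snd y)" if "x \<in> intr N" for x
  proof -
    have "lap u x = (\<Sum>z\<in>intr N. lap logw (fst z - fst y, snd z - snd y) * lap (\<lambda>x. green0 N x z) x)"
      unfolding u_def lap_def[of _ x]
      by (subst sum.swap) (simp add: sum_distrib_left sum_distrib_right sum_divide_distrib sum_subtractf[symmetric] algebra_simps)
    also have "\<dots> = (\<Sum>z\<in>intr N. if x = z then - lap logw (fst z - fst y, snd z - snd y) else 0)"
      using that by (intro sum.cong) (auto simp: lap_green0)
    also have "\<dots> = - lap logw (fst x - fst y, snd x - snd y)"
      using that by simp
    finally show ?thesis .
  qed
  define v where "v = (\<lambda>x. logd x y + u x)"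
  have harm: "lap v x = 0" if "x \<in> intr N" for x
    using lapu[OF that] by (simp add: v_def lap_add lap_logd)
  have bd: "ln (real N) - c \<le> v x" "v x \<le> ln (real N) + c" if "x \<in> box N - intr N" for x
  proof -
    have "u x = 0" using that by (simp add: u_def green0_def)
    then have v: "v x = logd x y" by (simp add: v_def)
    define a b where "a = real_of_int (fst x - fst y)" and "b = real_of_int (snd x - snd y)"
    have yb: "y \<in> box N" using y bulk_intr intr_subset_box by blast
    have ab: "\<bar>a\<bar> \<le> real N - 1" "\<bar>b\<bar> \<le> real N - 1"
      using that yb by (auto simp: a_def b_def box_def)
    have ab2: "a\<^sup>2 \<le> (real N - 1)\<^sup>2" "b\<^sup>2 \<le> (real N - 1)\<^sup>2"
      using power_mono[OF ab(1), of 2] power_mono[OF ab(2), of 2] by simp_all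
    have e: "(edist x y)\<^sup>2 = a\<^sup>2 + b\<^sup>2" by (simp add: edist_sq a_def b_def)
    have "a\<^sup>2 + b\<^sup>2 + 1 \<le> (2 * real N)\<^sup>2"
    proof -
      have "real N \<ge> 1" using N0 by (cases N) auto
      moreover have "(real N - 1)\<^sup>2 = (real N)\<^sup>2 - 2 * real N + 1" "(2 * real N)\<^sup>2 = 4 * (real N)\<^sup>2"
        by (simp_all add: power2_eq_square algebra_simps)
      ultimately show ?thesis
        using ab2 zero_le_power2[of "real N"] by linarith
    qed
    then have "logd x y \<le> ln ((2 * real N)\<^sup>2) / 2"
      unfolding logd_def e using sq_sum_pos[of a b] N0 by (intro divide_right_mono ln_mono) auto
    also have "\<dots> = ln 2 + ln (real N)" using N0 by (subst ln_realpow) (auto simp: ln_mult)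
    finally show "v x \<le> ln (real N) + c" by (simp add: v c_def)
    \<comment> \<open>A boundary point has some coordinate 1 or \<open>N\<close>, so it differs from
      \<open>y\<close> by at least \<open>l * N - 1\<close> in that coordinate.\<close>
    have "\<bar>a\<bar> \<ge> l * real N - 1 \<or> \<bar>b\<bar> \<ge> l * real N - 1"
      using that y by (auto simp: bulk_def intr_eq box_def a_def b_def)
    then have "a\<^sup>2 + b\<^sup>2 \<ge> (l * real N - 1)\<^sup>2"
      using N by (auto simp: abs_le_square_iff[symmetric] intro: add_increasing add_increasing2)
    moreover have "(l * real N - 1)\<^sup>2 + 1 \<ge> (l * real N)\<^sup>2 / 2"
      using zero_le_power2[of "l * real N - 2"] by (simp add: power2_eq_square algebra_simps)
    ultimately have "a\<^sup>2 + b\<^sup>2 + 1 \<ge> (l * real N / 2)\<^sup>2"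
      by (simp add: power_divide) (smt (verit, best) zero_le_power2)
    then have "ln ((l * real N / 2)\<^sup>2) / 2 \<le> logd x y"
      unfolding logd_def e using N0 l by (intro divide_right_mono ln_mono) auto
    also have "ln ((l * real N / 2)\<^sup>2) / 2 = ln l + ln (real N) - ln 2"
      using N0 l by (subst ln_realpow) (auto simp: ln_mult ln_div)
    finally show "ln (real N) - c \<le> v x" unfolding v c_def by linarith
  qed
  have "v x \<le> ln (real N) + c"
    by (rule subharmonic_max[OF order_refl _ bd(2) x]) (auto simp: harm)
  moreover have "ln (real N) - c \<le> v x"
    by (rule superharmonic_min[OF order_refl _ bd(1) x]) (auto simp: harm)
  ultimately show ?thesis
    unfolding v_def u_def c_def by linarith
qed

lemma sum_translate:
  fixes y :: "int \<times> int"
  shows "(\<Sum>z\<in>A. h (fst z - fst y, snd z - snd y)) = sum h ((\<lambda>z. (fst z - fst y, snd z - snd y)) ` A)"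
  by (subst sum.reindex) (auto simp: inj_on_def prod_eq_iff)

text \<open>Replacing the spread charge by a point charge at \<open>y\<close> costs the Lipschitz
  constant 4 times the first moment, hence \<open>O(1)\<close>. The charge \<open>m\<close> inside
  the interior depends on \<open>y\<close>, so it is only located between the masses of an inscribed
  and a circumscribed square.\<close>

lemma green_times_mass:
  fixes l :: real
  assumes l: "0 < l" "l < 1"
  shows "\<exists>C. \<forall>N x y. l * real N \<ge> 3 \<longrightarrow> x \<in> intr N \<longrightarrow> y \<in> bulk N l \<longrightarrow> (\<exists>m.
     (\<Sum>w\<in>{-int (nat \<lfloor>l * real N\<rfloor> - 2)..int (nat \<lfloor>l * real N\<rfloor> - 2)} \<times> {-int (nat \<lfloor>l * real N\<rfloor> - 2)..int (nat \<lfloor>l * real N\<rfloor> - 2)}. lap logw w) \<le> m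
     \<and> m \<le> (\<Sum>w\<in>{-int N..int N} \<times> {-int N..int N}. lap logw w)
     \<and> \<bar>m * green N x y - (ln (real N) - logd x y)\<bar> \<le> C)"
proof -
  obtain C1 where C1: "\<And>n. (\<Sum>w\<in>{-int n..int n} \<times> {-int n..int n}. real_of_int (\<bar>fst w\<bar> + \<bar>snd w\<bar>) * lap logw w) \<le> C1"
    using lap_logw_first_moment by blast
  show ?thesis
  proof (rule exI[of _ "ln 2 + \<bar>ln l\<bar> + 4 * C1"], intro allI impI)
    fix N x y assume N: "l * real N \<ge> 3" and x: "x \<in> intr N" and y: "y \<in> bulk N l"
    \<comment> \<open>Interior coordinates run from 2 to \<open>N - 1\<close>; subtracting 2 makes
      this square fit around every bulk point.\<close>
    define n where "n = nat \<lfloor>l * real N\<rfloor> - 2"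
    let ?Q = "\<lambda>n. {-int n..int n} \<times> {-int n..int n}"
    let ?t = "\<lambda>z::int\<times>int. (fst z - fst y, snd z - snd y)"
    define m where "m = (\<Sum>z\<in>intr N. lap logw (?t z))"
    have yi: "y \<in> intr N" using y bulk_intr by auto
    have xb: "x \<in> box N" using x intr_subset_box by auto
    have sub2: "?t ` intr N \<subseteq> ?Q N"
      using yi by (auto simp: intr_eq)
    have n: "real n \<le> l * real N - 2"
      using N unfolding n_def by linarith
    have sub1: "?Q n \<subseteq> ?t ` intr N"
    proof
      fix w assume w: "w \<in> ?Q n"
      have "(fst w + fst y, snd w + snd y) \<in> intr N"
      proof -
        have "real_of_int \<bar>fst w\<bar> \<le> real n" "real_of_int \<bar>snd w\<bar> \<le> real n" using w by auto
        then have "2 \<le> real_of_int (fst w + fst y)" "real_of_int (fst w + fst y) \<le> real_of_int (int N - 1)"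
           "2 \<le> real_of_int (snd w + snd y)" "real_of_int (snd w + snd y) \<le> real_of_int (int N - 1)"
          using n y unfolding bulk_def by auto
        then show ?thesis unfolding intr_eq of_int_le_iff by (simp del: of_int_add of_int_diff)
      qed
      then show "w \<in> ?t ` intr N" by (force intro: image_eqI[of _ _ "(fst w + fst y, snd w + snd y)"])
    qed
    have m1: "(\<Sum>w\<in>?Q n. lap logw w) \<le> m"
      unfolding m_def sum_translate[where h="lap logw"]
      by (intro sum_mono2 sub1) (auto intro: lap_logw_bounds)
    have m2: "m \<le> (\<Sum>w\<in>?Q N. lap logw w)"
      unfolding m_def sum_translate[where h="lap logw"]
      by (intro sum_mono2 sub2) (auto intro: lap_logw_bounds)
    have "\<bar>(\<Sum>z\<in>intr N. green0 N x z * lap logw (?t z)) - m * green N x y\<bar>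
        = \<bar>\<Sum>z\<in>intr N. (green0 N x z - green0 N x y) * lap logw (?t z)\<bar>"
      using x by (simp add: m_def green0_def sum_distrib_left sum_subtractf left_diff_distrib mult.commute)
    also have "\<dots> \<le> (\<Sum>z\<in>intr N. \<bar>(green0 N x z - green0 N x y) * lap logw (?t z)\<bar>)"
      by (rule sum_abs)
    also have "\<dots> \<le> (\<Sum>z\<in>intr N. (\<lambda>w. 4 * (real_of_int (\<bar>fst w\<bar> + \<bar>snd w\<bar>) * lap logw w)) (?t z))"
    proof (rule sum_mono)
      fix z assume z: "z \<in> intr N"
      have "\<bar>(green0 N x z - green0 N x y) * lap logw (?t z)\<bar> = \<bar>green0 N x z - green0 N x y\<bar> * lap logw (?t z)"
        using lap_logw_bounds(1)[of "?t z"] by (simp add: abs_mult)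
      also have "\<dots> \<le> 4 * real_of_int (\<bar>fst z - fst y\<bar> + \<bar>snd z - snd y\<bar>) * lap logw (?t z)"
        by (intro mult_right_mono green0_lipschitz[OF xb yi z] lap_logw_bounds)
      finally show "\<bar>(green0 N x z - green0 N x y) * lap logw (?t z)\<bar> \<le> (\<lambda>w. 4 * (real_of_int (\<bar>fst w\<bar> + \<bar>snd w\<bar>) * lap logw w)) (?t z)"
        by (simp add: mult.assoc algebra_simps)
    qed
    also have "\<dots> \<le> (\<Sum>w\<in>?Q N. 4 * (real_of_int (\<bar>fst w\<bar> + \<bar>snd w\<bar>) * lap logw w))"
      unfolding sum_translate[where h="\<lambda>w. 4 * (real_of_int (\<bar>fst w\<bar> + \<bar>snd w\<bar>) * lap logw w)"]
      using lap_logw_bounds(1) by (intro sum_mono2 sub2) (auto intro!: mult_nonneg_nonneg)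
    also have "\<dots> \<le> 4 * C1"
      unfolding sum_distrib_left[symmetric] using C1[of N] by simp
    finally have "\<bar>(\<Sum>z\<in>intr N. green0 N x z * lap logw (?t z)) - m * green N x y\<bar> \<le> 4 * C1" .
    moreover have "\<bar>(\<Sum>z\<in>intr N. green0 N x z * lap logw (?t z)) - (ln (real N) - logd x y)\<bar> \<le> ln 2 + \<bar>ln l\<bar>"
      using N by (intro green_potential[OF _ l(1) y xb]) linarith
    ultimately have "\<bar>m * green N x y - (ln (real N) - logd x y)\<bar> \<le> ln 2 + \<bar>ln l\<bar> + 4 * C1"
      by linarith
    with m1 m2 show "\<exists>m. (\<Sum>w\<in>?Q (nat \<lfloor>l * real N\<rfloor> - 2). lap logw w) \<le> m
     \<and> m \<le> (\<Sum>w\<in>?Q N. lap logw w)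
     \<and> \<bar>m * green N x y - (ln (real N) - logd x y)\<bar> \<le> ln 2 + \<bar>ln l\<bar> + 4 * C1"
      unfolding n_def by blast
  qed
qed

text \<open>Divides by the mass, which tends to pi/2. The mass error multiplies a Green function of
  order \<open>ln N\<close>, and its limit is used without a rate, so the \<open>O(1)\<close> of
  \<open>green_times_mass\<close> becomes \<open>o(ln N)\<close>.\<close>

theorem green_asymp:
  fixes l e :: real
  assumes l: "0 < l" "l < 1" and e: "e > 0"
  shows "\<forall>\<^sub>F N in sequentially. \<forall>x\<in>intr N. \<forall>y\<in>bulk N l.
           \<bar>green N x y - gconst * (ln (real N) - logd x y)\<bar> \<le> e * ln (real N)"
proof -
  let ?Q = "\<lambda>n. {-int n..int n} \<times> {-int n..int n}"
  let ?S = "\<lambda>n. \<Sum>w\<in>?Q n. lap logw w"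
  let ?n = "\<lambda>N::nat. nat \<lfloor>l * real N\<rfloor> - 2"
  obtain C where C: "\<And>N x y. l * real N \<ge> 3 \<Longrightarrow> x \<in> intr N \<Longrightarrow> y \<in> bulk N l \<Longrightarrow>
    \<exists>m. ?S (?n N) \<le> m \<and> m \<le> ?S N \<and> \<bar>m * green N x y - (ln (real N) - logd x y)\<bar> \<le> C"
    using green_times_mass[OF l] by blast
  \<comment> \<open>The bound 1/2 keeps \<open>m >= 1\<close>, which yields the a priori estimate
    \<open>G <= 2 * ln N\<close>; with it, \<open>e / 4\<close> leaves an error of
    \<open>e / 2 * ln N\<close> from the mass.\<close>
  define e' where "e' = min (e / 4) (1/2)"
  have e': "e' > 0" "e' \<le> e / 4" "e' \<le> 1/2" using e by (auto simp: e'_def)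
  have lim: "filterlim (\<lambda>N. l * real N) at_top sequentially"
    using l by real_asymp
  have nlim: "filterlim ?n at_top sequentially"
  proof (subst filterlim_at_top, intro allI)
    fix Z :: nat
    have "\<forall>\<^sub>F N in sequentially. l * real N \<ge> real Z + 4"
      using lim unfolding filterlim_at_top by blast
    then show "\<forall>\<^sub>F N in sequentially. Z \<le> ?n N"
      by eventually_elim linarith
  qed
  have S1: "\<forall>\<^sub>F n in sequentially. \<bar>?S n - pi/2\<bar> < e'"
    using lap_logw_mass e'(1) unfolding tendsto_iff dist_real_def by blast
  have S2: "\<forall>\<^sub>F N in sequentially. \<bar>?S (?n N) - pi/2\<bar> < e'"
    using nlim S1 by (rule eventually_compose_filterlim[rotated])
  have L1: "\<forall>\<^sub>F N in sequentially. ln (real N) \<ge> (4 * \<bar>C\<bar> + 1) / e + \<bar>C\<bar>"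
    by real_asymp
  have L2: "\<forall>\<^sub>F N in sequentially. l * real N \<ge> 3"
    using lim unfolding filterlim_at_top by blast
  show ?thesis
    using S1 S2 L1 L2
  proof eventually_elim
    case (elim N)
    show ?case
    proof (intro ballI)
      fix x y assume x: "x \<in> intr N" and y: "y \<in> bulk N l"
      obtain m where m: "?S (?n N) \<le> m" "m \<le> ?S N" "\<bar>m * green N x y - (ln (real N) - logd x y)\<bar> \<le> C"
        using C[OF elim(4) x y] by blast
      define G where "G = green N x y"
      define D where "D = ln (real N) - logd x y"
      have G0: "G \<ge> 0" using green0_nonneg[of N x y] x by (simp add: G_def green0_def)
      have mp: "\<bar>m - pi/2\<bar> < e'" using m elim(1,2) by linarith
      have "m \<ge> 1" using mp e' pi_gt3 by linarith
      have C0: "C \<ge> 0" using m(3) by linarith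
      have "G \<le> m * G" using \<open>m \<ge> 1\<close> G0 by (simp add: mult_le_cancel_right1)
      also have "m * G \<le> ln (real N) + C"
        using m(3) logd_nonneg[of x y] unfolding G_def by linarith
      also have "\<dots> \<le> 2 * ln (real N)"
      proof -
        have "0 \<le> (4 * \<bar>C\<bar> + 1) / e" using e by simp
        then show ?thesis using elim(3) by linarith
      qed
      finally have G2: "G \<le> 2 * ln (real N)" .
      have "\<bar>(pi/2 - m) * G\<bar> \<le> e' * (2 * ln (real N))"
        unfolding abs_mult using mp G0 G2 e' by (intro mult_mono) auto
      also have "\<dots> \<le> e / 4 * (2 * ln (real N))"
        using e' G0 G2 by (intro mult_right_mono) auto
      finally have 1: "\<bar>(pi/2 - m) * G\<bar> \<le> e / 2 * ln (real N)" by simp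
      have "C \<le> e / 2 * ln (real N)"
      proof -
        have "(4 * C + 1) / e \<le> ln (real N)" using elim(3) C0 by simp
        then have "4 * C + 1 \<le> ln (real N) * e" using e by (simp add: pos_divide_le_eq)
        then show ?thesis using C0 by (simp add: mult.commute)
      qed
      moreover have "\<bar>pi/2 * G - D\<bar> \<le> \<bar>(pi/2 - m) * G\<bar> + \<bar>m * G - D\<bar>"
        by (simp add: algebra_simps)
      ultimately have 2: "\<bar>pi/2 * G - D\<bar> \<le> e * ln (real N)"
        using 1 m(3) unfolding G_def D_def by linarith
      have "G - gconst * D = gconst * (pi/2 * G - D)"
        by (simp add: gconst_def field_simps)
      then have "\<bar>G - gconst * D\<bar> = gconst * \<bar>pi/2 * G - D\<bar>"
        unfolding \<open>G - gconst * D = _\<close> abs_mult by (simp add: gconst_def)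
      also have "\<dots> \<le> 1 * \<bar>pi/2 * G - D\<bar>"
        using pi_gt3 by (intro mult_right_mono) (auto simp: gconst_def)
      also have "\<dots> \<le> e * ln (real N)" using 2 by simp
      finally show "\<bar>green N x y - gconst * (ln (real N) - logd x y)\<bar> \<le> e * ln (real N)"
        unfolding G_def D_def .
    qed
  qed
qed

section \<open>Gaussian families\<close>

definition bform :: "'i set \<Rightarrow> ('i \<Rightarrow> 'i \<Rightarrow> real) \<Rightarrow> ('i \<Rightarrow> real) \<Rightarrow> ('i \<Rightarrow> real) \<Rightarrow> real" where
  "bform I C c d = (\<Sum>i\<in>I. \<Sum>j\<in>I. c i * d j * C i j)"

text \<open>Stated through the joint characteristic function, which admits degenerate covariances
  and turns linear images into algebra of the form \<open>bform\<close>.\<close>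

definition gaussian_family ::
    "'a measure \<Rightarrow> 'i set \<Rightarrow> ('i \<Rightarrow> 'a \<Rightarrow> real) \<Rightarrow> ('i \<Rightarrow> 'i \<Rightarrow> real) \<Rightarrow> bool" where
  "gaussian_family M I X C \<longleftrightarrow> prob_space M \<and> finite I \<and> (\<forall>i\<in>I. X i \<in> borel_measurable M)
     \<and> (\<forall>i\<in>I. \<forall>j\<in>I. C i j = C j i)
     \<and> (\<forall>c. (CLINT \<omega>|M. iexp (\<Sum>i\<in>I. c i * X i \<omega>)) = complex_of_real (exp (- bform I C c c / 2)))"

lemma bform_sym:
  assumes "\<forall>i\<in>I. \<forall>j\<in>I. C i j = C j i"
  shows "bform I C c d = bform I C d c"
proof -
  have "bform I C c d = (\<Sum>i\<in>I. \<Sum>j\<in>I. d j * c i * C j i)"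
    unfolding bform_def using assms by (intro sum.cong refl) (simp add: mult.commute)
  then show ?thesis unfolding bform_def by (subst sum.swap)
qed

lemma bform_add_left: "bform I C (\<lambda>i. c i + c' i) d = bform I C c d + bform I C c' d"
  by (simp add: bform_def sum.distrib[symmetric] algebra_simps)

lemma bform_add_right: "bform I C c (\<lambda>i. d i + d' i) = bform I C c d + bform I C c d'"
  by (simp add: bform_def sum.distrib[symmetric] algebra_simps)

lemma bform_cmult_left: "bform I C (\<lambda>i. k * c i) d = k * bform I C c d"
  by (simp add: bform_def sum_distrib_left mult_ac)

lemma bform_cmult_right: "bform I C c (\<lambda>i. k * d i) = k * bform I C c d"
  by (simp add: bform_def sum_distrib_left mult_ac)

lemma bform_diff_left: "bform I C (\<lambda>i. c i - c' i) d = bform I C c d - bform I C c' d"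
  by (simp add: bform_def sum_subtractf[symmetric] algebra_simps)

lemma bform_diff_right: "bform I C c (\<lambda>i. d i - d' i) = bform I C c d - bform I C c d'"
  by (simp add: bform_def sum_subtractf[symmetric] algebra_simps)

lemma bform_sum_left: "bform I C (\<lambda>i. \<Sum>k\<in>K. c k i) d = (\<Sum>k\<in>K. bform I C (c k) d)"
  by (induction K rule: infinite_finite_induct) (simp_all add: bform_add_left, simp_all add: bform_def)

lemma bform_sum_right: "bform I C c (\<lambda>i. \<Sum>k\<in>K. d k i) = (\<Sum>k\<in>K. bform I C c (d k))"
  by (induction K rule: infinite_finite_induct) (simp_all add: bform_add_right, simp_all add: bform_def)

definition unitv :: "'i \<Rightarrow> 'i \<Rightarrow> real" where "unitv x = (\<lambda>i. if i = x then 1 else 0)"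

lemma sum_unitv: "finite I \<Longrightarrow> x \<in> I \<Longrightarrow> (\<Sum>i\<in>I. unitv x i * f i) = f x"
  by (simp add: unitv_def if_distrib[of "\<lambda>c. c * _"] cong: if_cong)

lemma bform_unitv:
  assumes "finite I" "x \<in> I" "y \<in> I"
  shows "bform I C (unitv x) (unitv y) = C x y"
proof -
  have "bform I C (unitv x) (unitv y) = (\<Sum>i\<in>I. unitv x i * (\<Sum>j\<in>I. unitv y j * C i j))"
    by (simp add: bform_def sum_distrib_left mult.assoc)
  then show ?thesis using assms by (simp add: sum_unitv)
qed

lemma gaussian_familyD:
  assumes "gaussian_family M I X C"
  shows "prob_space M" "finite I" "\<And>i. i \<in> I \<Longrightarrow> X i \<in> borel_measurable M"
    "\<And>i j. i \<in> I \<Longrightarrow> j \<in> I \<Longrightarrow> C i j = C j i" "\<forall>i\<in>I. \<forall>j\<in>I. C i j = C j i"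
    "\<And>c. (CLINT \<omega>|M. iexp (\<Sum>i\<in>I. c i * X i \<omega>)) = complex_of_real (exp (- bform I C c c / 2))"
  using assms unfolding gaussian_family_def by blast+

lemma gaussian_lin_measurable:
  assumes "gaussian_family M I X C"
  shows "(\<lambda>\<omega>. \<Sum>i\<in>I. c i * X i \<omega>) \<in> borel_measurable M"
  using gaussian_familyD(3)[OF assms] by (intro borel_measurable_sum borel_measurable_times) auto

lemma cmod_iexp_integral_le:
  assumes "prob_space M"
  shows "cmod (CLINT \<omega>|M. iexp (f \<omega>)) \<le> 1"
proof -
  interpret prob_space M by fact
  have "cmod (CLINT \<omega>|M. iexp (f \<omega>)) \<le> (\<integral>\<omega>. cmod (iexp (f \<omega>)) \<partial>M)"
    by (rule integral_norm_bound)
  then show ?thesis by (simp add: prob_space)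
qed

text \<open>A characteristic function has modulus at most 1, and this forces positive
  semidefiniteness.\<close>

lemma gaussian_qform_nonneg:
  assumes "gaussian_family M I X C"
  shows "bform I C c c \<ge> 0"
proof -
  have "cmod (complex_of_real (exp (- bform I C c c / 2))) \<le> 1"
    using cmod_iexp_integral_le[OF gaussian_familyD(1)[OF assms]] gaussian_familyD(6)[OF assms] by metis
  then show ?thesis by simp
qed

lemma gaussian_linear_image:
  assumes g: "gaussian_family M I X C" and J: "finite J"
  shows "gaussian_family M J (\<lambda>j \<omega>. \<Sum>i\<in>I. T j i * X i \<omega>) (\<lambda>j k. bform I C (T j) (T k))"
proof -
  have lin: "(\<Sum>j\<in>J. c j * (\<Sum>i\<in>I. T j i * X i \<omega>)) = (\<Sum>i\<in>I. (\<Sum>j\<in>J. c j * T j i) * X i \<omega>)" for c \<omega>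
    by (simp add: sum_distrib_left sum_distrib_right mult.assoc) (rule sum.swap)
  have b: "bform I C (\<lambda>i. \<Sum>j\<in>J. c j * T j i) (\<lambda>i. \<Sum>j\<in>J. c j * T j i) = bform J (\<lambda>j k. bform I C (T j) (T k)) c c" for c
    by (simp add: bform_sum_left bform_sum_right bform_cmult_left bform_cmult_right)
       (simp add: bform_def[of J] sum_distrib_left mult_ac)
  show ?thesis
    unfolding gaussian_family_def lin gaussian_familyD(6)[OF g] b
    using J gaussian_familyD[OF g] gaussian_lin_measurable[OF g] bform_sym[OF gaussian_familyD(5)[OF g]]
    by auto
qed

text \<open>Writing the law as the image of a standard normal variable covers variance 0 as
  well.\<close>

lemma gaussian_lin_distr:
  assumes g: "gaussian_family M I X C"
  shows "distr M borel (\<lambda>\<omega>. \<Sum>i\<in>I. c i * X i \<omega>)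
       = distr std_normal_distribution borel (\<lambda>z. sqrt (bform I C c c) * z)"
proof (rule Levy_uniqueness)
  define Y where "Y = (\<lambda>\<omega>. \<Sum>i\<in>I. c i * X i \<omega>)"
  define q where "q = bform I C c c"
  have Y [measurable]: "Y \<in> borel_measurable M" unfolding Y_def by (rule gaussian_lin_measurable[OF g])
  interpret M: prob_space M by (rule gaussian_familyD(1)[OF g])
  interpret N: real_distribution std_normal_distribution by (rule real_dist_normal_dist)
  show "real_distribution (distr M borel Y)"
    using Y by (rule M.real_distribution_distr)
  show "real_distribution (distr std_normal_distribution borel (\<lambda>z. sqrt q * z))"
    by (rule N.real_distribution_distr) simp
  show "char (distr M borel Y) = char (distr std_normal_distribution borel (\<lambda>z. sqrt q * z))"
  proof
    fix t
    have q0: "q \<ge> 0" unfolding q_def by (rule gaussian_qform_nonneg[OF g])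
    have "char (distr M borel Y) t = (CLINT \<omega>|M. iexp (\<Sum>i\<in>I. (t * c i) * X i \<omega>))"
    proof -
      have "(\<Sum>i\<in>I. (t * c i) * X i \<omega>) = t * Y \<omega>" for \<omega>
        by (simp add: Y_def sum_distrib_left mult.assoc)
      then show ?thesis unfolding char_def by (subst integral_distr) simp_all
    qed
    also have "\<dots> = complex_of_real (exp (- ((t * sqrt q)\<^sup>2) / 2))"
      unfolding gaussian_familyD(6)[OF g] bform_cmult_left bform_cmult_right q_def[symmetric]
      using q0 by (simp add: power2_eq_square mult_ac)
    also have "\<dots> = char std_normal_distribution (t * sqrt q)"
      by (simp add: char_std_normal_distribution)
    also have "\<dots> = char (distr std_normal_distribution borel (\<lambda>z. sqrt q * z)) t"
      unfolding char_def by (subst integral_distr) (simp_all add: mult.assoc)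
    finally show "char (distr M borel Y) t = char (distr std_normal_distribution borel (\<lambda>z. sqrt q * z)) t" .
  qed
qed

lemma gaussian_mgf:
  assumes g: "gaussian_family M I X C"
  shows "(\<integral>\<^sup>+\<omega>. ennreal (exp (\<Sum>i\<in>I. c i * X i \<omega>)) \<partial>M) = ennreal (exp (bform I C c c / 2))"
proof -
  define s where "s = sqrt (bform I C c c)"
  have q0: "bform I C c c \<ge> 0" by (rule gaussian_qform_nonneg[OF g])
  have "(\<integral>\<^sup>+\<omega>. ennreal (exp (\<Sum>i\<in>I. c i * X i \<omega>)) \<partial>M)
      = (\<integral>\<^sup>+y. ennreal (exp y) \<partial>distr M borel (\<lambda>\<omega>. \<Sum>i\<in>I. c i * X i \<omega>))"
    using gaussian_lin_measurable[OF g] by (subst nn_integral_distr) auto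
  also have "\<dots> = (\<integral>\<^sup>+z. ennreal (exp (s * z)) \<partial>std_normal_distribution)"
    unfolding gaussian_lin_distr[OF g] s_def by (subst nn_integral_distr) auto
  also have "\<dots> = (\<integral>\<^sup>+z. ennreal (exp (s\<^sup>2 / 2)) * ennreal (normal_density s 1 z) \<partial>lborel)"
  proof (subst nn_integral_density)
    \<comment> \<open>Completing the square: the exponential tilt moves the mean of the normal
      density from 0 to \<open>s\<close>.\<close>
    have "std_normal_density z * exp (s * z) = exp (s\<^sup>2 / 2) * normal_density s 1 z" for z
      unfolding normal_density_def
      by (simp add: mult_exp_exp[symmetric] field_simps power2_eq_square exp_add[symmetric] exp_diff[symmetric])
    then show "(\<integral>\<^sup>+ x. ennreal (std_normal_density x) * ennreal (exp (s * x)) \<partial>lborel) =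
        (\<integral>\<^sup>+z. ennreal (exp (s\<^sup>2 / 2)) * ennreal (normal_density s 1 z) \<partial>lborel)"
      by (simp add: ennreal_mult[symmetric])
  qed auto
  also have "\<dots> = ennreal (exp (s\<^sup>2 / 2)) * (\<integral>\<^sup>+z. ennreal (normal_density s 1 z) \<partial>lborel)"
    by (subst nn_integral_cmult) auto
  also have "(\<integral>\<^sup>+z. ennreal (normal_density s 1 z) \<partial>lborel) = 1"
    using prob_space.emeasure_space_1[OF prob_space_normal_density[of 1 s]]
    by (simp add: emeasure_density)
  finally show ?thesis using q0 by (simp add: s_def)
qed

text \<open>Markov's inequality at tilt 1; any other tilt arises by rescaling \<open>c\<close> and
  \<open>a\<close>.\<close>

lemma gaussian_chernoff:
  assumes g: "gaussian_family M I X C"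
  shows "measure M {\<omega>\<in>space M. a \<le> (\<Sum>i\<in>I. c i * X i \<omega>)} \<le> exp (bform I C c c / 2 - a)"
proof -
  interpret M: prob_space M by (rule gaussian_familyD(1)[OF g])
  let ?Y = "\<lambda>\<omega>. \<Sum>i\<in>I. c i * X i \<omega>"
  have [measurable]: "?Y \<in> borel_measurable M" by (rule gaussian_lin_measurable[OF g])
  have "emeasure M {\<omega>\<in>space M. a \<le> ?Y \<omega>} = (\<integral>\<^sup>+\<omega>. indicator {\<omega>\<in>space M. a \<le> ?Y \<omega>} \<omega> \<partial>M)"
    by (subst nn_integral_indicator) auto
  also have "\<dots> \<le> (\<integral>\<^sup>+\<omega>. ennreal (exp (- a)) * ennreal (exp (?Y \<omega>)) \<partial>M)"
  proof (rule nn_integral_mono)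
    fix \<omega>
    show "indicator {\<omega>\<in>space M. a \<le> ?Y \<omega>} \<omega> \<le> ennreal (exp (- a)) * ennreal (exp (?Y \<omega>))"
      by (auto simp: indicator_def ennreal_mult[symmetric] exp_add[symmetric])
  qed
  also have "\<dots> = ennreal (exp (- a)) * ennreal (exp (bform I C c c / 2))"
    by (subst nn_integral_cmult) (auto simp: gaussian_mgf[OF g])
  also have "\<dots> = ennreal (exp (bform I C c c / 2 - a))"
    by (simp add: ennreal_mult[symmetric] exp_add[symmetric])
  finally show ?thesis
    by (simp add: M.emeasure_eq_measure)
qed

text \<open>Integrates the normal density over one unit interval to the right of the threshold and
  keeps its smallest value there. The loss is of order \<open>exp (O(sqrt L))\<close> for levels and
  variances of order \<open>L\<close>, below any power of \<open>N\<close>.\<close>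

lemma gaussian_tail_lower:
  assumes g: "gaussian_family M I X C" and q: "bform I C c c > 0" and a: "a \<ge> 0"
  shows "exp (- (a + sqrt (bform I C c c))\<^sup>2 / (2 * bform I C c c)) / sqrt (2 * pi)
     \<le> measure M {\<omega>\<in>space M. a \<le> (\<Sum>i\<in>I. c i * X i \<omega>)}"
proof -
  interpret M: prob_space M by (rule gaussian_familyD(1)[OF g])
  interpret N: real_distribution std_normal_distribution by (rule real_dist_normal_dist)
  define q where "q = bform I C c c"
  define b where "b = a / sqrt q"
  have q0: "q > 0" using q by (simp add: q_def)
  have b0: "b \<ge> 0" using a q0 by (simp add: b_def)
  let ?Y = "\<lambda>\<omega>. \<Sum>i\<in>I. c i * X i \<omega>"
  have [measurable]: "?Y \<in> borel_measurable M" by (rule gaussian_lin_measurable[OF g])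
  have "measure M {\<omega>\<in>space M. a \<le> ?Y \<omega>} = measure (distr M borel ?Y) {a..}"
    by (subst measure_distr) (auto intro!: arg_cong[where f="measure M"])
  also have "\<dots> = measure std_normal_distribution {b..}"
    unfolding gaussian_lin_distr[OF g] q_def[symmetric] using q0
    by (subst measure_distr) (auto intro!: arg_cong[where f="measure std_normal_distribution"] simp: b_def field_simps)
  finally have eq: "measure M {\<omega>\<in>space M. a \<le> ?Y \<omega>} = measure std_normal_distribution {b..}" .
  have "ennreal (std_normal_density (b + 1)) = (\<integral>\<^sup>+z. ennreal (std_normal_density (b + 1)) * indicator {b..b+1} z \<partial>lborel)"
    by (subst nn_integral_cmult_indicator) auto
  also have "\<dots> \<le> (\<integral>\<^sup>+z. ennreal (std_normal_density z) * indicator {b..} z \<partial>lborel)"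
  proof (rule nn_integral_mono)
    fix z
    have "std_normal_density (b + 1) \<le> std_normal_density z" if "b \<le> z" "z \<le> b + 1"
      using that b0 unfolding normal_density_def by (auto intro!: power_mono divide_right_mono)
    then show "ennreal (std_normal_density (b + 1)) * indicator {b..b+1} z \<le> ennreal (std_normal_density z) * indicator {b..} z"
      by (auto simp: indicator_def intro!: ennreal_leI)
  qed
  also have "\<dots> = emeasure std_normal_distribution {b..}"
    by (subst emeasure_density) auto
  finally have "std_normal_density (b + 1) \<le> measure std_normal_distribution {b..}"
    by (simp add: N.emeasure_eq_measure)
  moreover have "std_normal_density (b + 1) = exp (- (a + sqrt q)\<^sup>2 / (2 * q)) / sqrt (2 * pi)"
  proof -
    have "(b + 1)\<^sup>2 = (a + sqrt q)\<^sup>2 / q"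
      using q0 by (simp add: b_def power_divide[symmetric] field_simps)
    then show ?thesis by (simp add: normal_density_def)
  qed
  ultimately show ?thesis unfolding eq q_def by simp
qed

section \<open>Uniqueness of finite-dimensional laws from characteristic functions\<close>

lemma bounded_integrable:
  fixes f :: "'a \<Rightarrow> 'b::{banach, second_countable_topology}"
  assumes "prob_space M" "f \<in> borel_measurable M" "\<And>x. norm (f x) \<le> B"
  shows "integrable M f"
proof -
  interpret prob_space M by fact
  show ?thesis using assms(2,3) by (intro integrable_const_bound[of _ B]) auto
qed

text \<open>A nonnegative bounded weight is absorbed into the measure after normalisation, which
  puts weighted expectations within reach of the one-dimensional uniqueness theorem.\<close>

lemma weighted_distr:
  fixes w X :: "'a \<Rightarrow> real"
  assumes M: "prob_space M" and [measurable]: "w \<in> borel_measurable M" "X \<in> borel_measurable M" "A \<in> sets borel"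
    and b: "\<And>x. 0 \<le> w x" "\<And>x. w x \<le> B" and i: "(LINT x|M. w x) = m" and mp: "m > 0"
  defines "D \<equiv> distr (density M (\<lambda>x. ennreal (w x / m))) borel X"
  shows "real_distribution D"
    and "char D t = (CLINT x|M. w x * iexp (t * X x)) / m"
    and "measure D A = (LINT x|M. w x * indicator A (X x)) / m"
proof -
  interpret M: prob_space M by fact
  let ?E = "density M (\<lambda>x. ennreal (w x / m))"
  have iw: "integrable M w" using b by (auto intro!: bounded_integrable[where B=B] M)
  have E: "emeasure ?E S = ennreal ((LINT x|M. w x * indicator S x) / m)" if [measurable]: "S \<in> sets M" for S
  proof -
    have "emeasure ?E S = (\<integral>\<^sup>+x. ennreal (w x / m * indicator S x) \<partial>M)"
      using b mp by (subst emeasure_density) (auto simp: ennreal_mult' ennreal_indicator intro!: nn_integral_cong split: split_indicator)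
    also have "\<dots> = ennreal (LINT x|M. w x / m * indicator S x)"
      using b mp order_trans[OF b] by (intro nn_integral_eq_integral bounded_integrable[where B="B / m"] M)
         (auto simp: indicator_def divide_right_mono)
    finally show ?thesis by simp
  qed
  have "emeasure ?E (space M) = 1"
    using mp by (subst E) (auto simp: i[symmetric] intro!: Bochner_Integration.integral_cong arg_cong2[where f="(/)"])
  then have "prob_space ?E" by (intro prob_spaceI) simp
  then interpret E: prob_space ?E .
  have 1: "real_distribution (distr ?E borel X)"
    by (intro E.real_distribution_distr) simp
  have 2: "char (distr ?E borel X) t = (CLINT x|M. w x * iexp (t * X x)) / m" for t
  proof -
    have "char (distr ?E borel X) t = (CLINT x|?E. iexp (t * X x))"
      unfolding char_def by (subst integral_distr) auto
    also have "\<dots> = (CLINT x|M. (w x / m) *\<^sub>R iexp (t * X x))"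
      using b mp by (subst integral_density) auto
    also have "\<dots> = (CLINT x|M. w x * iexp (t * X x) / m)"
      by (simp add: scaleR_conv_of_real)
    finally show ?thesis by simp
  qed
  have 3: "measure (distr ?E borel X) A = (LINT x|M. w x * indicator A (X x)) / m"
  proof -
    have "measure (distr ?E borel X) A = measure ?E (X -` A \<inter> space M)"
      by (subst measure_distr) auto
    also have "\<dots> = (LINT x|M. w x * indicator (X -` A \<inter> space M) x) / m"
      unfolding measure_def using b mp by (subst E) (auto intro!: divide_nonneg_pos)
    also have "(LINT x|M. w x * indicator (X -` A \<inter> space M) x) = (LINT x|M. w x * indicator A (X x))"
      by (intro Bochner_Integration.integral_cong) (auto simp: indicator_def)
    finally show ?thesis .
  qed
  from 1 show "real_distribution D" by (simp add: D_def)
  from 2 show "char D t = (CLINT x|M. w x * iexp (t * X x)) / m" by (simp add: D_def)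
  from 3 show "measure D A = (LINT x|M. w x * indicator A (X x)) / m" by (simp add: D_def)
qed

lemma weighted_uniqueness:
  fixes w1 X1 :: "'a \<Rightarrow> real" and w2 X2 :: "'b \<Rightarrow> real"
  assumes M: "prob_space M1" "prob_space M2"
    and w [measurable]: "w1 \<in> borel_measurable M1" "w2 \<in> borel_measurable M2"
    and wb: "\<And>x. 0 \<le> w1 x" "\<And>x. w1 x \<le> B" "\<And>x. 0 \<le> w2 x" "\<And>x. w2 x \<le> B"
    and X [measurable]: "X1 \<in> borel_measurable M1" "X2 \<in> borel_measurable M2"
    and eq: "\<And>t. (CLINT x|M1. w1 x * iexp (t * X1 x)) = (CLINT x|M2. w2 x * iexp (t * X2 x))"
    and A [measurable]: "A \<in> sets borel"
  shows "(LINT x|M1. w1 x * indicator A (X1 x)) = (LINT x|M2. w2 x * indicator A (X2 x))"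
proof -
  interpret M1: prob_space M1 by fact
  interpret M2: prob_space M2 by fact
  have int: "integrable M1 w1" "integrable M2 w2"
    using wb by (auto intro!: bounded_integrable[where B=B] M)
  have intA: "integrable M1 (\<lambda>x. w1 x * indicator A (X1 x))" "integrable M2 (\<lambda>x. w2 x * indicator A (X2 x))"
    using wb order_trans[OF wb(1,2)] by (auto intro!: bounded_integrable[where B=B] M simp: indicator_def)
  define m where "m = (LINT x|M1. w1 x)"
  have m2: "m = (LINT x|M2. w2 x)"
    using eq[of 0] unfolding m_def by (simp del: of_real_eq_iff add: of_real_eq_iff[symmetric, where ?'a=complex])
  have m0: "m \<ge> 0" unfolding m_def using wb by simp
  show ?thesis
  \<comment> \<open>Mass 0 excludes normalisation; in that case both sides lie between 0 and
    \<open>m\<close>.\<close>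
  proof (cases "m = 0")
    case True
    have "(LINT x|M1. w1 x * indicator A (X1 x)) \<le> m"
      unfolding m_def using wb by (intro integral_mono int intA) (auto simp: indicator_def)
    moreover have "(LINT x|M2. w2 x * indicator A (X2 x)) \<le> m"
      unfolding m2 using wb by (intro integral_mono int intA) (auto simp: indicator_def)
    moreover have "0 \<le> (LINT x|M1. w1 x * indicator A (X1 x))" "0 \<le> (LINT x|M2. w2 x * indicator A (X2 x))"
      using wb by auto
    ultimately show ?thesis using True by linarith
  next
    case False
    with m0 have mp: "m > 0" by simp
    let ?D1 = "distr (density M1 (\<lambda>x. ennreal (w1 x / m))) borel X1"
    let ?D2 = "distr (density M2 (\<lambda>x. ennreal (w2 x / m))) borel X2"
    note d1 = weighted_distr[OF M(1) w(1) X(1) A wb(1,2) m_def[symmetric] mp]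
    note d2 = weighted_distr[OF M(2) w(2) X(2) A wb(3,4) m2[symmetric] mp]
    have "?D1 = ?D2"
      by (rule Levy_uniqueness[OF d1(1) d2(1)]) (intro ext, simp only: d1(2) d2(2) eq)
    then show ?thesis
      using d1(3) d2(3) mp by simp
  qed
qed

text \<open>Euler's formulas in both directions: the weights \<open>P * (1 + cos S)\<close> and
  \<open>P * (1 + sin S)\<close> have characteristic functions that combine the phases 0, 1 and -1,
  and they recover the complex weight \<open>iexp S\<close>. Adding 1 keeps them
  nonnegative.\<close>

lemma phase_integrals:
  fixes P X S :: "'a \<Rightarrow> real"
  assumes M: "prob_space M" and [measurable]: "P \<in> borel_measurable M" "X \<in> borel_measurable M" "S \<in> borel_measurable M" "A \<in> sets borel"
    and b: "\<And>x. 0 \<le> P x" "\<And>x. P x \<le> 1"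
  shows "(CLINT x|M. (P x * (1 + cos (S x))) * iexp (t * X x))
        = (CLINT x|M. P x * iexp (0 * S x + t * X x)) + (CLINT x|M. P x * iexp (1 * S x + t * X x)) / 2
          + (CLINT x|M. P x * iexp ((-1) * S x + t * X x)) / 2" (is ?c)
    and "(CLINT x|M. (P x * (1 + sin (S x))) * iexp (t * X x))
        = (CLINT x|M. P x * iexp (0 * S x + t * X x)) + (CLINT x|M. P x * iexp (1 * S x + t * X x)) / (2 * \<i>)
          - (CLINT x|M. P x * iexp ((-1) * S x + t * X x)) / (2 * \<i>)" (is ?s)
    and "(CLINT x|M. (P x * indicator A (X x)) * iexp (S x))
        = complex_of_real (LINT x|M. (P x * (1 + cos (S x))) * indicator A (X x)) - complex_of_real (LINT x|M. P x * indicator A (X x))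
          + \<i> * (complex_of_real (LINT x|M. (P x * (1 + sin (S x))) * indicator A (X x)) - complex_of_real (LINT x|M. P x * indicator A (X x)))" (is ?z)
proof -
  have i: "integrable M (\<lambda>x. P x * iexp (a * S x + t * X x))" for a
    using b by (intro bounded_integrable[where B=1] M) (auto simp: norm_mult)
  have e: "iexp (a * S x + t * X x) = iexp (a * S x) * iexp (t * X x)" for a x
    by (simp add: exp_add[symmetric] distrib_left)
  have c: "complex_of_real (P x * (1 + cos (S x))) * iexp (t * X x) = P x * iexp (0 * S x + t * X x) + P x * iexp (1 * S x + t * X x) / 2
      + P x * iexp ((-1) * S x + t * X x) / 2" for x
    unfolding e by (simp add: cos_of_real[symmetric] cos_exp_eq field_simps)
  have s: "complex_of_real (P x * (1 + sin (S x))) * iexp (t * X x) = P x * iexp (0 * S x + t * X x) + P x * iexp (1 * S x + t * X x) / (2 * \<i>)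
      - P x * iexp ((-1) * S x + t * X x) / (2 * \<i>)" for x
    unfolding e by (simp add: sin_of_real[symmetric] sin_exp_eq field_simps)
  show ?c unfolding c using i[of 0] i[of 1] i[of "-1"] by simp
  show ?s unfolding s using i[of 0] i[of 1] i[of "-1"] by simp
  have P2: "\<bar>P x * (1 + cos (S x))\<bar> \<le> 2" "\<bar>P x * (1 + sin (S x))\<bar> \<le> 2" for x
  proof -
    have "\<bar>1 + cos (S x)\<bar> \<le> 2" "\<bar>1 + sin (S x)\<bar> \<le> 2"
      using abs_cos_le_one[of "S x"] abs_sin_le_one[of "S x"] by linarith+
    then show "\<bar>P x * (1 + cos (S x))\<bar> \<le> 2" "\<bar>P x * (1 + sin (S x))\<bar> \<le> 2"
      using b[of x] mult_mono[of "\<bar>P x\<bar>" 1 "\<bar>1 + cos (S x)\<bar>" 2] mult_mono[of "\<bar>P x\<bar>" 1 "\<bar>1 + sin (S x)\<bar>" 2]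
      by (auto simp: abs_mult)
  qed
  have iA: "integrable M (\<lambda>x. P x * indicator A (X x))"
    "integrable M (\<lambda>x. (P x * (1 + cos (S x))) * indicator A (X x))"
    "integrable M (\<lambda>x. (P x * (1 + sin (S x))) * indicator A (X x))"
    using b P2 by (auto intro!: bounded_integrable[where B=2] M simp: indicator_def intro: order_trans[OF _ one_le_numeral])
  have z: "complex_of_real (P x * indicator A (X x)) * iexp (S x)
      = complex_of_real ((P x * (1 + cos (S x))) * indicator A (X x)) - complex_of_real (P x * indicator A (X x))
          + \<i> * (complex_of_real ((P x * (1 + sin (S x))) * indicator A (X x)) - complex_of_real (P x * indicator A (X x)))" for x
    by (simp add: complex_eq_iff exp_Euler cos_of_real sin_of_real algebra_simps)
  have "(CLINT x|M. complex_of_real (f x) - complex_of_real (h x) + \<i> * (complex_of_real (f' x) - complex_of_real (h x)))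
      = complex_of_real (LINT x|M. f x) - complex_of_real (LINT x|M. h x) + \<i> * (complex_of_real (LINT x|M. f' x) - complex_of_real (LINT x|M. h x))"
    if "integrable M f" "integrable M h" "integrable M f'" for f h f' :: "'a \<Rightarrow> real"
    using that by simp
  from this[OF iA(2,1,3)] show ?z unfolding z .
qed

text \<open>The inductive step towards several dimensions: knowing all phases in
  \<open>(S, X)\<close> jointly, one may trade the phase in \<open>X\<close> for an indicator of
  \<open>X\<close> while the phase in \<open>S\<close> survives.\<close>

lemma phase_uniqueness:
  fixes P1 S1 X1 :: "'a \<Rightarrow> real" and P2 S2 X2 :: "'b \<Rightarrow> real"
  assumes M: "prob_space M1" "prob_space M2"
    and P [measurable]: "P1 \<in> borel_measurable M1" "P2 \<in> borel_measurable M2"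
    and Pb: "\<And>x. 0 \<le> P1 x" "\<And>x. P1 x \<le> 1" "\<And>x. 0 \<le> P2 x" "\<And>x. P2 x \<le> 1"
    and X [measurable]: "X1 \<in> borel_measurable M1" "X2 \<in> borel_measurable M2"
    and S [measurable]: "S1 \<in> borel_measurable M1" "S2 \<in> borel_measurable M2"
    and eq: "\<And>a t. (CLINT x|M1. P1 x * iexp (a * S1 x + t * X1 x)) = (CLINT x|M2. P2 x * iexp (a * S2 x + t * X2 x))"
    and A [measurable]: "A \<in> sets borel"
  shows "(CLINT x|M1. (P1 x * indicator A (X1 x)) * iexp (S1 x)) = (CLINT x|M2. (P2 x * indicator A (X2 x)) * iexp (S2 x))"
proof -
  have pos: "0 \<le> 1 + cos s" "0 \<le> 1 + sin s" for s :: real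
    using cos_ge_minus_one[of s] sin_ge_minus_one[of s] by linarith+
  have b2: "0 \<le> p" "p \<le> 1 \<Longrightarrow> p * (1 + cos s) \<le> 2" "p \<le> 1 \<Longrightarrow> p * (1 + sin s) \<le> 2"
      "0 \<le> p * (1 + cos s)" "0 \<le> p * (1 + sin s)" if "0 \<le> p" for p s :: real
    using that cos_le_one[of s] sin_le_one[of s] pos[of s]
      mult_mono[of p 1 "1 + cos s" 2] mult_mono[of p 1 "1 + sin s" 2] by auto
  note g1 = phase_integrals[OF M(1) P(1) X(1) S(1) A Pb(1,2)]
  note g2 = phase_integrals[OF M(2) P(2) X(2) S(2) A Pb(3,4)]
  have e0: "(LINT x|M1. P1 x * indicator A (X1 x)) = (LINT x|M2. P2 x * indicator A (X2 x))"
    using Pb eq[of 0] by (intro weighted_uniqueness[where B=1] M) auto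
  have ms: "(\<lambda>x. P1 x * (1 + cos (S1 x))) \<in> borel_measurable M1" "(\<lambda>x. P2 x * (1 + cos (S2 x))) \<in> borel_measurable M2"
    "(\<lambda>x. P1 x * (1 + sin (S1 x))) \<in> borel_measurable M1" "(\<lambda>x. P2 x * (1 + sin (S2 x))) \<in> borel_measurable M2"
    by measurable
  have e1: "(LINT x|M1. (P1 x * (1 + cos (S1 x))) * indicator A (X1 x)) = (LINT x|M2. (P2 x * (1 + cos (S2 x))) * indicator A (X2 x))"
    by (rule weighted_uniqueness[where B=2, OF M ms(1,2) _ _ _ _ X _ A]) (auto intro: b2 Pb simp only: g1 g2 eq)
  have e2: "(LINT x|M1. (P1 x * (1 + sin (S1 x))) * indicator A (X1 x)) = (LINT x|M2. (P2 x * (1 + sin (S2 x))) * indicator A (X2 x))"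
    by (rule weighted_uniqueness[where B=2, OF M ms(3,4) _ _ _ _ X _ A]) (auto intro: b2 Pb simp only: g1 g2 eq)
  show ?thesis unfolding g1 g2 e0 e1 e2 by simp
qed

lemma sum_insert_scaled:
  fixes X :: "'i \<Rightarrow> 'a \<Rightarrow> real"
  assumes "finite K" "k \<notin> K"
  shows "(\<Sum>i\<in>insert k K. (if i = k then t else a * c i) * X i x) = a * (\<Sum>i\<in>K. c i * X i x) + t * X k x"
proof -
  have "(\<Sum>i\<in>K. (if i = k then t else a * c i) * X i x) = a * (\<Sum>i\<in>K. c i * X i x)"
    using assms(2) by (auto simp: sum_distrib_left mult.assoc intro!: sum.cong)
  then show ?thesis using assms by (subst sum.insert) auto
qed

text \<open>The coordinates are replaced by indicators one at a time; the nonnegative weights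
  \<open>P * (1 + cos S)\<close> and \<open>P * (1 + sin S)\<close> make the one-dimensional theorem applicable.\<close>

lemma cylinder_uniqueness:
  fixes X1 :: "'i \<Rightarrow> 'a \<Rightarrow> real" and X2 :: "'i \<Rightarrow> 'b \<Rightarrow> real"
  assumes M: "prob_space M1" "prob_space M2" and I: "finite I"
    and X: "\<And>i. i \<in> I \<Longrightarrow> X1 i \<in> borel_measurable M1" "\<And>i. i \<in> I \<Longrightarrow> X2 i \<in> borel_measurable M2"
    and eq: "\<And>c. (CLINT x|M1. iexp (\<Sum>i\<in>I. c i * X1 i x)) = (CLINT x|M2. iexp (\<Sum>i\<in>I. c i * X2 i x))"
    and J: "J \<subseteq> I" and B: "\<And>j. j \<in> J \<Longrightarrow> B j \<in> sets borel"
  shows "(CLINT x|M1. complex_of_real (\<Prod>j\<in>J. indicator (B j) (X1 j x)) * iexp (\<Sum>i\<in>I - J. c i * X1 i x))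
       = (CLINT x|M2. complex_of_real (\<Prod>j\<in>J. indicator (B j) (X2 j x)) * iexp (\<Sum>i\<in>I - J. c i * X2 i x))"
  using finite_subset[OF J I] J B
proof (induction J arbitrary: c rule: finite_induct)
  case empty
  then show ?case using eq by simp
next
  case (insert k J)
  have k: "k \<in> I" and JI: "J \<subseteq> I" using insert.prems by auto
  let ?P = "\<lambda>X x. \<Prod>j\<in>J. indicator (B j) (X j x) :: real"
  let ?S = "\<lambda>X x. \<Sum>i\<in>I - insert k J. c i * X i x :: real"
  have Pm: "(\<lambda>x. ?P X1 x) \<in> borel_measurable M1" "(\<lambda>x. ?P X2 x) \<in> borel_measurable M2"
    using X JI insert.prems(2) by (auto intro!: borel_measurable_prod borel_measurable_indicator' measurable_sets)
  have Sm: "(\<lambda>x. ?S X1 x) \<in> borel_measurable M1" "(\<lambda>x. ?S X2 x) \<in> borel_measurable M2"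
    using X by auto
  have Pb: "0 \<le> ?P X1 x" "?P X1 x \<le> 1" "0 \<le> ?P X2 y" "?P X2 y \<le> 1" for x y
    by (auto intro!: prod_nonneg prod_le_1)
  have kd: "I - J = insert k (I - insert k J)" using k insert.hyps by auto
  have "(CLINT x|M1. complex_of_real (?P X1 x * indicator (B k) (X1 k x)) * iexp (?S X1 x))
      = (CLINT x|M2. complex_of_real (?P X2 x * indicator (B k) (X2 k x)) * iexp (?S X2 x))"
  proof (rule phase_uniqueness[OF M Pm Pb X(1)[OF k] X(2)[OF k] Sm])
    fix a t
    show "(CLINT x|M1. complex_of_real (?P X1 x) * iexp (a * ?S X1 x + t * X1 k x))
        = (CLINT x|M2. complex_of_real (?P X2 x) * iexp (a * ?S X2 x + t * X2 k x))"
    proof -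
      have k': "finite (I - insert k J)" "k \<notin> I - insert k J" using I by auto
      show ?thesis
        using insert.IH[OF JI insert.prems(2), where c="\<lambda>i. if i = k then t else a * c i"]
        unfolding kd sum_insert_scaled[OF k'] by blast
    qed
  qed (use insert.prems in auto)
  then show ?case using insert.hyps by (simp add: mult.commute)
qed

lemma measure_distr_indicator:
  assumes "prob_space M" and f: "f \<in> measurable M N" and S: "S \<in> sets N"
  shows "measure (distr M N f) S = (LINT x|M. indicator S (f x))"
proof -
  interpret prob_space M by fact
  have "measure (distr M N f) S = measure M (f -` S \<inter> space M)"
    by (rule measure_distr[OF f S])
  also have "\<dots> = (LINT x|M. indicator (f -` S \<inter> space M) x)"
    by simp
  also have "\<dots> = (LINT x|M. indicator S (f x))"
    by (intro Bochner_Integration.integral_cong) (auto simp: indicator_def)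
  finally show ?thesis .
qed

lemma indicator_PiE:
  "finite I \<Longrightarrow> f \<in> extensional I \<Longrightarrow> indicator (Pi\<^sub>E I B) f = (\<Prod>j\<in>I. indicator (B j) (f j) :: real)"
  by (auto simp: indicator_def PiE_iff prod_zero_iff)

text \<open>Once all coordinates have been traded for indicators, the two laws agree on rectangles,
  which generate the product sigma-algebra.\<close>

theorem vector_uniqueness:
  fixes X1 :: "'i \<Rightarrow> 'a \<Rightarrow> real" and X2 :: "'i \<Rightarrow> 'b \<Rightarrow> real"
  assumes M: "prob_space M1" "prob_space M2" and I: "finite I"
    and X: "\<And>i. i \<in> I \<Longrightarrow> X1 i \<in> borel_measurable M1" "\<And>i. i \<in> I \<Longrightarrow> X2 i \<in> borel_measurable M2"
    and eq: "\<And>c. (CLINT x|M1. iexp (\<Sum>i\<in>I. c i * X1 i x)) = (CLINT x|M2. iexp (\<Sum>i\<in>I. c i * X2 i x))"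
  shows "distr M1 (PiM I (\<lambda>_. borel)) (\<lambda>x. \<lambda>i\<in>I. X1 i x) = distr M2 (PiM I (\<lambda>_. borel)) (\<lambda>x. \<lambda>i\<in>I. X2 i x)"
proof (rule measure_eqI_PiM_finite[OF I])
  interpret M1: prob_space M1 by fact
  interpret M2: prob_space M2 by fact
  have m: "(\<lambda>x. \<lambda>i\<in>I. X1 i x) \<in> measurable M1 (PiM I (\<lambda>_. borel))" "(\<lambda>x. \<lambda>i\<in>I. X2 i x) \<in> measurable M2 (PiM I (\<lambda>_. borel))"
    using X by (auto intro!: measurable_restrict)
  fix B :: "'i \<Rightarrow> real set" assume B: "\<And>i. i \<in> I \<Longrightarrow> B i \<in> sets borel"
  have S: "Pi\<^sub>E I B \<in> sets (PiM I (\<lambda>_. borel))" using I B by (intro sets_PiM_I_finite) auto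
  have "complex_of_real (LINT x|M1. (\<Prod>j\<in>I. indicator (B j) (X1 j x))) = complex_of_real (LINT x|M2. (\<Prod>j\<in>I. indicator (B j) (X2 j x)))"
    using cylinder_uniqueness[OF M I X eq order_refl B, where c="\<lambda>_. 0"] by (simp del: of_real_prod of_real_eq_iff)
  then have e: "(LINT x|M1. (\<Prod>j\<in>I. indicator (B j) (X1 j x))) = (LINT x|M2. (\<Prod>j\<in>I. indicator (B j) (X2 j x)) :: real)"
    by (simp only: of_real_eq_iff)
  have i: "indicator (Pi\<^sub>E I B) (\<lambda>i\<in>I. X1 i x) = (\<Prod>j\<in>I. indicator (B j) (X1 j x) :: real)"
     "indicator (Pi\<^sub>E I B) (\<lambda>i\<in>I. X2 i y) = (\<Prod>j\<in>I. indicator (B j) (X2 j y) :: real)" for x y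
    using indicator_PiE[OF I restrict_extensional, of B "\<lambda>i. X1 i x"] indicator_PiE[OF I restrict_extensional, of B "\<lambda>i. X2 i y"]
    by (auto cong: prod.cong)
  have "measure (distr M1 (PiM I (\<lambda>_. borel)) (\<lambda>x. \<lambda>i\<in>I. X1 i x)) (Pi\<^sub>E I B) = (LINT x|M1. indicator (Pi\<^sub>E I B) (\<lambda>i\<in>I. X1 i x))"
    by (rule measure_distr_indicator[OF M(1) m(1) S])
  moreover have "measure (distr M2 (PiM I (\<lambda>_. borel)) (\<lambda>x. \<lambda>i\<in>I. X2 i x)) (Pi\<^sub>E I B) = (LINT x|M2. indicator (Pi\<^sub>E I B) (\<lambda>i\<in>I. X2 i x))"
    by (rule measure_distr_indicator[OF M(2) m(2) S])
  ultimately have "measure (distr M1 (PiM I (\<lambda>_. borel)) (\<lambda>x. \<lambda>i\<in>I. X1 i x)) (Pi\<^sub>E I B)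
     = measure (distr M2 (PiM I (\<lambda>_. borel)) (\<lambda>x. \<lambda>i\<in>I. X2 i x)) (Pi\<^sub>E I B)"
    unfolding i e by simp
  moreover have "prob_space (distr M1 (PiM I (\<lambda>_. borel)) (\<lambda>x. \<lambda>i\<in>I. X1 i x))" "prob_space (distr M2 (PiM I (\<lambda>_. borel)) (\<lambda>x. \<lambda>i\<in>I. X2 i x))"
    using M1.prob_space_distr[OF m(1)] M2.prob_space_distr[OF m(2)] by auto
  ultimately show "emeasure (distr M1 (PiM I (\<lambda>_. borel)) (\<lambda>x. \<lambda>i\<in>I. X1 i x)) (Pi\<^sub>E I B)
     = emeasure (distr M2 (PiM I (\<lambda>_. borel)) (\<lambda>x. \<lambda>i\<in>I. X2 i x)) (Pi\<^sub>E I B)"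
    by (simp add: finite_measure.emeasure_eq_measure prob_space.finite_measure)
next
  interpret M1: prob_space M1 by fact
  have m: "(\<lambda>x. \<lambda>i\<in>I. X1 i x) \<in> measurable M1 (PiM I (\<lambda>_. borel))"
    using X by (auto intro!: measurable_restrict)
  show "range (\<lambda>_::nat. Pi\<^sub>E I (\<lambda>_. UNIV)) \<subseteq> prod_algebra I (\<lambda>_. borel :: real measure)"
    using I by (auto intro!: prod_algebraI_finite)
  show "(\<Union>i::nat. Pi\<^sub>E I (\<lambda>_. UNIV)) = space (PiM I (\<lambda>_. borel :: real measure))"
    by (simp add: space_PiM)
  show "emeasure (distr M1 (PiM I (\<lambda>_. borel)) (\<lambda>x. \<lambda>i\<in>I. X1 i x)) (Pi\<^sub>E I (\<lambda>_. UNIV)) \<noteq> \<infinity>"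
    using prob_space.finite_measure[OF M1.prob_space_distr[OF m]] by (simp add: finite_measure.emeasure_eq_measure)
qed auto

section \<open>Independence of orthogonal Gaussian forms\<close>

lemma complex_integral_pair_mult:
  fixes f :: "'a \<Rightarrow> complex" and h :: "'b \<Rightarrow> complex"
  assumes M: "prob_space M" "prob_space N"
    and [measurable]: "f \<in> borel_measurable M" "h \<in> borel_measurable N"
    and b: "\<And>x. cmod (f x) \<le> 1" "\<And>x. cmod (h x) \<le> 1"
  shows "(CLINT p|M \<Otimes>\<^sub>M N. f (fst p) * h (snd p)) = (CLINT x|M. f x) * (CLINT x|N. h x)"
proof -
  interpret M: prob_space M by fact
  interpret N: prob_space N by fact
  interpret P: pair_prob_space M N ..
  have "integrable (M \<Otimes>\<^sub>M N) (\<lambda>p. f (fst p) * h (snd p))"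
    using b by (intro bounded_integrable[where B=1] P.prob_space_axioms) (auto simp: norm_mult intro: mult_le_one)
  from P.integral_fst'[OF this] show ?thesis by simp
qed

lemma gaussian_two_forms:
  assumes g: "gaussian_family M I X C" and orth: "bform I C u v = 0"
  shows "(CLINT \<omega>|M. iexp (a * (\<Sum>i\<in>I. v i * X i \<omega>) + t * (\<Sum>i\<in>I. u i * X i \<omega>)))
     = complex_of_real (exp (- bform I C u u * t\<^sup>2 / 2) * exp (- bform I C v v * a\<^sup>2 / 2))"
proof -
  have e: "a * (\<Sum>i\<in>I. v i * X i \<omega>) + t * (\<Sum>i\<in>I. u i * X i \<omega>) = (\<Sum>i\<in>I. (a * v i + t * u i) * X i \<omega>)" for \<omega>
    by (simp add: sum_distrib_left sum.distrib[symmetric] algebra_simps)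
  have "bform I C v u = 0"
    using orth bform_sym[OF gaussian_familyD(5)[OF g]] by metis
  then have "bform I C (\<lambda>i. a * v i + t * u i) (\<lambda>i. a * v i + t * u i) = a\<^sup>2 * bform I C v v + t\<^sup>2 * bform I C u u"
    by (simp add: bform_add_left bform_add_right bform_cmult_left bform_cmult_right orth power2_eq_square)
  then show ?thesis
    unfolding e gaussian_familyD(6)[OF g] by (simp add: exp_add[symmetric] field_simps)
qed

text \<open>The pair of forms is compared with its independent version on the product space.
  Orthogonality makes their joint characteristic functions agree, and
  \<open>phase_uniqueness\<close> with \<open>P = 1\<close> passes to the indicator.\<close>

lemma gaussian_orthogonal_indep:
  assumes g: "gaussian_family M I X C" and orth: "bform I C u v = 0" and A [measurable]: "A \<in> sets borel"
  shows "(CLINT \<omega>|M. complex_of_real (indicator A (\<Sum>i\<in>I. u i * X i \<omega>)) * iexp (\<Sum>i\<in>I. v i * X i \<omega>))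
     = complex_of_real (LINT \<omega>|M. indicator A (\<Sum>i\<in>I. u i * X i \<omega>)) * (CLINT \<omega>|M. iexp (\<Sum>i\<in>I. v i * X i \<omega>))"
proof -
  define U where "U = (\<lambda>\<omega>. \<Sum>i\<in>I. u i * X i \<omega>)"
  define V where "V = (\<lambda>\<omega>. \<Sum>i\<in>I. v i * X i \<omega>)"
  have [measurable]: "U \<in> borel_measurable M" "V \<in> borel_measurable M"
    unfolding U_def V_def by (rule gaussian_lin_measurable[OF g])+
  have M: "prob_space M" by (rule gaussian_familyD(1)[OF g])
  interpret M: prob_space M by fact
  interpret P: pair_prob_space M M ..
  have eq: "(CLINT x|M. iexp (a * V x + t * U x)) = (CLINT p|M \<Otimes>\<^sub>M M. iexp (a * V (snd p) + t * U (fst p)))" for a t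
  proof -
    have "(CLINT p|M \<Otimes>\<^sub>M M. iexp (a * V (snd p) + t * U (fst p)))
        = (CLINT p|M \<Otimes>\<^sub>M M. iexp (t * U (fst p)) * iexp (a * V (snd p)))"
      by (simp add: exp_add[symmetric] algebra_simps)
    also have "\<dots> = (CLINT x|M. iexp (t * U x)) * (CLINT x|M. iexp (a * V x))"
      by (rule complex_integral_pair_mult[OF M M]) auto
    also have "\<dots> = (CLINT x|M. iexp (a * V x + t * U x))"
      using gaussian_two_forms[OF g orth, of a t] gaussian_two_forms[OF g orth, of 0 t] gaussian_two_forms[OF g orth, of a 0]
      by (simp add: U_def V_def)
    finally show ?thesis by simp
  qed
  have "(CLINT x|M. complex_of_real (1 * indicator A (U x)) * iexp (V x))
     = (CLINT p|M \<Otimes>\<^sub>M M. complex_of_real (1 * indicator A (U (fst p))) * iexp (V (snd p)))"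
  proof (rule phase_uniqueness[OF M P.prob_space_axioms])
    fix a t
    show "(CLINT x|M. complex_of_real 1 * iexp (a * V x + t * U x))
       = (CLINT p|M \<Otimes>\<^sub>M M. complex_of_real 1 * iexp (a * V (snd p) + t * U (fst p)))"
      unfolding of_real_1 mult_1_left by (rule eq)
  qed auto
  also have "\<dots> = (CLINT x|M. complex_of_real (indicator A (U x))) * (CLINT x|M. iexp (V x))"
    unfolding mult_1_left by (rule complex_integral_pair_mult[OF M M]) (auto simp: indicator_def)
  also have "(CLINT x|M. complex_of_real (indicator A (U x))) = complex_of_real (LINT x|M. indicator A (U x))"
    by (rule integral_complex_of_real)
  finally show ?thesis unfolding U_def V_def by simp
qed

text \<open>The indicator of \<open>S\<close> depends only on the form \<open>d\<close>, so it
  factors out of each characteristic function and cancels against the normalisation by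
  \<open>measure M S\<close>.\<close>

lemma gaussian_conditional:
  assumes g: "gaussian_family M I X C" and J: "finite J"
    and orth: "\<And>j. j \<in> J \<Longrightarrow> bform I C d (T j) = 0"
    and S: "S = {\<omega>\<in>space M. a \<le> (\<Sum>i\<in>I. d i * X i \<omega>)}" and p: "measure M S > 0"
  shows "gaussian_family (uniform_measure M S) J (\<lambda>j \<omega>. \<Sum>i\<in>I. T j i * X i \<omega>) (\<lambda>j k. bform I C (T j) (T k))"
proof -
  interpret M: prob_space M by (rule gaussian_familyD(1)[OF g])
  note lm [measurable] = gaussian_lin_measurable[OF g]
  have [measurable]: "S \<in> sets M" unfolding S by measurable
  note img = gaussian_linear_image[OF g J, of T]
  have "(CLINT \<omega>|uniform_measure M S. iexp (\<Sum>j\<in>J. c j * (\<Sum>i\<in>I. T j i * X i \<omega>)))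
      = (CLINT \<omega>|M. iexp (\<Sum>j\<in>J. c j * (\<Sum>i\<in>I. T j i * X i \<omega>)))" for c
  proof -
    define v where "v = (\<lambda>i. \<Sum>j\<in>J. c j * T j i)"
    have lin: "(\<Sum>j\<in>J. c j * (\<Sum>i\<in>I. T j i * X i \<omega>)) = (\<Sum>i\<in>I. v i * X i \<omega>)" for \<omega>
      unfolding v_def by (simp add: sum_distrib_left sum_distrib_right mult.assoc) (rule sum.swap)
    have o: "bform I C d v = 0"
      unfolding v_def by (simp add: bform_sum_right bform_cmult_right orth)
    have ind: "indicator {a..} (\<Sum>i\<in>I. d i * X i \<omega>) = (indicator S \<omega> :: real)" if "\<omega> \<in> space M" for \<omega>
      using that by (auto simp: S indicator_def)
    have U: "uniform_measure M S = density M (\<lambda>x. ennreal (indicator S x / measure M S))"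
      unfolding uniform_measure_def using p
      by (intro density_cong) (auto simp: M.emeasure_eq_measure divide_ennreal[symmetric] ennreal_indicator)
    have "(CLINT \<omega>|uniform_measure M S. iexp (\<Sum>i\<in>I. v i * X i \<omega>))
        = (CLINT \<omega>|M. (indicator S \<omega> / measure M S) *\<^sub>R iexp (\<Sum>i\<in>I. v i * X i \<omega>))"
    proof -
      have "(\<lambda>\<omega>. iexp (\<Sum>i\<in>I. v i * X i \<omega>)) \<in> borel_measurable M" by measurable
      then show ?thesis unfolding U by (intro integral_density) auto
    qed
    also have "\<dots> = (CLINT \<omega>|M. complex_of_real (indicator {a..} (\<Sum>i\<in>I. d i * X i \<omega>)) * iexp (\<Sum>i\<in>I. v i * X i \<omega>) / measure M S)"
      by (intro Bochner_Integration.integral_cong) (auto simp: ind scaleR_conv_of_real)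
    also have "\<dots> = complex_of_real (LINT \<omega>|M. indicator {a..} (\<Sum>i\<in>I. d i * X i \<omega>)) * (CLINT \<omega>|M. iexp (\<Sum>i\<in>I. v i * X i \<omega>)) / measure M S"
      using gaussian_orthogonal_indep[OF g o, of "{a..}"] by simp
    also have "(LINT \<omega>|M. indicator {a..} (\<Sum>i\<in>I. d i * X i \<omega>)) = (LINT \<omega>|M. indicator S \<omega> :: real)"
      by (intro Bochner_Integration.integral_cong) (auto simp: ind)
    also have "(LINT \<omega>|M. indicator S \<omega> :: real) = measure M S" by simp
    finally show ?thesis unfolding lin using p by simp
  qed
  moreover have "prob_space (uniform_measure M S)"
    using p by (intro prob_space_uniform_measure) (auto simp: M.emeasure_eq_measure)
  ultimately show ?thesis
    using img unfolding gaussian_family_def by (auto simp: measurable_def uniform_measure_def)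
qed

section \<open>Gaussian concentration\<close>

text \<open>Rotation invariance of two independent copies. The boolean index distinguishes position
  from velocity along the rotating path, so that one functional \<open>H\<close> can see
  both.\<close>

lemma gaussian_rotation:
  assumes g: "gaussian_family M I X C"
    and H: "H \<in> borel_measurable (PiM (I \<times> UNIV) (\<lambda>_. borel))"
  shows "(\<integral>\<^sup>+p. H (\<lambda>(i, b)\<in>I \<times> UNIV. if b then - sin t * X i (fst p) + cos t * X i (snd p)
              else cos t * X i (fst p) + sin t * X i (snd p)) \<partial>(M \<Otimes>\<^sub>M M))
       = (\<integral>\<^sup>+p. H (\<lambda>(i, b)\<in>I \<times> UNIV. if b then X i (snd p) else X i (fst p)) \<partial>(M \<Otimes>\<^sub>M M))"
proof -
  have M: "prob_space M" by (rule gaussian_familyD(1)[OF g])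
  have I: "finite I" by (rule gaussian_familyD(2)[OF g])
  have Xm: "X i \<in> borel_measurable M" if "i \<in> I" for i by (rule gaussian_familyD(3)[OF g that])
  interpret M: prob_space M by fact
  interpret P: pair_prob_space M M ..
  define Z1 where "Z1 = (\<lambda>(i, b) p. if b then - sin t * X i (fst p) + cos t * X i (snd p)
              else cos t * X i (fst p) + sin t * X i (snd p))"
  define Z2 where "Z2 = (\<lambda>(i, b) p. if b then X i (snd p) else X i (fst p))"
  have Xm1: "(\<lambda>p. X i (fst p)) \<in> borel_measurable (M \<Otimes>\<^sub>M M)" if "i \<in> I" for i
    using Xm[OF that] by measurable
  have Xm2: "(\<lambda>p. X i (snd p)) \<in> borel_measurable (M \<Otimes>\<^sub>M M)" if "i \<in> I" for i
    using Xm[OF that] by measurable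
  have Zm: "Z1 k \<in> borel_measurable (M \<Otimes>\<^sub>M M)" "Z2 k \<in> borel_measurable (M \<Otimes>\<^sub>M M)" if "k \<in> I \<times> UNIV" for k
    using that Xm1 Xm2 unfolding Z1_def Z2_def by (cases k; cases "snd k"; auto)+
  have two: "(CLINT p|M \<Otimes>\<^sub>M M. iexp (\<Sum>i\<in>I. c i * X i (fst p) + d i * X i (snd p)))
      = complex_of_real (exp (- (bform I C c c + bform I C d d) / 2))" for c d
  proof -
    have "(CLINT p|M \<Otimes>\<^sub>M M. iexp (\<Sum>i\<in>I. c i * X i (fst p) + d i * X i (snd p)))
        = (CLINT p|M \<Otimes>\<^sub>M M. (\<lambda>\<omega>. iexp (\<Sum>i\<in>I. c i * X i \<omega>)) (fst p) * (\<lambda>\<omega>. iexp (\<Sum>i\<in>I. d i * X i \<omega>)) (snd p))"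
      by (simp add: exp_add[symmetric] sum.distrib distrib_left)
    also have "\<dots> = (CLINT \<omega>|M. iexp (\<Sum>i\<in>I. c i * X i \<omega>)) * (CLINT \<omega>|M. iexp (\<Sum>i\<in>I. d i * X i \<omega>))"
    proof -
      note lm [measurable] = gaussian_lin_measurable[OF g]
      have m: "(\<lambda>\<omega>. iexp (\<Sum>i\<in>I. c i * X i \<omega>)) \<in> borel_measurable M" for c by measurable
      show ?thesis
        by (rule complex_integral_pair_mult[OF M M m m]) (simp_all only: norm_exp_i_times order_refl)
    qed
    also have "\<dots> = complex_of_real (exp (- (bform I C c c + bform I C d d) / 2))"
    proof -
      have "exp (- (x + y) / 2) = exp (- x / 2) * exp (- y / 2)" for x y :: real
        by (simp add: exp_add[symmetric] field_simps)
      then show ?thesis unfolding gaussian_familyD(6)[OF g] by simp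
    qed
    finally show ?thesis .
  qed
  have UB: "(\<Sum>k\<in>I \<times> UNIV. f k) = (\<Sum>i\<in>I. f (i, False) + f (i, True))" for f :: "_ \<Rightarrow> real"
    by (simp add: sum.cartesian_product[symmetric, where g="\<lambda>i b. f (i, b)", simplified] UNIV_bool add.commute)
  have "(CLINT p|M \<Otimes>\<^sub>M M. iexp (\<Sum>k\<in>I \<times> UNIV. c k * Z1 k p)) = (CLINT p|M \<Otimes>\<^sub>M M. iexp (\<Sum>k\<in>I \<times> UNIV. c k * Z2 k p))" for c
  proof -
    define c0 c1 where "c0 = (\<lambda>i. c (i, False))" and "c1 = (\<lambda>i. c (i, True))"
    have s2: "(\<Sum>k\<in>I \<times> UNIV. c k * Z2 k p) = (\<Sum>i\<in>I. c0 i * X i (fst p) + c1 i * X i (snd p))" for p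
      unfolding UB by (simp add: Z2_def c0_def c1_def)
    have s1: "(\<Sum>k\<in>I \<times> UNIV. c k * Z1 k p) = (\<Sum>i\<in>I. (cos t * c0 i - sin t * c1 i) * X i (fst p) + (sin t * c0 i + cos t * c1 i) * X i (snd p))" for p
      unfolding UB by (simp add: Z1_def c0_def c1_def algebra_simps)
    \<comment> \<open>The cross terms of the two rotated forms have opposite signs, so the total
      variance depends only on \<open>x^2 + y^2\<close>.\<close>
    have rot: "bform I C (\<lambda>i. x * c0 i - y * c1 i) (\<lambda>i. x * c0 i - y * c1 i)
        + bform I C (\<lambda>i. y * c0 i + x * c1 i) (\<lambda>i. y * c0 i + x * c1 i)
        = (x\<^sup>2 + y\<^sup>2) * (bform I C c0 c0 + bform I C c1 c1)" for x y
      by (simp add: bform_add_left bform_add_right bform_diff_left bform_diff_right bform_cmult_left bform_cmult_right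
          power2_eq_square algebra_simps)
    have "bform I C (\<lambda>i. cos t * c0 i - sin t * c1 i) (\<lambda>i. cos t * c0 i - sin t * c1 i)
        + bform I C (\<lambda>i. sin t * c0 i + cos t * c1 i) (\<lambda>i. sin t * c0 i + cos t * c1 i)
        = ((cos t)\<^sup>2 + (sin t)\<^sup>2) * (bform I C c0 c0 + bform I C c1 c1)"
      by (rule rot)
    then show ?thesis unfolding s1 s2 two by simp
  qed
  from vector_uniqueness[OF P.prob_space_axioms P.prob_space_axioms _ Zm this]
  have d: "distr (M \<Otimes>\<^sub>M M) (PiM (I \<times> UNIV) (\<lambda>_. borel)) (\<lambda>p. \<lambda>k\<in>I \<times> UNIV. Z1 k p)
      = distr (M \<Otimes>\<^sub>M M) (PiM (I \<times> UNIV) (\<lambda>_. borel)) (\<lambda>p. \<lambda>k\<in>I \<times> UNIV. Z2 k p)"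
    using I by simp
  have rm: "(\<lambda>p. \<lambda>k\<in>I \<times> UNIV. Z1 k p) \<in> measurable (M \<Otimes>\<^sub>M M) (PiM (I \<times> UNIV) (\<lambda>_. borel))"
    "(\<lambda>p. \<lambda>k\<in>I \<times> UNIV. Z2 k p) \<in> measurable (M \<Otimes>\<^sub>M M) (PiM (I \<times> UNIV) (\<lambda>_. borel))"
    using Zm by (auto intro!: measurable_restrict)
  have "(\<integral>\<^sup>+p. H (\<lambda>k\<in>I \<times> UNIV. Z1 k p) \<partial>(M \<Otimes>\<^sub>M M)) = (\<integral>\<^sup>+p. H (\<lambda>k\<in>I \<times> UNIV. Z2 k p) \<partial>(M \<Otimes>\<^sub>M M))"
    using nn_integral_distr[OF rm(1), of H] nn_integral_distr[OF rm(2), of H] H unfolding d by simp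
  then show ?thesis unfolding Z1_def Z2_def by (simp add: split_def)
qed

section \<open>The soft count and its concentration\<close>

definition logistic :: "real \<Rightarrow> real" where "logistic u = 1 / (1 + exp (- u))"

lemma logistic_pos: "0 < logistic u" and logistic_less_1: "logistic u < 1"
  by (simp_all add: logistic_def add_pos_pos)

lemma DERIV_logistic [derivative_intros]:
  assumes "(f has_real_derivative f') (at x)"
  shows "((\<lambda>x. logistic (f x)) has_real_derivative logistic (f x) * (1 - logistic (f x)) * f') (at x)"
proof -
  have p: "1 + exp (- f x) > 0" by (simp add: add_pos_pos)
  have "((\<lambda>x. logistic (f x)) has_real_derivative (exp (- f x) * f') / (1 + exp (- f x))\<^sup>2) (at x)"
    unfolding logistic_def using p
    by (auto intro!: derivative_eq_intros assms simp: power2_eq_square)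
  moreover have "(exp (- f x) * f') / (1 + exp (- f x))\<^sup>2 = logistic (f x) * (1 - logistic (f x)) * f'"
    using p by (simp add: logistic_def field_simps power2_eq_square)
  ultimately show ?thesis by simp
qed

text \<open>A smooth surrogate for the logarithm of the number of points of \<open>B\<close> above level \<open>a\<close>;
  its gradient has $\ell^1$-norm at most \<open>\<theta>\<close>, whatever the size of \<open>B\<close>.\<close>

definition softcount :: "real \<Rightarrow> real \<Rightarrow> 'i set \<Rightarrow> ('i \<Rightarrow> real) \<Rightarrow> real" where
  "softcount \<theta> a B \<phi> = ln (\<Sum>y\<in>B. logistic (\<theta> * (\<phi> y - a)))"

text \<open>The partial derivative of \<open>softcount\<close> in the coordinate
  \<open>y\<close>.\<close>

definition softgrad :: "real \<Rightarrow> real \<Rightarrow> 'i set \<Rightarrow> ('i \<Rightarrow> real) \<Rightarrow> 'i \<Rightarrow> real" where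
  "softgrad \<theta> a B \<phi> y = \<theta> * (logistic (\<theta> * (\<phi> y - a)) * (1 - logistic (\<theta> * (\<phi> y - a)))) / (\<Sum>z\<in>B. logistic (\<theta> * (\<phi> z - a)))"

lemma softsum_pos: "finite B \<Longrightarrow> B \<noteq> {} \<Longrightarrow> (\<Sum>y\<in>B. logistic (\<theta> * (\<phi> y - a))) > 0"
  by (intro sum_pos logistic_pos)

lemma softgrad_nonneg:
  assumes "\<theta> \<ge> 0"
  shows "softgrad \<theta> a B \<phi> y \<ge> 0"
  unfolding softgrad_def using assms less_imp_le[OF logistic_pos] less_imp_le[OF logistic_less_1]
  by (intro divide_nonneg_nonneg mult_nonneg_nonneg sum_nonneg) auto

text \<open>The derivative \<open>s * (1 - s)\<close> of the logistic function is at most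
  \<open>s\<close>, so the numerators sum to at most \<open>\<theta>\<close> times the common
  denominator.\<close>

lemma softgrad_sum:
  assumes "finite B" "B \<noteq> {}" "\<theta> \<ge> 0"
  shows "(\<Sum>y\<in>B. softgrad \<theta> a B \<phi> y) \<le> \<theta>"
proof -
  let ?s = "\<lambda>y. logistic (\<theta> * (\<phi> y - a))"
  have "(\<Sum>y\<in>B. softgrad \<theta> a B \<phi> y) = \<theta> * (\<Sum>y\<in>B. ?s y * (1 - ?s y)) / (\<Sum>y\<in>B. ?s y)"
    unfolding softgrad_def by (simp add: sum_divide_distrib sum_distrib_left)
  also have "\<dots> \<le> \<theta> * (\<Sum>y\<in>B. ?s y) / (\<Sum>y\<in>B. ?s y)"
  proof (intro divide_right_mono mult_left_mono sum_mono)
    show "?s y * (1 - ?s y) \<le> ?s y" for y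
      using logistic_pos[of "\<theta> * (\<phi> y - a)"] by (simp add: algebra_simps)
    show "0 \<le> (\<Sum>y\<in>B. ?s y)" using softsum_pos[OF assms(1,2)] less_imp_le by blast
  qed (use assms in auto)
  also have "\<dots> = \<theta>" using softsum_pos[OF assms(1,2), of \<theta> \<phi> a] by simp
  finally show ?thesis .
qed

lemma softcount_deriv:
  assumes "finite B" "B \<noteq> {}"
  shows "((\<lambda>t. softcount \<theta> a B (\<lambda>y. cos t * u y + sin t * v y)) has_real_derivative
     (\<Sum>y\<in>B. softgrad \<theta> a B (\<lambda>y. cos t * u y + sin t * v y) y * (- sin t * u y + cos t * v y))) (at t)"
proof -
  let ?s = "\<lambda>t y. logistic (\<theta> * (cos t * u y + sin t * v y - a))"
  have "((\<lambda>t. \<Sum>y\<in>B. ?s t y) has_real_derivative (\<Sum>y\<in>B. ?s t y * (1 - ?s t y) * (\<theta> * (- sin t * u y + cos t * v y)))) (at t)"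
    by (intro DERIV_sum) (auto intro!: derivative_eq_intros)
  from DERIV_chain2[OF DERIV_ln_divide[OF softsum_pos[OF assms]] this]
  show ?thesis
    unfolding softcount_def softgrad_def
    by (rule DERIV_cong) (simp add: sum_divide_distrib sum_distrib_left mult_ac)
qed

text \<open>Jensen's inequality for the uniform law on \<open>[0, T]\<close>, under which
  \<open>T * D\<close> has mean \<open>F T - F 0\<close>.\<close>

lemma exp_integral_jensen:
  fixes D :: "real \<Rightarrow> real"
  assumes T: "T > 0" and F: "\<And>t. (F has_real_derivative D t) (at t)" and D: "\<And>t. isCont D t"
  shows "ennreal (T * exp (F T - F 0)) \<le> (\<integral>\<^sup>+t. ennreal (exp (T * D t)) * indicator {0..T} t \<partial>lborel)"
proof -
  define m where "m = F T - F 0"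
  have ftc: "(LBINT t. D t * indicator {0..T} t) = m"
    unfolding m_def using T F D by (intro integral_FTC_Icc_real) auto
  have iD: "integrable lborel (\<lambda>t. D t * indicator {0..T} t)"
    using borel_integrable_atLeastAtMost[of 0 T D] D by (simp add: mult.commute)
  have iE: "integrable lborel (\<lambda>t. exp (T * D t) * indicator {0..T} t)"
    using borel_integrable_atLeastAtMost[of 0 T "\<lambda>t. exp (T * D t)"] D by (simp add: mult.commute)
  have i1: "integrable lborel (\<lambda>t. indicator {0..T} t :: real)"
    using T by (intro integrable_real_indicator) auto
  have "(LBINT t. exp m * ((1 - m) * indicator {0..T} t + T * (D t * indicator {0..T} t)))
      = exp m * ((1 - m) * (LBINT t. indicator {0..T} t) + T * (LBINT t. D t * indicator {0..T} t))"
    using iD i1 by simp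
  also have "\<dots> = T * exp m"
    unfolding ftc using T by (simp add: algebra_simps)
  finally have "T * exp m = (LBINT t. exp m * ((1 - m) * indicator {0..T} t + T * (D t * indicator {0..T} t)))"
    by simp
  also have "\<dots> \<le> (LBINT t. exp (T * D t) * indicator {0..T} t)"
  proof (rule integral_mono)
    show "integrable lborel (\<lambda>t. exp m * ((1 - m) * indicator {0..T} t + T * (D t * indicator {0..T} t)))"
      using iD i1 by (intro integrable_mult_right Bochner_Integration.integrable_add)
    fix t
    \<comment> \<open>The tangent of exp at the mean \<open>m\<close> lies below exp, and its
      integral is exactly the left-hand side.\<close>
    have "exp m * (1 + (T * D t - m)) \<le> exp m * exp (T * D t - m)"
      by (intro mult_left_mono exp_ge_add_one_self) simp
    also have "\<dots> = exp (T * D t)" by (simp add: exp_add[symmetric])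
    finally show "exp m * ((1 - m) * indicator {0..T} t + T * (D t * indicator {0..T} t)) \<le> exp (T * D t) * indicator {0..T} t"
      by (auto simp: indicator_def algebra_simps)
  qed (rule iE)
  finally have "ennreal (T * exp m) \<le> ennreal (LBINT t. exp (T * D t) * indicator {0..T} t)"
    by (rule ennreal_leI)
  also have "\<dots> = (\<integral>\<^sup>+t. ennreal (exp (T * D t) * indicator {0..T} t) \<partial>lborel)"
    by (intro nn_integral_eq_integral[symmetric] iE) auto
  also have "\<dots> = (\<integral>\<^sup>+t. ennreal (exp (T * D t)) * indicator {0..T} t \<partial>lborel)"
    by (intro nn_integral_cong) (auto simp: indicator_def)
  finally show ?thesis by (simp add: m_def)
qed

lemma softgrad_cong: "(\<And>y. y \<in> B \<Longrightarrow> \<phi> y = \<psi> y) \<Longrightarrow> z \<in> B \<Longrightarrow> softgrad \<theta> a B \<phi> z = softgrad \<theta> a B \<psi> z"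
  unfolding softgrad_def by (auto cong: sum.cong)

lemma logistic_measurable [measurable]: "logistic \<in> borel_measurable borel"
  unfolding logistic_def by measurable

lemma bform_le:
  assumes "\<And>y. y \<in> B \<Longrightarrow> 0 \<le> c y" "\<And>y z. y \<in> B \<Longrightarrow> z \<in> B \<Longrightarrow> C y z \<le> K" "(\<Sum>y\<in>B. c y) \<le> s" "0 \<le> K"
  shows "bform B C c c \<le> s\<^sup>2 * K"
proof -
  have "bform B C c c \<le> (\<Sum>y\<in>B. \<Sum>z\<in>B. c y * c z * K)"
    unfolding bform_def using assms by (intro sum_mono mult_left_mono) auto
  also have "\<dots> = (\<Sum>y\<in>B. c y)\<^sup>2 * K"
    unfolding power2_eq_square sum_product by (simp add: sum_distrib_right)
  also have "\<dots> \<le> s\<^sup>2 * K"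
    using assms by (intro mult_right_mono power_mono) (auto intro: sum_nonneg)
  finally show ?thesis .
qed

text \<open>The interpolation argument of Maurey and Pisier: two independent copies are joined by the
  rotation \<open>cos t * X + sin t * X'\<close>, whose velocity is an independent copy of its position.\<close>

lemma softcount_exp_moment:
  assumes g: "gaussian_family M B X C" and B: "B \<noteq> {}" and Xm [measurable]: "\<And>i. X i \<in> borel_measurable M"
    and th: "\<theta> \<ge> 0" and K: "K \<ge> 0" "\<And>y z. y \<in> B \<Longrightarrow> z \<in> B \<Longrightarrow> C y z \<le> K" and lam: "\<kappa> \<ge> 0"
  shows "(\<integral>\<^sup>+p. ennreal (exp (\<kappa> * (softcount \<theta> a B (\<lambda>y. X y (snd p)) - softcount \<theta> a B (\<lambda>y. X y (fst p))))) \<partial>(M \<Otimes>\<^sub>M M))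
      \<le> ennreal (exp ((pi / 2 * \<kappa> * \<theta>)\<^sup>2 * K / 2))"
proof -
  have M: "prob_space M" by (rule gaussian_familyD(1)[OF g])
  have fin [simp]: "finite B" by (rule gaussian_familyD(2)[OF g])
  interpret M: prob_space M by fact
  interpret P: pair_prob_space M M ..
  interpret L: pair_sigma_finite "M \<Otimes>\<^sub>M M" lborel ..
  \<comment> \<open>A quarter turn leads from the first copy to the second.\<close>
  define T where "T = pi / 2"
  have T: "T > 0" by (simp add: T_def)
  define \<phi> where "\<phi> = (\<lambda>p t y. cos t * X y (fst p) + sin t * X y (snd p))"
  define \<psi> where "\<psi> = (\<lambda>p t y. - sin t * X y (fst p) + cos t * X y (snd p))"
  define D where "D = (\<lambda>p t. \<kappa> * (\<Sum>y\<in>B. softgrad \<theta> a B (\<phi> p t) y * \<psi> p t y))"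
  define W where "W = (\<lambda>p. exp (\<kappa> * (softcount \<theta> a B (\<lambda>y. X y (snd p)) - softcount \<theta> a B (\<lambda>y. X y (fst p)))))"
  define Q where "Q = exp ((T * \<kappa> * \<theta>)\<^sup>2 * K / 2)"
  have [measurable]: "(\<lambda>(p, t). D p t) \<in> borel_measurable ((M \<Otimes>\<^sub>M M) \<Otimes>\<^sub>M lborel)"
    unfolding D_def \<phi>_def \<psi>_def softgrad_def split_def by measurable
  have [measurable]: "W \<in> borel_measurable (M \<Otimes>\<^sub>M M)"
    unfolding W_def softcount_def by measurable
  have path: "ennreal T * ennreal (W p) \<le> (\<integral>\<^sup>+t. ennreal (exp (T * D p t)) * indicator {0..T} t \<partial>lborel)" for p
  proof -
    have "ennreal (T * exp (\<kappa> * softcount \<theta> a B (\<phi> p T) - \<kappa> * softcount \<theta> a B (\<phi> p 0)))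
        \<le> (\<integral>\<^sup>+t. ennreal (exp (T * D p t)) * indicator {0..T} t \<partial>lborel)"
    proof (rule exp_integral_jensen[OF T, where F="\<lambda>t. \<kappa> * softcount \<theta> a B (\<phi> p t)"])
      fix t
      show "((\<lambda>t. \<kappa> * softcount \<theta> a B (\<phi> p t)) has_real_derivative D p t) (at t)"
        unfolding D_def \<phi>_def \<psi>_def by (intro DERIV_cmult softcount_deriv fin B)
      have "(\<Sum>z\<in>B. 1 / (1 + exp (- (\<theta> * (cos t * X z (fst p) + sin t * X z (snd p) - a))))) \<noteq> 0"
        using softsum_pos[OF fin B, of \<theta> "\<phi> p t" a] by (simp add: logistic_def \<phi>_def)
      moreover have "1 + exp u \<noteq> 0" for u :: real
        using exp_gt_zero[of u] by linarith
      ultimately show "isCont (D p) t"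
        unfolding D_def \<phi>_def \<psi>_def softgrad_def logistic_def by (intro continuous_intros) auto
    qed
    then show ?thesis
      using T by (simp add: W_def \<phi>_def T_def ennreal_mult[symmetric] right_diff_distrib)
  qed
  have inner: "(\<integral>\<^sup>+p. ennreal (exp (T * D p t)) \<partial>(M \<Otimes>\<^sub>M M)) \<le> ennreal Q" for t
  proof -
    \<comment> \<open>\<open>(y, False)\<close> carries the position and \<open>(y, True)\<close>
      the velocity, which is the format of \<open>gaussian_rotation\<close>.\<close>
    define H where "H = (\<lambda>f. ennreal (exp (T * (\<kappa> * (\<Sum>y\<in>B. softgrad \<theta> a B (\<lambda>y. f (y, False)) y * f (y, True))))))"
    have comp: "(\<lambda>f. f k) \<in> borel_measurable (PiM (B \<times> UNIV) (\<lambda>_. borel :: real measure))" if "k \<in> B \<times> UNIV" for k :: "'b \<times> bool"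
      using that by (rule measurable_component_singleton)
    have Hm: "H \<in> borel_measurable (PiM (B \<times> UNIV) (\<lambda>_. borel))"
      unfolding H_def softgrad_def
      by (intro measurable_compose[OF _ measurable_ennreal] borel_measurable_exp borel_measurable_times borel_measurable_const
          borel_measurable_sum borel_measurable_divide borel_measurable_diff measurable_compose[OF _ logistic_measurable] comp) auto
    have "(\<integral>\<^sup>+p. ennreal (exp (T * D p t)) \<partial>(M \<Otimes>\<^sub>M M))
       = (\<integral>\<^sup>+p. H (\<lambda>(i, b)\<in>B \<times> UNIV. if b then - sin t * X i (fst p) + cos t * X i (snd p)
              else cos t * X i (fst p) + sin t * X i (snd p)) \<partial>(M \<Otimes>\<^sub>M M))"
      unfolding H_def D_def \<phi>_def \<psi>_def
      by (intro nn_integral_cong arg_cong[where f=ennreal] arg_cong[where f=exp] arg_cong2[where f="(*)"] sum.cong refl softgrad_cong) auto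
    also have "\<dots> = (\<integral>\<^sup>+p. H (\<lambda>(i, b)\<in>B \<times> UNIV. if b then X i (snd p) else X i (fst p)) \<partial>(M \<Otimes>\<^sub>M M))"
      by (rule gaussian_rotation[OF g Hm])
    also have "\<dots> = (\<integral>\<^sup>+p. ennreal (exp (\<Sum>y\<in>B. (T * \<kappa> * softgrad \<theta> a B (\<lambda>y. X y (fst p)) y) * X y (snd p))) \<partial>(M \<Otimes>\<^sub>M M))"
    proof -
      have "T * (\<kappa> * (\<Sum>y\<in>B. softgrad \<theta> a B (\<lambda>y. (\<lambda>(i, b)\<in>B \<times> UNIV. if b then X i (snd p) else X i (fst p)) (y, False)) y
             * (\<lambda>(i, b)\<in>B \<times> UNIV. if b then X i (snd p) else X i (fst p)) (y, True)))
          = (\<Sum>y\<in>B. (T * \<kappa> * softgrad \<theta> a B (\<lambda>y. X y (fst p)) y) * X y (snd p))" for p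
        unfolding sum_distrib_left
      proof (rule sum.cong[OF refl])
        fix y assume y: "y \<in> B"
        have "softgrad \<theta> a B (\<lambda>y. (\<lambda>(i, b)\<in>B \<times> UNIV. if b then X i (snd p) else X i (fst p)) (y, False)) y
            = softgrad \<theta> a B (\<lambda>y. X y (fst p)) y"
          using y by (intro softgrad_cong) auto
        then show "T * (\<kappa> * (softgrad \<theta> a B (\<lambda>y. (\<lambda>(i, b)\<in>B \<times> UNIV. if b then X i (snd p) else X i (fst p)) (y, False)) y
             * (\<lambda>(i, b)\<in>B \<times> UNIV. if b then X i (snd p) else X i (fst p)) (y, True)))
          = (T * \<kappa> * softgrad \<theta> a B (\<lambda>y. X y (fst p)) y) * X y (snd p)"
          using y by simp
      qed
      then show ?thesis unfolding H_def by presburger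
    qed
    \<comment> \<open>After undoing the rotation the coefficients depend on the first copy alone.
      For fixed \<open>\<omega>\<close> the inner integral is therefore the moment generating
      function of a Gaussian form.\<close>
    also have "\<dots> = (\<integral>\<^sup>+\<omega>. \<integral>\<^sup>+\<omega>'. ennreal (exp (\<Sum>y\<in>B. (T * \<kappa> * softgrad \<theta> a B (\<lambda>y. X y \<omega>) y) * X y \<omega>')) \<partial>M \<partial>M)"
      by (subst M.nn_integral_fst[symmetric]) (auto simp: softgrad_def)
    also have "\<dots> = (\<integral>\<^sup>+\<omega>. ennreal (exp (bform B C (\<lambda>y. T * \<kappa> * softgrad \<theta> a B (\<lambda>y. X y \<omega>) y) (\<lambda>y. T * \<kappa> * softgrad \<theta> a B (\<lambda>y. X y \<omega>) y) / 2)) \<partial>M)"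
      unfolding gaussian_mgf[OF g] ..
    also have "\<dots> \<le> (\<integral>\<^sup>+\<omega>. ennreal Q \<partial>M)"
    proof (rule nn_integral_mono)
      fix \<omega>
      have "(\<Sum>y\<in>B. T * \<kappa> * softgrad \<theta> a B (\<lambda>y. X y \<omega>) y) \<le> T * \<kappa> * \<theta>"
        unfolding sum_distrib_left[symmetric] using T lam softgrad_sum[OF fin B th] by (intro mult_left_mono) auto
      then have "bform B C (\<lambda>y. T * \<kappa> * softgrad \<theta> a B (\<lambda>y. X y \<omega>) y) (\<lambda>y. T * \<kappa> * softgrad \<theta> a B (\<lambda>y. X y \<omega>) y) \<le> (T * \<kappa> * \<theta>)\<^sup>2 * K"
        using T lam th K by (intro bform_le) (auto intro!: mult_nonneg_nonneg softgrad_nonneg)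
      then show "ennreal (exp (bform B C (\<lambda>y. T * \<kappa> * softgrad \<theta> a B (\<lambda>y. X y \<omega>) y) (\<lambda>y. T * \<kappa> * softgrad \<theta> a B (\<lambda>y. X y \<omega>) y) / 2)) \<le> ennreal Q"
        unfolding Q_def by (intro ennreal_leI) simp
    qed
    also have "\<dots> = ennreal Q" by (simp add: M.emeasure_space_1)
    finally show ?thesis .
  qed
  have "ennreal T * (\<integral>\<^sup>+p. ennreal (W p) \<partial>(M \<Otimes>\<^sub>M M)) = (\<integral>\<^sup>+p. ennreal T * ennreal (W p) \<partial>(M \<Otimes>\<^sub>M M))"
    by (rule nn_integral_cmult[symmetric]) simp
  also have "\<dots> \<le> (\<integral>\<^sup>+p. \<integral>\<^sup>+t. ennreal (exp (T * D p t)) * indicator {0..T} t \<partial>lborel \<partial>(M \<Otimes>\<^sub>M M))"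
    by (intro nn_integral_mono path)
  also have "\<dots> = (\<integral>\<^sup>+t. \<integral>\<^sup>+p. ennreal (exp (T * D p t)) * indicator {0..T} t \<partial>(M \<Otimes>\<^sub>M M) \<partial>lborel)"
    by (rule L.Fubini'[symmetric]) measurable
  also have "\<dots> \<le> (\<integral>\<^sup>+t. ennreal Q * indicator {0..T} t \<partial>lborel)"
  proof (rule nn_integral_mono)
    fix t
    have [measurable]: "(\<lambda>p. D p t) \<in> borel_measurable (M \<Otimes>\<^sub>M M)"
      unfolding D_def \<phi>_def \<psi>_def softgrad_def by measurable
    have "(\<integral>\<^sup>+p. ennreal (exp (T * D p t)) * indicator {0..T} t \<partial>(M \<Otimes>\<^sub>M M)) = (\<integral>\<^sup>+p. ennreal (exp (T * D p t)) \<partial>(M \<Otimes>\<^sub>M M)) * indicator {0..T} t"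
      by (rule nn_integral_multc) simp
    also have "\<dots> \<le> ennreal Q * indicator {0..T} t"
      by (intro mult_right_mono inner) simp
    finally show "(\<integral>\<^sup>+p. ennreal (exp (T * D p t)) * indicator {0..T} t \<partial>(M \<Otimes>\<^sub>M M)) \<le> ennreal Q * indicator {0..T} t" .
  qed
  also have "\<dots> = ennreal T * ennreal Q"
    using T by (subst nn_integral_cmult_indicator) (auto simp: mult.commute)
  finally have "(\<integral>\<^sup>+p. ennreal (W p) \<partial>(M \<Otimes>\<^sub>M M)) \<le> ennreal Q"
    using T by (simp add: ennreal_mult_le_mult_iff)
  then show ?thesis by (simp add: W_def Q_def T_def)
qed

text \<open>On the product space the two events force a jump of at least \<open>r\<close> between
  independent copies, whose exponential moment is known. Bounding a product of probabilities,
  instead of deviations from a mean, lets any lower bound on one factor yield an upper bound on the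
  other.\<close>

lemma softcount_concentration_all:
  assumes g: "gaussian_family M B X C" and B: "B \<noteq> {}" and Xm [measurable]: "\<And>i. X i \<in> borel_measurable M"
    and th: "\<theta> \<ge> 0" and K: "K \<ge> 0" "\<And>y z. y \<in> B \<Longrightarrow> z \<in> B \<Longrightarrow> C y z \<le> K" and lam: "\<kappa> \<ge> 0"
  shows "measure M {\<omega>\<in>space M. softcount \<theta> a B (\<lambda>y. X y \<omega>) \<le> s - r} * measure M {\<omega>\<in>space M. s \<le> softcount \<theta> a B (\<lambda>y. X y \<omega>)}
     \<le> exp ((pi / 2 * \<kappa> * \<theta>)\<^sup>2 * K / 2 - \<kappa> * r)"
proof -
  have M: "prob_space M" by (rule gaussian_familyD(1)[OF g])
  have fin [simp]: "finite B" by (rule gaussian_familyD(2)[OF g])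
  interpret M: prob_space M by fact
  interpret P: pair_prob_space M M ..
  define F where "F = (\<lambda>\<omega>. softcount \<theta> a B (\<lambda>y. X y \<omega>))"
  have [measurable]: "F \<in> borel_measurable M" unfolding F_def softcount_def by measurable
  let ?A = "{\<omega>\<in>space M. F \<omega> \<le> s - r}" and ?A' = "{\<omega>\<in>space M. s \<le> F \<omega>}"
  have "ennreal (measure M ?A * measure M ?A') = emeasure M ?A * emeasure M ?A'"
    by (simp add: M.emeasure_eq_measure ennreal_mult)
  also have "\<dots> = emeasure (M \<Otimes>\<^sub>M M) (?A \<times> ?A')"
    by (rule M.emeasure_pair_measure_Times[symmetric]) auto
  also have "\<dots> = (\<integral>\<^sup>+p. indicator (?A \<times> ?A') p \<partial>(M \<Otimes>\<^sub>M M))"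
    by (rule nn_integral_indicator[symmetric]) auto
  also have "\<dots> \<le> (\<integral>\<^sup>+p. ennreal (exp (- \<kappa> * r)) * ennreal (exp (\<kappa> * (F (snd p) - F (fst p)))) \<partial>(M \<Otimes>\<^sub>M M))"
  proof (rule nn_integral_mono)
    fix p
    have "1 \<le> exp (- \<kappa> * r) * exp (\<kappa> * (F (snd p) - F (fst p)))" if "p \<in> ?A \<times> ?A'"
    proof -
      have "\<kappa> * r \<le> \<kappa> * (F (snd p) - F (fst p))"
        using that lam by (intro mult_left_mono) auto
      then show ?thesis by (simp add: exp_add[symmetric])
    qed
    then show "indicator (?A \<times> ?A') p \<le> ennreal (exp (- \<kappa> * r)) * ennreal (exp (\<kappa> * (F (snd p) - F (fst p))))"
      by (auto simp: indicator_def ennreal_mult[symmetric])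
  qed
  also have "\<dots> = ennreal (exp (- \<kappa> * r)) * (\<integral>\<^sup>+p. ennreal (exp (\<kappa> * (F (snd p) - F (fst p)))) \<partial>(M \<Otimes>\<^sub>M M))"
    by (rule nn_integral_cmult) measurable
  also have "\<dots> \<le> ennreal (exp (- \<kappa> * r)) * ennreal (exp ((pi / 2 * \<kappa> * \<theta>)\<^sup>2 * K / 2))"
    unfolding F_def by (intro mult_left_mono softcount_exp_moment[OF g B Xm th K lam]) auto
  also have "\<dots> = ennreal (exp ((pi / 2 * \<kappa> * \<theta>)\<^sup>2 * K / 2 - \<kappa> * r))"
    by (simp add: ennreal_mult[symmetric] exp_add[symmetric])
  finally show ?thesis by (simp add: F_def)
qed

text \<open>Extends the field by 0 outside \<open>B\<close>, which provides measurability at every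
  index.\<close>

lemma softcount_concentration:
  assumes g: "gaussian_family M B X C" and B: "B \<noteq> {}"
    and th: "\<theta> \<ge> 0" and K: "K \<ge> 0" "\<And>y z. y \<in> B \<Longrightarrow> z \<in> B \<Longrightarrow> C y z \<le> K" and kap: "\<kappa> \<ge> 0"
  shows "measure M {\<omega>\<in>space M. softcount \<theta> a B (\<lambda>y. X y \<omega>) \<le> s - r} * measure M {\<omega>\<in>space M. s \<le> softcount \<theta> a B (\<lambda>y. X y \<omega>)}
     \<le> exp ((pi / 2 * \<kappa> * \<theta>)\<^sup>2 * K / 2 - \<kappa> * r)"
proof -
  define X' where "X' = (\<lambda>i \<omega>. if i \<in> B then X i \<omega> else 0)"
  have [simp]: "(\<Sum>i\<in>B. c i * X' i \<omega>) = (\<Sum>i\<in>B. c i * X i \<omega>)" for c \<omega>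
    by (simp add: X'_def)
  have m: "X' i \<in> borel_measurable M" for i
    using gaussian_familyD(3)[OF g] by (cases "i \<in> B") (auto simp: X'_def)
  have g': "gaussian_family M B X' C"
    using g m unfolding gaussian_family_def by auto
  have e: "softcount \<theta> a B (\<lambda>y. X' y \<omega>) = softcount \<theta> a B (\<lambda>y. X y \<omega>)" for \<omega>
    by (simp add: softcount_def X'_def)
  show ?thesis unfolding e[symmetric] by (rule softcount_concentration_all[OF g' B m th K kap])
qed

section \<open>From soft counts back to true counts\<close>

lemma softcount_lower:
  assumes "finite B" and k: "0 < k" "k \<le> real (card {y\<in>B. a \<le> \<phi> y})" and th: "\<theta> \<ge> 0"
  shows "ln (k / 2) \<le> softcount \<theta> a B \<phi>"
proof -
  have half: "1 / 2 \<le> logistic u" if "u \<ge> 0" for u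
    using that unfolding logistic_def by (intro divide_left_mono) (auto simp: add_pos_pos)
  have "k / 2 \<le> real (card {y\<in>B. a \<le> \<phi> y}) * (1 / 2)" using k by simp
  also have "\<dots> = (\<Sum>y\<in>{y\<in>B. a \<le> \<phi> y}. 1 / 2)" by simp
  also have "\<dots> \<le> (\<Sum>y\<in>{y\<in>B. a \<le> \<phi> y}. logistic (\<theta> * (\<phi> y - a)))"
    using th by (intro sum_mono half) auto
  also have "\<dots> \<le> (\<Sum>y\<in>B. logistic (\<theta> * (\<phi> y - a)))"
    using assms(1) less_imp_le[OF logistic_pos] by (intro sum_mono2) auto
  finally show ?thesis unfolding softcount_def using k by simp
qed

text \<open>Points within \<open>\<eta>\<close> below the level are counted fully; those further
  down contribute at most \<open>exp (- (\<theta> * \<eta>))\<close> each. This blur of the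
  threshold is the reason for the two different levels in \<open>high_count_boost\<close>.\<close>

lemma softcount_upper:
  assumes B: "finite B" "B \<noteq> {}" and th: "\<theta> \<ge> 0" and n: "real (card {y\<in>B. a - \<eta> \<le> \<phi> y}) \<le> n"
  shows "softcount \<theta> a B \<phi> \<le> ln (n + real (card B) * exp (- (\<theta> * \<eta>)))"
proof -
  have 1: "logistic u \<le> exp u" for u
    by (simp add: logistic_def exp_minus field_simps add_pos_pos)
  let ?H = "{y\<in>B. a - \<eta> \<le> \<phi> y}"
  have "(\<Sum>y\<in>B. logistic (\<theta> * (\<phi> y - a))) = (\<Sum>y\<in>?H. logistic (\<theta> * (\<phi> y - a))) + (\<Sum>y\<in>B - ?H. logistic (\<theta> * (\<phi> y - a)))"
    using B by (subst sum.subset_diff[of ?H B]) auto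
  also have "\<dots> \<le> (\<Sum>y\<in>?H. 1) + (\<Sum>y\<in>B - ?H. exp (- (\<theta> * \<eta>)))"
  proof (intro add_mono sum_mono)
    fix y assume "y \<in> B - ?H"
    then have "\<theta> * (\<phi> y - a) \<le> \<theta> * (- \<eta>)" using th by (intro mult_left_mono) auto
    then show "logistic (\<theta> * (\<phi> y - a)) \<le> exp (- (\<theta> * \<eta>))"
      using 1[of "\<theta> * (\<phi> y - a)"] by (smt (verit) exp_le_cancel_iff mult_minus_right)
  qed (use less_imp_le[OF logistic_less_1] in auto)
  also have "\<dots> \<le> n + real (card B) * exp (- (\<theta> * \<eta>))"
    using n B by (auto intro!: add_mono mult_right_mono card_mono)
  finally show ?thesis unfolding softcount_def
    using softsum_pos[OF B] by (intro ln_mono) auto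
qed

text \<open>Turns a weak lower bound for the probability of many points above \<open>a\<close> into
  a strong upper bound for the probability of few points above \<open>a - \<eta>\<close>.\<close>

lemma high_count_boost:
  assumes g: "gaussian_family M B X C" and B: "B \<noteq> {}"
    and th: "\<theta> \<ge> 0" and K: "K \<ge> 0" "\<And>y z. y \<in> B \<Longrightarrow> z \<in> B \<Longrightarrow> C y z \<le> K" and kap: "\<kappa> \<ge> 0" and k: "k > 0"
    and n: "n + real (card B) * exp (- (\<theta> * \<eta>)) \<le> k / 2 * exp (- r)" "n \<ge> 0"
  shows "measure M {\<omega>\<in>space M. real (card {y\<in>B. a - \<eta> \<le> X y \<omega>}) \<le> n}
       * measure M {\<omega>\<in>space M. k \<le> real (card {y\<in>B. a \<le> X y \<omega>})}
     \<le> exp ((pi / 2 * \<kappa> * \<theta>)\<^sup>2 * K / 2 - \<kappa> * r)"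
proof -
  have fin: "finite B" by (rule gaussian_familyD(2)[OF g])
  interpret M: prob_space M by (rule gaussian_familyD(1)[OF g])
  have Xm [measurable]: "X i \<in> borel_measurable M" if "i \<in> B" for i using gaussian_familyD(3)[OF g that] .
  have [measurable]: "(\<lambda>\<omega>. softcount \<theta> a B (\<lambda>y. X y \<omega>)) \<in> borel_measurable M"
    unfolding softcount_def by measurable
  have cb: "card B > 0" using fin B by (simp add: card_gt_0_iff)
  have pos: "n + real (card B) * exp (- (\<theta> * \<eta>)) > 0"
    using n cb by (intro add_nonneg_pos mult_pos_pos) auto
  have lnr: "ln (k / 2 * exp (- r)) = ln (k / 2) - r"
    using k by (subst ln_mult) auto
  have "measure M {\<omega>\<in>space M. real (card {y\<in>B. a - \<eta> \<le> X y \<omega>}) \<le> n}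
      \<le> measure M {\<omega>\<in>space M. softcount \<theta> a B (\<lambda>y. X y \<omega>) \<le> ln (k / 2) - r}"
  proof (rule M.finite_measure_mono)
    show "{\<omega>\<in>space M. real (card {y\<in>B. a - \<eta> \<le> X y \<omega>}) \<le> n} \<subseteq> {\<omega>\<in>space M. softcount \<theta> a B (\<lambda>y. X y \<omega>) \<le> ln (k / 2) - r}"
    proof safe
      fix \<omega> assume "real (card {y\<in>B. a - \<eta> \<le> X y \<omega>}) \<le> n"
      then have "softcount \<theta> a B (\<lambda>y. X y \<omega>) \<le> ln (n + real (card B) * exp (- (\<theta> * \<eta>)))"
        by (rule softcount_upper[OF fin B th])
      also have "\<dots> \<le> ln (k / 2 * exp (- r))" using n pos by (intro ln_mono) auto
      finally show "softcount \<theta> a B (\<lambda>y. X y \<omega>) \<le> ln (k / 2) - r" unfolding lnr .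
    qed
  qed measurable
  moreover have "measure M {\<omega>\<in>space M. k \<le> real (card {y\<in>B. a \<le> X y \<omega>})} \<le> measure M {\<omega>\<in>space M. ln (k / 2) \<le> softcount \<theta> a B (\<lambda>y. X y \<omega>)}"
    using softcount_lower[OF fin k _ th] by (intro M.finite_measure_mono) auto
  ultimately have "measure M {\<omega>\<in>space M. real (card {y\<in>B. a - \<eta> \<le> X y \<omega>}) \<le> n}
       * measure M {\<omega>\<in>space M. k \<le> real (card {y\<in>B. a \<le> X y \<omega>})}
     \<le> measure M {\<omega>\<in>space M. softcount \<theta> a B (\<lambda>y. X y \<omega>) \<le> ln (k / 2) - r} * measure M {\<omega>\<in>space M. ln (k / 2) \<le> softcount \<theta> a B (\<lambda>y. X y \<omega>)}"
    by (intro mult_mono) auto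
  also have "\<dots> \<le> exp ((pi / 2 * \<kappa> * \<theta>)\<^sup>2 * K / 2 - \<kappa> * r)"
    by (rule softcount_concentration[OF g B th K kap])
  finally show ?thesis .
qed

text \<open>The Paley-Zygmund inequality at half the mean. A pointwise arithmetic-geometric mean
  bound with parameter \<open>t\<close> stands in for Cauchy-Schwarz.\<close>

lemma paley_zygmund_count:
  assumes M: "prob_space M" and B: "finite B" and E [measurable]: "\<And>y. y \<in> B \<Longrightarrow> E y \<in> sets M"
    and m: "m = (\<Sum>y\<in>B. measure M (E y))" "m > 0"
    and m2: "(\<Sum>y\<in>B. \<Sum>z\<in>B. measure M (E y \<inter> E z)) \<le> m2"
  shows "m\<^sup>2 / (4 * m2) \<le> measure M {\<omega>\<in>space M. m / 2 \<le> real (card {y\<in>B. \<omega> \<in> E y})}"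
proof -
  interpret M: prob_space M by fact
  define W where "W = (\<lambda>\<omega>. \<Sum>y\<in>B. indicator (E y) \<omega> :: real)"
  have [measurable]: "W \<in> borel_measurable M" unfolding W_def by measurable
  have card: "real (card {y\<in>B. \<omega> \<in> E y}) = W \<omega>" for \<omega>
    using B by (simp add: W_def indicator_def sum.If_cases Int_def)
  let ?A = "{\<omega>\<in>space M. m / 2 \<le> W \<omega>}"
  define P where "P = measure M ?A"
  have W0: "0 \<le> W \<omega>" for \<omega> unfolding W_def by (intro sum_nonneg) auto
  have Wc: "W \<omega> \<le> card B" for \<omega>
    unfolding W_def using sum_bounded_above[of B "\<lambda>y. indicator (E y) \<omega> :: real" 1] by (auto simp: indicator_def)
  have iW: "integrable M W" using W0 Wc by (intro bounded_integrable[where B="card B"] M) auto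
  have W2: "(W \<omega>)\<^sup>2 = (\<Sum>y\<in>B. \<Sum>z\<in>B. indicator (E y \<inter> E z) \<omega>)" for \<omega>
    unfolding W_def power2_eq_square sum_product by (intro sum.cong) (auto simp: indicator_def)
  have iW2: "integrable M (\<lambda>\<omega>. (W \<omega>)\<^sup>2)"
    unfolding W2 by (intro Bochner_Integration.integrable_sum integrable_real_indicator) (auto simp: M.emeasure_eq_measure)
  have EW: "(LINT \<omega>|M. W \<omega>) = m"
    unfolding W_def m by (subst Bochner_Integration.integral_sum) (auto simp: M.emeasure_eq_measure)
  have EW2: "(LINT \<omega>|M. (W \<omega>)\<^sup>2) \<le> m2"
  proof -
    have "(LINT \<omega>|M. (W \<omega>)\<^sup>2) = (\<Sum>y\<in>B. \<Sum>z\<in>B. measure M (E y \<inter> E z))"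
      unfolding W2 by (simp add: M.emeasure_eq_measure)
    then show ?thesis using m2 by simp
  qed
  have "m2 > 0"
  proof -
    have "m = (LINT \<omega>|M. W \<omega>)" using EW by simp
    also have "\<dots> \<le> (LINT \<omega>|M. (W \<omega>)\<^sup>2)"
    proof (rule integral_mono[OF iW iW2])
      fix \<omega>
      \<comment> \<open>The count is an integer, so it is at most its square; this gives
        \<open>m2 > 0\<close> from \<open>m > 0\<close>.\<close>
      have "W \<omega> \<le> (W \<omega>)\<^sup>2"
      proof -
        have "real n \<le> (real n)\<^sup>2" for n :: nat by (cases n) (auto simp: power2_eq_square)
        from this[of "card {y\<in>B. \<omega> \<in> E y}"] show ?thesis unfolding card .
      qed
      then show "W \<omega> \<le> (W \<omega>)\<^sup>2" .
    qed
    finally show ?thesis using EW2 m(2) by linarith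
  qed
  \<comment> \<open>With this \<open>t\<close> the second moment contributes exactly
    \<open>m / 4\<close>, which leaves \<open>m / 4\<close> for the event.\<close>
  define t where "t = m / (2 * m2)"
  have t: "t > 0" using m(2) \<open>m2 > 0\<close> by (simp add: t_def)
  have iA: "integrable M (indicator ?A :: _ \<Rightarrow> real)"
    by (intro integrable_real_indicator) (auto simp: M.emeasure_eq_measure)
  have "m = (LINT \<omega>|M. W \<omega>)" using EW by simp
  also have "\<dots> \<le> (LINT \<omega>|M. m / 2 + (t / 2 * (W \<omega>)\<^sup>2 + indicator ?A \<omega> / (2 * t)))"
  proof (rule integral_mono[OF iW])
    show "integrable M (\<lambda>\<omega>. m / 2 + (t / 2 * (W \<omega>)\<^sup>2 + indicator ?A \<omega> / (2 * t)))"
      using iW2 iA by (intro Bochner_Integration.integrable_add integrable_mult_right integrable_divide) auto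
    fix \<omega> assume w: "\<omega> \<in> space M"
    show "W \<omega> \<le> m / 2 + (t / 2 * (W \<omega>)\<^sup>2 + indicator ?A \<omega> / (2 * t))"
    proof (cases "\<omega> \<in> ?A")
      case True
      have "0 \<le> (t * W \<omega> - 1)\<^sup>2 / (2 * t)" using t by simp
      also have "\<dots> = t / 2 * (W \<omega>)\<^sup>2 + 1 / (2 * t) - W \<omega>"
        using t by (simp add: power2_eq_square field_simps)
      finally show ?thesis using True m(2) by simp
    next
      case False
      moreover have "0 \<le> t / 2 * (W \<omega>)\<^sup>2" using t by simp
      ultimately show ?thesis using w by auto
    qed
  qed
  also have "\<dots> = m / 2 + (t / 2 * (LINT \<omega>|M. (W \<omega>)\<^sup>2) + P / (2 * t))"
    using iW2 iA by (simp add: P_def M.prob_space)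
  also have "\<dots> \<le> m / 2 + (t / 2 * m2 + P / (2 * t))"
    using EW2 t by simp
  also have "t / 2 * m2 = m / 4" using \<open>m2 > 0\<close> by (simp add: t_def)
  also have "P / (2 * t) = P * m2 / m" using m(2) \<open>m2 > 0\<close> by (simp add: t_def)
  finally have "m / 4 \<le> P * m2 / m" by linarith
  then have "m\<^sup>2 / (4 * m2) \<le> P"
    using m(2) \<open>m2 > 0\<close> by (simp add: field_simps power2_eq_square)
  then show ?thesis unfolding P_def card .
qed

section \<open>Logarithmically correlated fields\<close>

text \<open>The coefficient vector of the arithmetic mean of the field over
  \<open>p 1, ..., p m\<close>.\<close>

definition avg :: "nat \<Rightarrow> (nat \<Rightarrow> 'i) \<Rightarrow> 'i \<Rightarrow> real" where
  "avg m p = (\<lambda>i. (1 / real m) * (\<Sum>j\<in>{1..m}. unitv (p j) i))"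

text \<open>\<open>\<kappa>\<close> is the exponent of the effective side length: 1 for the free
  field and \<open>\<beta>\<close> for the field recentred at scale \<open>N powr \<beta>\<close>.
  \<open>L\<close> stands for \<open>ln N\<close>.\<close>

definition log_cov :: "(int \<times> int) set \<Rightarrow> (int \<times> int \<Rightarrow> int \<times> int \<Rightarrow> real) \<Rightarrow> real \<Rightarrow> real \<Rightarrow> real \<Rightarrow> bool" where
  "log_cov A C \<kappa> L \<epsilon> \<longleftrightarrow> finite A \<and> (\<forall>y\<in>A. \<forall>z\<in>A. \<bar>C y z - gconst * (\<kappa> * L - logd y z)\<bar> \<le> \<epsilon> * L)"

lemma gconst_bounds: "1 / 2 < gconst" "gconst < 1" "2 / gconst < 4"
  using pi_gt3 pi_less_4 by (auto simp: gconst_def field_simps)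

lemma sqrt_gconst_bounds: "1 / 2 < sqrt gconst" "sqrt gconst < 1"
  using gconst_bounds real_less_rsqrt[of "1 / 2" gconst] by (auto simp: power2_eq_square)

lemma log_covD:
  assumes "log_cov A C \<kappa> L \<epsilon>" "y \<in> A" "z \<in> A"
  shows "C y z \<le> gconst * (\<kappa> * L - logd y z) + \<epsilon> * L" "gconst * (\<kappa> * L - logd y z) - \<epsilon> * L \<le> C y z"
  using assms unfolding log_cov_def by (force simp: abs_le_iff)+

lemma bform_avg_right: "bform I C c (avg m p) = (1 / real m) * (\<Sum>j\<in>{1..m}. bform I C c (unitv (p j)))"
  unfolding avg_def by (simp only: bform_cmult_right bform_sum_right)

lemma bform_avg_left: "bform I C (avg m p) c = (1 / real m) * (\<Sum>j\<in>{1..m}. bform I C (unitv (p j)) c)"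
  unfolding avg_def by (simp only: bform_cmult_left bform_sum_left)

lemma avg_le:
  assumes "m > 0" "\<And>j. j \<in> {1..m} \<Longrightarrow> f j \<le> (v::real)"
  shows "(1 / real m) * (\<Sum>j\<in>{1..m}. f j) \<le> v"
proof -
  have "(\<Sum>j\<in>{1..m}. f j) \<le> real m * v"
    using sum_bounded_above[of "{1..m}" f v] assms(2) by simp
  then show ?thesis using assms(1) by (simp add: field_simps)
qed

lemma avg_ge:
  assumes "m > 0" "\<And>j. j \<in> {1..m} \<Longrightarrow> (v::real) \<le> f j"
  shows "v \<le> (1 / real m) * (\<Sum>j\<in>{1..m}. f j)"
  using avg_le[of m "\<lambda>j. - f j" "- v"] assms by (simp add: sum_negf)

context
  fixes A C \<kappa> L \<epsilon> and m :: nat and p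
  assumes lc: "log_cov A C \<kappa> L \<epsilon>" and m: "m > 0" and p: "\<And>j. j \<in> {1..m} \<Longrightarrow> p j \<in> A"
begin

lemma finA: "finite A"
  using lc by (simp add: log_cov_def)

lemma cov_avg_le:
  assumes "y \<in> A" "\<And>j. j \<in> {1..m} \<Longrightarrow> \<rho> * L \<le> logd y (p j)"
  shows "bform A C (unitv y) (avg m p) \<le> (gconst * (\<kappa> - \<rho>) + \<epsilon>) * L"
  unfolding bform_avg_right
proof (rule avg_le[OF m])
  fix j assume j: "j \<in> {1..m}"
  have "bform A C (unitv y) (unitv (p j)) \<le> gconst * (\<kappa> * L - logd y (p j)) + \<epsilon> * L"
    using log_covD(1)[OF lc assms(1) p[OF j]] assms(1) p[OF j] by (simp add: bform_unitv finA)
  also have "\<dots> \<le> gconst * (\<kappa> * L - \<rho> * L) + \<epsilon> * L"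
    using assms(2)[OF j] gconst_bounds by (intro add_right_mono mult_left_mono) auto
  finally show "bform A C (unitv y) (unitv (p j)) \<le> (gconst * (\<kappa> - \<rho>) + \<epsilon>) * L"
    by (simp add: algebra_simps)
qed

lemma cov_avg_ge:
  assumes "y \<in> A" "\<And>j. j \<in> {1..m} \<Longrightarrow> logd y (p j) \<le> \<rho> * L"
  shows "(gconst * (\<kappa> - \<rho>) - \<epsilon>) * L \<le> bform A C (unitv y) (avg m p)"
  unfolding bform_avg_right
proof (rule avg_ge[OF m])
  fix j assume j: "j \<in> {1..m}"
  have "gconst * (\<kappa> * L - \<rho> * L) - \<epsilon> * L \<le> gconst * (\<kappa> * L - logd y (p j)) - \<epsilon> * L"
    using assms(2)[OF j] gconst_bounds by (intro diff_right_mono mult_left_mono) auto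
  also have "\<dots> \<le> bform A C (unitv y) (unitv (p j))"
    using log_covD(2)[OF lc assms(1) p[OF j]] assms(1) p[OF j] by (simp add: bform_unitv finA)
  finally show "(gconst * (\<kappa> - \<rho>) - \<epsilon>) * L \<le> bform A C (unitv y) (unitv (p j))"
    by (simp add: algebra_simps)
qed

lemma var_avg_ge:
  assumes "\<And>i j. i \<in> {1..m} \<Longrightarrow> j \<in> {1..m} \<Longrightarrow> logd (p i) (p j) \<le> \<rho> * L"
  shows "(gconst * (\<kappa> - \<rho>) - \<epsilon>) * L \<le> bform A C (avg m p) (avg m p)"
  unfolding bform_avg_left
  by (rule avg_ge[OF m], rule cov_avg_ge) (use p assms in auto)

text \<open>The diagonal terms contribute \<open>1 / m\<close> of a full variance.\<close>

lemma var_avg_le: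
  assumes "\<And>i j. i \<in> {1..m} \<Longrightarrow> j \<in> {1..m} \<Longrightarrow> i \<noteq> j \<Longrightarrow> \<rho> * L \<le> logd (p i) (p j)"
    and "0 \<le> \<rho>" "\<rho> \<le> \<kappa>" "0 \<le> L"
  shows "bform A C (avg m p) (avg m p) \<le> (gconst * (\<kappa> - \<rho>) + gconst * \<kappa> / real m + \<epsilon>) * L"
  unfolding bform_avg_left
proof (rule avg_le[OF m])
  fix i assume i: "i \<in> {1..m}"
  let ?v = "(gconst * (\<kappa> - \<rho>) + \<epsilon>) * L"
  have b: "bform A C (unitv (p i)) (unitv (p j)) \<le> ?v + (if i = j then gconst * \<kappa> * L else 0)" if j: "j \<in> {1..m}" for j
  proof -
    have 1: "bform A C (unitv (p i)) (unitv (p j)) \<le> gconst * (\<kappa> * L - logd (p i) (p j)) + \<epsilon> * L"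
      using log_covD(1)[OF lc p[OF i] p[OF j]] p[OF i] p[OF j] by (simp add: bform_unitv finA)
    show ?thesis
    proof (cases "i = j")
      case True
      have "gconst * logd (p i) (p j) \<ge> 0" using logd_nonneg gconst_bounds by simp
      moreover have "0 \<le> gconst * ((\<kappa> - \<rho>) * L)" using assms gconst_bounds by simp
      ultimately show ?thesis using 1 True by (simp add: algebra_simps)
    next
      case False
      have "gconst * (\<rho> * L) \<le> gconst * logd (p i) (p j)"
        using assms(1)[OF i j False] gconst_bounds by (intro mult_left_mono) auto
      then show ?thesis using 1 False by (simp add: algebra_simps)
    qed
  qed
  have "bform A C (unitv (p i)) (avg m p) \<le> (1 / real m) * (\<Sum>j\<in>{1..m}. ?v + (if i = j then gconst * \<kappa> * L else 0))"
    unfolding bform_avg_right using b by (intro mult_left_mono sum_mono) auto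
  also have "\<dots> = ?v + gconst * \<kappa> * L / real m"
    using i m by (simp add: sum.distrib distrib_left)
  finally show "bform A C (unitv (p i)) (avg m p) \<le> (gconst * (\<kappa> - \<rho>) + gconst * \<kappa> / real m + \<epsilon>) * L"
    by (simp add: algebra_simps)
qed

end

section \<open>Probabilities of high points and of atypical averages\<close>

lemma gaussian_chernoff_scaled:
  assumes g: "gaussian_family M I X C" and sub: "E \<subseteq> {\<omega>\<in>space M. a \<le> (\<Sum>i\<in>I. c i * X i \<omega>)}" and k: "k \<ge> 0"
  shows "measure M E \<le> exp (k\<^sup>2 * bform I C c c / 2 - k * a)"
proof -
  interpret M: prob_space M by (rule gaussian_familyD(1)[OF g])
  note lm [measurable] = gaussian_lin_measurable[OF g]
  have "measure M E \<le> measure M {\<omega>\<in>space M. k * a \<le> (\<Sum>i\<in>I. (k * c i) * X i \<omega>)}"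
  proof (rule M.finite_measure_mono)
    show "E \<subseteq> {\<omega>\<in>space M. k * a \<le> (\<Sum>i\<in>I. (k * c i) * X i \<omega>)}"
      using sub k by (auto simp: mult.assoc sum_distrib_left[symmetric] intro: mult_left_mono)
  qed measurable
  also have "\<dots> \<le> exp (bform I C (\<lambda>i. k * c i) (\<lambda>i. k * c i) / 2 - k * a)"
    by (rule gaussian_chernoff[OF g])
  finally show ?thesis by (simp add: bform_cmult_left bform_cmult_right power2_eq_square mult.assoc)
qed

text \<open>\<open>q\<close> is level over variance:
  \<open>2 * sqrt gconst * \<alpha> * \<kappa> * L\<close> divided by
  \<open>gconst * \<kappa> * L\<close>, in which \<open>\<kappa>\<close> and \<open>L\<close>
  cancel. The bounds 4 and 8 come from \<open>gconst > 1/2\<close> and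
  \<open>sqrt gconst > 1/2\<close>.\<close>

lemma chernoff_slope:
  assumes "0 < \<alpha>" "\<alpha> < 1"
  defines "q \<equiv> 2 * \<alpha> / sqrt gconst"
  shows "0 \<le> q" "q \<le> 4" "q\<^sup>2 * gconst = 4 * \<alpha>\<^sup>2" "q\<^sup>2 \<le> 8" "q * sqrt gconst = 2 * \<alpha>" "q * gconst = 2 * \<alpha> * sqrt gconst"
proof -
  have g: "gconst > 0" using gconst_bounds by simp
  show "0 \<le> q" using assms g by simp
  have "2 * \<alpha> \<le> 4 * sqrt gconst" using sqrt_gconst_bounds assms by linarith
  then show "q \<le> 4" using g by (simp add: q_def field_simps)
  show e: "q\<^sup>2 * gconst = 4 * \<alpha>\<^sup>2" using g by (simp add: q_def power_divide power_mult_distrib)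
  have "\<alpha>\<^sup>2 \<le> 1" using assms by (simp add: power_le_one)
  have "q\<^sup>2 * (1/2) \<le> q\<^sup>2 * gconst" using gconst_bounds by (intro mult_left_mono) auto
  then show "q\<^sup>2 \<le> 8" using e \<open>\<alpha>\<^sup>2 \<le> 1\<close> by linarith
  show "q * sqrt gconst = 2 * \<alpha>" using g by (simp add: q_def)
  show "q * gconst = 2 * \<alpha> * sqrt gconst"
    using g by (simp add: q_def field_simps)
qed

text \<open>The slope \<open>q = 2 * \<alpha> / sqrt gconst\<close> is the optimal exponential tilt at every scale, which is why
  one linear combination \<open>X y + X z - h\<close> suffices for three simultaneous constraints.\<close>

lemma high_pair_prob:
  fixes h :: "int \<times> int \<Rightarrow> real"
  assumes g: "gaussian_family M A X C" and lc: "log_cov A C \<kappa> L \<epsilon>" and L: "L \<ge> 0"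
    and yz: "y \<in> A" "z \<in> A" and al: "0 < \<alpha>" "\<alpha> < 1" and er: "\<epsilon> \<le> r"
    and d: "(\<gamma> - \<theta>) * L \<le> logd y z" and th: "\<theta> \<ge> 0"
    and hv: "bform A C h h \<le> (gconst * (\<kappa> - \<gamma>) + r) * L"
    and hy: "(gconst * (\<kappa> - \<gamma>) - r) * L \<le> bform A C (unitv y) h"
    and hz: "(gconst * (\<kappa> - \<gamma>) - r) * L \<le> bform A C (unitv z) h"
    and E: "\<And>\<omega>. \<omega> \<in> E \<Longrightarrow> \<omega> \<in> space M \<and> 2 * sqrt gconst * \<alpha> * \<kappa> * L \<le> X y \<omega> \<and> 2 * sqrt gconst * \<alpha> * \<kappa> * L \<le> X z \<omega>
        \<and> (\<Sum>i\<in>A. h i * X i \<omega>) \<le> (2 * sqrt gconst * \<alpha> * (\<kappa> - \<gamma>) + s) * L" and s: "s \<ge> 0"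
  shows "measure M E \<le> exp ((- 2 * \<alpha>\<^sup>2 * (\<kappa> + \<gamma>) + 8 * \<theta> + 36 * r + 4 * s) * L)"
proof -
  have fin: "finite A" using lc by (simp add: log_cov_def)
  note sl = chernoff_slope[OF al]
  define q where "q = 2 * \<alpha> / sqrt gconst"
  \<comment> \<open>Two points branching at scale \<open>\<gamma>\<close> share the part of the
    field that \<open>h\<close> represents. Subtracting \<open>h\<close> counts it once, so that the
    variance is about \<open>gconst * (\<kappa> + \<gamma>) * L\<close>.\<close>
  define c where "c = (\<lambda>i. unitv y i + unitv z i - h i)"
  define a where "a = (2 * sqrt gconst * \<alpha> * (\<kappa> + \<gamma>) - s) * L"
  have lin: "(\<Sum>i\<in>A. c i * X i \<omega>) = X y \<omega> + X z \<omega> - (\<Sum>i\<in>A. h i * X i \<omega>)" for \<omega>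
    unfolding c_def by (simp add: left_diff_distrib distrib_right sum.distrib sum_subtractf sum_unitv fin yz)
  have sub: "E \<subseteq> {\<omega>\<in>space M. a \<le> (\<Sum>i\<in>A. c i * X i \<omega>)}"
  proof
    fix \<omega> assume "\<omega> \<in> E"
    from E[OF this] show "\<omega> \<in> {\<omega>\<in>space M. a \<le> (\<Sum>i\<in>A. c i * X i \<omega>)}"
      unfolding lin a_def by (simp add: algebra_simps)
  qed
  have sy: "bform A C h (unitv y) = bform A C (unitv y) h" "bform A C h (unitv z) = bform A C (unitv z) h" "C z y = C y z"
    using bform_sym[OF gaussian_familyD(5)[OF g]] gaussian_familyD(4)[OF g] yz by auto
  have V: "bform A C c c = C y y + C z z + 2 * C y z + bform A C h h - 2 * bform A C (unitv y) h - 2 * bform A C (unitv z) h"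
    unfolding c_def bform_add_left bform_add_right bform_diff_left bform_diff_right
    using sy by (simp add: bform_unitv fin yz)
  have C: "C y y \<le> gconst * (\<kappa> * L) + r * L" "C z z \<le> gconst * (\<kappa> * L) + r * L" "C y z \<le> gconst * ((\<kappa> - \<gamma> + \<theta>) * L) + r * L"
  proof -
    have e: "\<epsilon> * L \<le> r * L" using er L by (rule mult_right_mono)
    have l: "gconst * (\<kappa> * L - logd y' y') \<le> gconst * (\<kappa> * L)" for y'
      using logd_nonneg[of y' y'] gconst_bounds by (intro mult_left_mono) auto
    show "C y y \<le> gconst * (\<kappa> * L) + r * L" "C z z \<le> gconst * (\<kappa> * L) + r * L"
      using log_covD(1)[OF lc yz(1) yz(1)] log_covD(1)[OF lc yz(2) yz(2)] l e by (meson add_mono order_trans)+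
    have "gconst * (\<kappa> * L - logd y z) \<le> gconst * ((\<kappa> - \<gamma> + \<theta>) * L)"
      using d gconst_bounds by (intro mult_left_mono) (auto simp: algebra_simps)
    then show "C y z \<le> gconst * ((\<kappa> - \<gamma> + \<theta>) * L) + r * L"
      using log_covD(1)[OF lc yz] e by linarith
  qed
  \<comment> \<open>The errors \<open>r\<close> enter once each from \<open>C y y\<close>,
    \<open>C z z\<close> and the variance of \<open>h\<close>, and twice each from
    \<open>C y z\<close> and the two covariances with \<open>h\<close>: nine in all.\<close>
  have "bform A C c c \<le> (gconst * (\<kappa> + \<gamma>) + 2 * (gconst * \<theta>) + 9 * r) * L"
    unfolding V using C hv hy hz by (simp add: algebra_simps)
  also have "\<dots> \<le> (gconst * (\<kappa> + \<gamma>) + 2 * \<theta> + 9 * r) * L"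
    using L th gconst_bounds by (intro mult_right_mono add_mono mult_left_mono order_refl) (auto intro: mult_left_le_one_le)
  finally have Vle: "bform A C c c \<le> (gconst * (\<kappa> + \<gamma>) + 2 * \<theta> + 9 * r) * L" .
  have r0: "0 \<le> r * L"
  proof -
    have "\<bar>C y y - gconst * (\<kappa> * L - logd y y)\<bar> \<le> \<epsilon> * L" using lc yz unfolding log_cov_def by blast
    then have "0 \<le> \<epsilon> * L" by linarith
    also have "\<dots> \<le> r * L" using er L by (rule mult_right_mono)
    finally show ?thesis .
  qed
  have "measure M E \<le> exp (q\<^sup>2 * bform A C c c / 2 - q * a)"
    using gaussian_chernoff_scaled[OF g sub sl(1)] unfolding q_def .
  also have "\<dots> \<le> exp ((- 2 * \<alpha>\<^sup>2 * (\<kappa> + \<gamma>) + 8 * \<theta> + 36 * r + 4 * s) * L)"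
  proof -
    have "q\<^sup>2 * bform A C c c \<le> q\<^sup>2 * ((gconst * (\<kappa> + \<gamma>) + 2 * \<theta> + 9 * r) * L)"
      by (intro mult_left_mono Vle) simp
    also have "\<dots> = (q\<^sup>2 * gconst) * ((\<kappa> + \<gamma>) * L) + q\<^sup>2 * (2 * (\<theta> * L) + 9 * (r * L))"
      by (simp add: algebra_simps)
    also have "\<dots> \<le> 4 * \<alpha>\<^sup>2 * ((\<kappa> + \<gamma>) * L) + 8 * (2 * (\<theta> * L) + 9 * (r * L))"
      using sl(4) r0 th L unfolding sl(3)[folded q_def] q_def[symmetric] by (intro add_left_mono mult_right_mono) auto
    finally have 1: "q\<^sup>2 * bform A C c c \<le> 4 * \<alpha>\<^sup>2 * ((\<kappa> + \<gamma>) * L) + 8 * (2 * (\<theta> * L) + 9 * (r * L))" .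
    have "q * a = 2 * \<alpha> * (q * sqrt gconst) * ((\<kappa> + \<gamma>) * L) - q * (s * L)"
      unfolding a_def by (simp add: algebra_simps)
    also have "q * sqrt gconst = 2 * \<alpha>" using sl(5) unfolding q_def .
    finally have 2: "q * a = 4 * \<alpha>\<^sup>2 * ((\<kappa> + \<gamma>) * L) - q * (s * L)" by (simp add: power2_eq_square)
    have 3: "q * (s * L) \<le> 4 * (s * L)" using sl(2) s L unfolding q_def by (intro mult_right_mono) auto
    show ?thesis unfolding exp_le_cancel_iff using 1 2 3 by (simp add: algebra_simps)
  qed
  finally show ?thesis .
qed

text \<open>When \<open>X y\<close> is high, its average at scale \<open>\<gamma>\<close> is
  typically the fraction of the height belonging to \<open>\<kappa> - \<gamma>\<close>. To detect an
  excess \<open>s * L\<close>, a small tilt \<open>u\<close> on the average is added to the optimal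
  tilt \<open>q\<close> on \<open>X y\<close>; it gains a factor \<open>N powr (- s^2 / 4)\<close>
  up to covariance errors.\<close>

lemma high_trunc_prob:
  fixes h :: "int \<times> int \<Rightarrow> real"
  assumes g: "gaussian_family M A X C" and lc: "log_cov A C \<kappa> L \<epsilon>" and L: "L \<ge> 0"
    and y: "y \<in> A" and al: "0 < \<alpha>" "\<alpha> < 1" and er: "\<epsilon> \<le> r" "0 \<le> r"
    and hv: "bform A C h h \<le> 2 * L"
    and hy: "bform A C (unitv y) h \<le> (gconst * (\<kappa> - \<gamma>) + r) * L"
    and E: "\<And>\<omega>. \<omega> \<in> E \<Longrightarrow> \<omega> \<in> space M \<and> 2 * sqrt gconst * \<alpha> * \<kappa> * L \<le> X y \<omega>
        \<and> (2 * sqrt gconst * \<alpha> * (\<kappa> - \<gamma>) + s) * L \<le> (\<Sum>i\<in>A. h i * X i \<omega>)" and s: "0 \<le> s" "s \<le> 1"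
  shows "measure M E \<le> exp ((- 2 * \<alpha>\<^sup>2 * \<kappa> - s\<^sup>2 / 4 + 6 * r) * L)"
proof -
  have fin: "finite A" using lc by (simp add: log_cov_def)
  note sl = chernoff_slope[OF al]
  define q where "q = 2 * \<alpha> / sqrt gconst"
  \<comment> \<open>Minimises \<open>u^2 * L - u * s * L\<close>, the cost of the extra tilt when
    the variance of the average is at most \<open>2 * L\<close>.\<close>
  define u where "u = s / 2"
  have u: "0 \<le> u" "u \<le> 1 / 2" using s by (auto simp: u_def)
  note sl = sl[folded q_def]
  define c where "c = (\<lambda>i. q * unitv y i + u * h i)"
  define a where "a = q * (2 * sqrt gconst * \<alpha> * \<kappa> * L) + u * ((2 * sqrt gconst * \<alpha> * (\<kappa> - \<gamma>) + s) * L)"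
  have lin: "(\<Sum>i\<in>A. c i * X i \<omega>) = q * X y \<omega> + u * (\<Sum>i\<in>A. h i * X i \<omega>)" for \<omega>
    unfolding c_def by (simp add: distrib_right sum.distrib sum_distrib_left[symmetric] mult.assoc sum_unitv fin y)
  have sub: "E \<subseteq> {\<omega>\<in>space M. a \<le> (\<Sum>i\<in>A. c i * X i \<omega>)}"
  proof
    fix \<omega> assume "\<omega> \<in> E"
    from E[OF this] show "\<omega> \<in> {\<omega>\<in>space M. a \<le> (\<Sum>i\<in>A. c i * X i \<omega>)}"
      unfolding lin a_def using sl(1) u by (auto intro!: add_mono mult_left_mono)
  qed
  have sy: "bform A C h (unitv y) = bform A C (unitv y) h"
    using bform_sym[OF gaussian_familyD(5)[OF g]] by auto
  have V: "bform A C c c = q\<^sup>2 * C y y + 2 * (q * u) * bform A C (unitv y) h + u\<^sup>2 * bform A C h h"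
    unfolding c_def bform_add_left bform_add_right bform_cmult_left bform_cmult_right
    using sy by (simp add: bform_unitv fin y power2_eq_square algebra_simps)
  have Cy: "C y y \<le> gconst * (\<kappa> * L) + r * L"
  proof -
    have e: "\<epsilon> * L \<le> r * L" using er(1) L by (rule mult_right_mono)
    have l: "gconst * (\<kappa> * L - logd y y) \<le> gconst * (\<kappa> * L)"
      using logd_nonneg[of y y] gconst_bounds by (intro mult_left_mono) auto
    show ?thesis using log_covD(1)[OF lc y y] l e by linarith
  qed
  have "measure M E \<le> exp (1\<^sup>2 * bform A C c c / 2 - 1 * a)"
    using gaussian_chernoff_scaled[OF g sub, of 1] by simp
  also have "\<dots> \<le> exp ((- 2 * \<alpha>\<^sup>2 * \<kappa> - s\<^sup>2 / 4 + 6 * r) * L)"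
  proof -
    have rL: "0 \<le> r * L" using er L by simp
    have 1: "q\<^sup>2 * C y y \<le> 4 * \<alpha>\<^sup>2 * (\<kappa> * L) + 8 * (r * L)"
    proof -
      have "q\<^sup>2 * C y y \<le> q\<^sup>2 * (gconst * (\<kappa> * L) + r * L)" by (intro mult_left_mono Cy) simp
      also have "\<dots> = (q\<^sup>2 * gconst) * (\<kappa> * L) + q\<^sup>2 * (r * L)" by (simp add: algebra_simps)
      also have "\<dots> \<le> 4 * \<alpha>\<^sup>2 * (\<kappa> * L) + 8 * (r * L)"
        unfolding sl(3) using sl(4) rL by (intro add_left_mono mult_right_mono) auto
      finally show ?thesis .
    qed
    have 2: "(q * u) * bform A C (unitv y) h \<le> 2 * \<alpha> * sqrt gconst * (u * ((\<kappa> - \<gamma>) * L)) + 2 * (r * L)"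
    proof -
      have "(q * u) * bform A C (unitv y) h \<le> (q * u) * ((gconst * (\<kappa> - \<gamma>) + r) * L)"
        using sl(1) u by (intro mult_left_mono hy) simp
      also have "\<dots> = (q * gconst) * (u * ((\<kappa> - \<gamma>) * L)) + (q * u) * (r * L)" by (simp add: algebra_simps)
      also have "(q * u) * (r * L) \<le> (4 * (1 / 2)) * (r * L)"
        using sl(1,2) u rL by (intro mult_right_mono mult_mono) auto
      finally show ?thesis unfolding sl(6) by simp
    qed
    have 3: "u\<^sup>2 * bform A C h h \<le> u\<^sup>2 * (2 * L)" by (intro mult_left_mono hv) simp
    have 4: "a = 4 * \<alpha>\<^sup>2 * (\<kappa> * L) + 2 * \<alpha> * sqrt gconst * (u * ((\<kappa> - \<gamma>) * L)) + u * (s * L)"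
    proof -
      have "a = (q * sqrt gconst) * (2 * \<alpha> * (\<kappa> * L)) + 2 * \<alpha> * sqrt gconst * (u * ((\<kappa> - \<gamma>) * L)) + u * (s * L)"
        unfolding a_def by (simp add: algebra_simps)
      then show ?thesis unfolding sl(5) by (simp add: power2_eq_square)
    qed
    have 5: "u\<^sup>2 * (2 * L) = s\<^sup>2 / 2 * L" "u * (s * L) = s\<^sup>2 / 2 * L"
      by (simp_all add: u_def power2_eq_square)
    have arith: "(x + 2 * y' + z) / 2 - (4 * P + T + S) \<le> - (2 * P) + 6 * R - S / 2"
      if "x \<le> 4 * P + 8 * R" "y' \<le> T + 2 * R" "z \<le> S" for x y' z P R S T :: real
      using that by (simp add: field_simps)
    have "bform A C c c / 2 - a \<le> - (2 * (\<alpha>\<^sup>2 * (\<kappa> * L))) + 6 * (r * L) - s\<^sup>2 / 2 * L / 2"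
      using arith[OF 1[unfolded mult.assoc[of 4]] 2[unfolded 5] 3[unfolded 5]] unfolding V 4 5 by (simp add: mult.assoc)
    then show ?thesis unfolding exp_le_cancel_iff by (simp add: algebra_simps)
  qed
  finally show ?thesis .
qed

text \<open>\<open>8 * \<epsilon> * L\<close> pays for the uncertain variance;
  \<open>4 * sqrt L + 2\<close> pays for the shift by one standard deviation in
  \<open>gaussian_tail_lower\<close> and for the factor \<open>sqrt (2 * pi)\<close>.\<close>

lemma high_prob_lower:
  assumes g: "gaussian_family M A X C" and lc: "log_cov A C \<kappa> L \<epsilon>" and L: "L > 0" and y: "y \<in> A"
    and al: "0 < \<alpha>" "\<alpha> < 1" and k: "0 < \<kappa>" "\<kappa> \<le> 1" and e: "\<epsilon> \<le> \<kappa> / 4"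
  shows "exp (- (2 * \<alpha>\<^sup>2 * \<kappa> + 8 * \<epsilon>) * L - 4 * sqrt L - 2) \<le> measure M {\<omega>\<in>space M. 2 * sqrt gconst * \<alpha> * \<kappa> * L \<le> X y \<omega>}"
proof -
  have fin: "finite A" using lc by (simp add: log_cov_def)
  define V where "V = C y y"
  define a where "a = 2 * sqrt gconst * \<alpha> * \<kappa> * L"
  have yy: "logd y y = 0" by (simp add: logd_def edist_def)
  have Vd: "\<bar>V - gconst * (\<kappa> * L)\<bar> \<le> \<epsilon> * L"
    using lc y unfolding log_cov_def V_def by (metis yy diff_zero)
  have e0: "0 \<le> \<epsilon>" using Vd L by (smt (verit) mult_neg_pos)
  have gk: "\<kappa> / 2 \<le> gconst * \<kappa>" using gconst_bounds k by simp
  have V1: "(gconst * \<kappa> - \<epsilon>) * L \<le> V" using Vd by (simp add: algebra_simps)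
  have "\<kappa> / 4 * L \<le> (gconst * \<kappa> - \<epsilon>) * L" using gk e L by (intro mult_right_mono) auto
  then have V2: "\<kappa> / 4 * L \<le> V" using V1 by linarith
  then have V0: "V > 0" using k L by (smt (verit) divide_pos_pos mult_pos_pos zero_less_numeral)
  have a0: "a \<ge> 0" using al k L gconst_bounds by (simp add: a_def)
  have "exp (- (a + sqrt V)\<^sup>2 / (2 * V)) / sqrt (2 * pi) \<le> measure M {\<omega>\<in>space M. a \<le> X y \<omega>}"
    using gaussian_tail_lower[OF g, of "unitv y" a] V0 a0 by (simp add: bform_unitv fin y V_def sum_unitv)
  moreover have "exp (- (2 * \<alpha>\<^sup>2 * \<kappa> + 8 * \<epsilon>) * L - 4 * sqrt L - 2) \<le> exp (- (a + sqrt V)\<^sup>2 / (2 * V)) / sqrt (2 * pi)"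
  proof -
    have s1: "(a + sqrt V)\<^sup>2 / (2 * V) = a\<^sup>2 / (2 * V) + a / sqrt V + 1 / 2"
      using V0 by (simp add: power2_sum add_divide_distrib) (simp add: field_simps)
    have s2: "a\<^sup>2 / (2 * V) \<le> (2 * \<alpha>\<^sup>2 * \<kappa> + 8 * \<epsilon>) * L"
    proof -
      have a2: "a\<^sup>2 = 4 * gconst * \<alpha>\<^sup>2 * \<kappa>\<^sup>2 * L\<^sup>2"
        using gconst_bounds by (simp add: a_def power_mult_distrib)
      \<comment> \<open>Bounds \<open>1 / (gconst * \<kappa> - \<epsilon>)\<close> without a
        quotient: the inequality amounts to
        \<open>\<epsilon> * (gconst * \<kappa> - 2 * \<epsilon>) >= 0\<close>, which follows from
        \<open>\<epsilon> <= \<kappa> / 4\<close>.\<close>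
      have "gconst * \<kappa> * (gconst * \<kappa>) \<le> (gconst * \<kappa> + 2 * \<epsilon>) * (gconst * \<kappa> - \<epsilon>)"
      proof -
        have "0 \<le> \<epsilon> * (gconst * \<kappa> - 2 * \<epsilon>)" using e0 gk e by simp
        then show ?thesis by (simp add: algebra_simps)
      qed
      then have "(4 * \<alpha>\<^sup>2 * L / gconst) * (gconst * \<kappa> * (gconst * \<kappa>)) * L \<le> (4 * \<alpha>\<^sup>2 * L / gconst) * ((gconst * \<kappa> + 2 * \<epsilon>) * (gconst * \<kappa> - \<epsilon>)) * L"
        using L gconst_bounds by (intro mult_right_mono mult_left_mono) auto
      also have "\<dots> = (4 * \<alpha>\<^sup>2 * L / gconst) * (gconst * \<kappa> + 2 * \<epsilon>) * ((gconst * \<kappa> - \<epsilon>) * L)" by simp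
      also have "\<dots> \<le> (4 * \<alpha>\<^sup>2 * L / gconst) * (gconst * \<kappa> + 2 * \<epsilon>) * V"
        using L gconst_bounds k e0 V1 by (intro mult_left_mono) auto
      also have "(4 * \<alpha>\<^sup>2 * L / gconst) * (gconst * \<kappa> * (gconst * \<kappa>)) * L = a\<^sup>2"
        unfolding a2 using gconst_bounds by (simp add: power2_eq_square)
      finally have "a\<^sup>2 / (2 * V) \<le> (2 * \<alpha>\<^sup>2 * L / gconst) * (gconst * \<kappa> + 2 * \<epsilon>)"
        using V0 by (simp add: field_simps)
      also have "\<dots> = 2 * \<alpha>\<^sup>2 * \<kappa> * L + (2 * \<alpha>\<^sup>2 * (2 / gconst)) * (\<epsilon> * L)"
        using gconst_bounds by (simp add: field_simps)
      also have "(2 * \<alpha>\<^sup>2 * (2 / gconst)) * (\<epsilon> * L) \<le> (2 * 1 * 4) * (\<epsilon> * L)"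
        using e0 L gconst_bounds al by (intro mult_right_mono mult_mono) (auto simp: power_le_one)
      finally show ?thesis by (simp add: algebra_simps)
    qed
    have s3: "a / sqrt V \<le> 4 * sqrt L"
    proof -
      have "a \<le> 2 * (\<kappa> * L)"
      proof -
        have "sqrt gconst * \<alpha> \<le> 1 * 1" using sqrt_gconst_bounds al by (intro mult_mono) auto
        then have "2 * (sqrt gconst * \<alpha>) * (\<kappa> * L) \<le> 2 * 1 * (\<kappa> * L)" using k L by (intro mult_right_mono) auto
        then show ?thesis by (simp add: a_def mult_ac)
      qed
      then have "a\<^sup>2 \<le> (2 * (\<kappa> * L))\<^sup>2" using a0 by (intro power_mono) auto
      also have "\<dots> = 16 * (L * (\<kappa> / 4 * L)) * \<kappa>" by (simp add: power2_eq_square)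
      also have "\<dots> \<le> 16 * (L * (\<kappa> / 4 * L)) * 1" using k L by (intro mult_left_mono) auto
      also have "\<dots> \<le> 16 * (L * V)" using V2 L by (simp add: mult.commute)
      also have "\<dots> = (4 * sqrt L * sqrt V)\<^sup>2" using L V0 by (simp add: power_mult_distrib)
      finally have sq: "a\<^sup>2 \<le> (4 * sqrt L * sqrt V)\<^sup>2" .
      have "a \<le> 4 * sqrt L * sqrt V"
        by (rule power2_le_imp_le[OF sq]) (use L V0 in simp)
      then show ?thesis using V0 by (simp add: pos_divide_le_eq)
    qed
    have pi3: "sqrt (2 * pi) \<le> exp (3 / 2)"
    proof -
      have "sqrt (2 * pi) \<le> 3" using pi_less_4 by (intro real_le_lsqrt) auto
      also have "3 \<le> (3 / 2 :: real) ^ 3" by (simp add: power3_eq_cube)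
      also have "\<dots> \<le> exp (1 / 2) ^ 3" using exp_ge_add_one_self[of "1 / 2"] by (intro power_mono) auto
      also have "\<dots> = exp (3 / 2)" by (simp add: exp_of_nat_mult[symmetric])
      finally show ?thesis .
    qed
    have "exp (- (2 * \<alpha>\<^sup>2 * \<kappa> + 8 * \<epsilon>) * L - 4 * sqrt L - 2) * sqrt (2 * pi)
        \<le> exp (- (2 * \<alpha>\<^sup>2 * \<kappa> + 8 * \<epsilon>) * L - 4 * sqrt L - 2) * exp (3 / 2)"
      by (intro mult_left_mono pi3) simp
    also have "\<dots> = exp (- (2 * \<alpha>\<^sup>2 * \<kappa> + 8 * \<epsilon>) * L - 4 * sqrt L - 1 / 2)"
      by (simp add: exp_add[symmetric])
    also have "\<dots> \<le> exp (- ((a + sqrt V)\<^sup>2 / (2 * V)))"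
      unfolding s1 exp_le_cancel_iff using s2 s3 by (simp add: algebra_simps)
    finally show ?thesis by (simp add: pos_le_divide_eq)
  qed
  ultimately show ?thesis unfolding a_def by linarith
qed

section \<open>Averaging points at a given scale and their logarithmic distances\<close>

definition ring_pt :: "int \<times> int \<Rightarrow> nat \<Rightarrow> nat \<Rightarrow> int \<times> int" where
  "ring_pt y r j = (fst y + int j * int r, snd y)"

definition scale :: "nat \<Rightarrow> real \<Rightarrow> nat" where
  "scale N \<gamma> = nat \<lfloor>exp (\<gamma> * ln (real N))\<rfloor> + 1"

lemma scale_bounds:
  assumes "0 \<le> \<gamma>" "N \<ge> 1"
  shows "exp (\<gamma> * ln (real N)) \<le> real (scale N \<gamma>)" "real (scale N \<gamma>) \<le> 2 * exp (\<gamma> * ln (real N))"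
    "1 \<le> exp (\<gamma> * ln (real N))"
proof -
  show 1: "1 \<le> exp (\<gamma> * ln (real N))" using assms by simp
  then show "exp (\<gamma> * ln (real N)) \<le> real (scale N \<gamma>)" "real (scale N \<gamma>) \<le> 2 * exp (\<gamma> * ln (real N))"
    unfolding scale_def by linarith+
qed

lemma edist_dist: "edist x y = dist (real_of_int (fst x), real_of_int (snd x)) (real_of_int (fst y), real_of_int (snd y))"
  by (simp add: edist_def dist_Pair_Pair dist_real_def)

lemma edist_triangle: "edist x z \<le> edist x y + edist y z"
  unfolding edist_dist by (rule dist_triangle)

lemma logd_ge_ln: "0 < d \<Longrightarrow> d \<le> edist x y \<Longrightarrow> ln d \<le> logd x y"
proof -
  assume d: "0 < d" "d \<le> edist x y"
  have "2 * ln d = ln (d\<^sup>2)" using d by (simp add: ln_realpow)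
  also have "\<dots> \<le> ln ((edist x y)\<^sup>2 + 1)"
    using d by (intro ln_mono) (auto intro: power_mono add_increasing2)
  finally show ?thesis by (simp add: logd_def)
qed

lemma logd_le_ln: "0 < D \<Longrightarrow> (edist x y)\<^sup>2 + 1 \<le> D\<^sup>2 \<Longrightarrow> logd x y \<le> ln D"
proof -
  assume d: "0 < D" "(edist x y)\<^sup>2 + 1 \<le> D\<^sup>2"
  have "ln ((edist x y)\<^sup>2 + 1) \<le> ln (D\<^sup>2)"
    using d by (intro ln_mono) (auto intro: add_nonneg_pos)
  also have "\<dots> = 2 * ln D" using d by (simp add: ln_realpow)
  finally show ?thesis by (simp add: logd_def)
qed

lemma edist_le_exp_logd: "edist x y \<le> exp (logd x y)"
proof (rule power2_le_imp_le)
  have "(exp (logd x y))\<^sup>2 = exp (ln ((edist x y)\<^sup>2 + 1))"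
    unfolding logd_def by (simp add: exp_double[symmetric] power2_eq_square exp_add[symmetric])
  also have "\<dots> = (edist x y)\<^sup>2 + 1" by (simp add: add_nonneg_pos)
  finally show "(edist x y)\<^sup>2 \<le> (exp (logd x y))\<^sup>2" by simp
qed simp

lemma logd_le_scale:
  assumes c: "c \<ge> 1" and e: "edist x y \<le> c * exp (\<gamma> * L)" and g: "1 \<le> exp (\<gamma> * L)"
  shows "logd x y \<le> \<gamma> * L + ln (2 * c)"
proof -
  let ?E = "exp (\<gamma> * L)"
  have "(edist x y)\<^sup>2 \<le> (c * ?E)\<^sup>2" using e edist_nonneg by (intro power_mono) auto
  moreover have "1 * 1 \<le> c * ?E" using c g by (intro mult_mono) auto
  then have "1\<^sup>2 \<le> (c * ?E)\<^sup>2" by (intro power_mono) auto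
  ultimately have "(edist x y)\<^sup>2 + 1 \<le> 4 * (c * ?E)\<^sup>2" by simp
  then have "(edist x y)\<^sup>2 + 1 \<le> (2 * c * ?E)\<^sup>2" by (simp add: power_mult_distrib)
  then have "logd x y \<le> ln (2 * c * ?E)" using c by (intro logd_le_ln) auto
  also have "\<dots> = \<gamma> * L + ln (2 * c)" using c by (simp add: ln_mult)
  finally show ?thesis .
qed

lemma edist_ring: "edist (ring_pt y r i) (ring_pt y r j) = \<bar>real i - real j\<bar> * real r" "edist y (ring_pt y r j) = real j * real r"
proof -
  have "edist (ring_pt y r i) (ring_pt y r j) = sqrt (((real i - real j) * real r)\<^sup>2)"
    by (simp add: edist_def ring_pt_def left_diff_distrib)
  also have "\<dots> = \<bar>real i - real j\<bar> * real r"
    unfolding real_sqrt_abs by (simp add: abs_mult)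
  finally show "edist (ring_pt y r i) (ring_pt y r j) = \<bar>real i - real j\<bar> * real r" .
  show "edist y (ring_pt y r j) = real j * real r" unfolding edist_def ring_pt_def by simp
qed

context
  fixes N :: nat and \<gamma> :: real and y :: "int \<times> int" and m :: nat
  assumes gam: "0 \<le> \<gamma>" and N: "N \<ge> 1"
begin

lemma logd_center_ring: "j \<ge> 1 \<Longrightarrow> \<gamma> * ln (real N) \<le> logd y (ring_pt y (scale N \<gamma>) j)"
proof -
  assume "j \<ge> 1"
  have "1 * exp (\<gamma> * ln (real N)) \<le> real j * real (scale N \<gamma>)"
    using scale_bounds[OF gam N] \<open>j \<ge> 1\<close> by (intro mult_mono) auto
  then show ?thesis using logd_ge_ln[of "exp (\<gamma> * ln (real N))" y "ring_pt y (scale N \<gamma>) j"] by (simp add: edist_ring)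
qed

lemma logd_ring_ring: "i \<noteq> j \<Longrightarrow> \<gamma> * ln (real N) \<le> logd (ring_pt y (scale N \<gamma>) i) (ring_pt y (scale N \<gamma>) j)"
proof -
  assume "i \<noteq> j"
  then have "1 \<le> \<bar>real i - real j\<bar>" by linarith
  then have "1 * exp (\<gamma> * ln (real N)) \<le> \<bar>real i - real j\<bar> * real (scale N \<gamma>)"
    using scale_bounds[OF gam N] by (intro mult_mono) auto
  then show ?thesis
    using logd_ge_ln[of "exp (\<gamma> * ln (real N))" "ring_pt y (scale N \<gamma>) i" "ring_pt y (scale N \<gamma>) j"] by (simp add: edist_ring)
qed

lemma logd_near_ring:
  assumes z: "edist y z \<le> 2 * exp (\<gamma> * ln (real N))" and j: "j \<in> {1..m}"
  shows "logd z (ring_pt y (scale N \<gamma>) j) \<le> \<gamma> * ln (real N) + ln (8 * real m)"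
proof -
  have "edist z (ring_pt y (scale N \<gamma>) j) \<le> edist z y + edist y (ring_pt y (scale N \<gamma>) j)"
    by (rule edist_triangle)
  also have "\<dots> \<le> 2 * exp (\<gamma> * ln (real N)) + real m * (2 * exp (\<gamma> * ln (real N)))"
    unfolding edist_ring using z scale_bounds[OF gam N] j by (intro add_mono mult_mono) (auto simp: edist_sym)
  also have "\<dots> \<le> real m * (2 * exp (\<gamma> * ln (real N))) + real m * (2 * exp (\<gamma> * ln (real N)))"
    using j by (intro add_right_mono) (auto intro!: mult_right_mono)
  also have "\<dots> = (4 * real m) * exp (\<gamma> * ln (real N))" by simp
  finally show ?thesis
    using logd_le_scale[of "4 * real m" z "ring_pt y (scale N \<gamma>) j" \<gamma> "ln (real N)"] scale_bounds[OF gam N] j by simp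
qed

lemma logd_ring_ring_le:
  assumes "i \<in> {1..m}" "j \<in> {1..m}"
  shows "logd (ring_pt y (scale N \<gamma>) i) (ring_pt y (scale N \<gamma>) j) \<le> \<gamma> * ln (real N) + ln (8 * real m)"
proof -
  have "edist (ring_pt y (scale N \<gamma>) i) (ring_pt y (scale N \<gamma>) j) \<le> real m * (2 * exp (\<gamma> * ln (real N)))"
    unfolding edist_ring using assms scale_bounds[OF gam N] by (intro mult_mono) auto
  then have "edist (ring_pt y (scale N \<gamma>) i) (ring_pt y (scale N \<gamma>) j) \<le> (4 * real m) * exp (\<gamma> * ln (real N))"
    by (rule order_trans) simp
  then show ?thesis
    using logd_le_scale[of "4 * real m"] scale_bounds[OF gam N] assms by simp
qed

text \<open>The "ring" is a set of \<open>m\<close> equally spaced points on a ray: on the scale of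
  \<open>ln N\<close> only the order \<open>N powr \<gamma>\<close> of the distances counts. Half of
  \<open>r\<close> pays for \<open>\<epsilon>\<close>. The other half pays for the diagonal terms in
  the upper bound of the variance, through \<open>2 / r <= m\<close>, and for the constant
  \<open>ln (8 * m)\<close> in the lower bounds.\<close>

lemma ring_avg:
  assumes lc: "log_cov A C \<kappa> (ln (real N)) \<epsilon>" and y: "y \<in> A" and k: "\<gamma> \<le> \<kappa>" "\<kappa> \<le> 1" and m: "m > 0"
    and p: "\<And>j. j \<in> {1..m} \<Longrightarrow> ring_pt y (scale N \<gamma>) j \<in> A"
    and r: "\<epsilon> \<le> r / 2" "2 / r \<le> real m" "0 < r" and lm: "ln (8 * real m) \<le> r / 2 * ln (real N)"
  defines "h \<equiv> avg m (ring_pt y (scale N \<gamma>))"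
  shows "bform A C h h \<le> (gconst * (\<kappa> - \<gamma>) + r) * ln (real N)"
    and "bform A C (unitv y) h \<le> (gconst * (\<kappa> - \<gamma>) + r) * ln (real N)"
    and "\<And>z. z \<in> A \<Longrightarrow> edist y z \<le> 2 * exp (\<gamma> * ln (real N)) \<Longrightarrow> (gconst * (\<kappa> - \<gamma>) - r) * ln (real N) \<le> bform A C (unitv z) h"
    and "(gconst * (\<kappa> - \<gamma>) - r) * ln (real N) \<le> bform A C h h"
proof -
  have L: "0 \<le> ln (real N)" using N by simp
  have gm: "gconst * \<kappa> / real m \<le> r / 2"
  proof -
    have "gconst * \<kappa> \<le> 1 * 1" using k gam gconst_bounds by (intro mult_mono) auto
    moreover have "1 \<le> r / 2 * real m" using r by (simp add: field_simps)
    ultimately show ?thesis using m by (simp add: pos_divide_le_eq)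
  qed
  have "bform A C h h \<le> (gconst * (\<kappa> - \<gamma>) + gconst * \<kappa> / real m + \<epsilon>) * ln (real N)"
    unfolding h_def using gam k L logd_ring_ring by (intro var_avg_le[OF lc m p]) auto
  also have "\<dots> \<le> (gconst * (\<kappa> - \<gamma>) + r) * ln (real N)"
  proof (rule mult_right_mono[OF _ L])
    show "gconst * (\<kappa> - \<gamma>) + gconst * \<kappa> / real m + \<epsilon> \<le> gconst * (\<kappa> - \<gamma>) + r"
      using gm r by linarith
  qed
  finally show "bform A C h h \<le> (gconst * (\<kappa> - \<gamma>) + r) * ln (real N)" .
  have "bform A C (unitv y) h \<le> (gconst * (\<kappa> - \<gamma>) + \<epsilon>) * ln (real N)"
    unfolding h_def using logd_center_ring by (intro cov_avg_le[OF lc m p y]) auto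
  also have "\<dots> \<le> (gconst * (\<kappa> - \<gamma>) + r) * ln (real N)"
    using L r by (intro mult_right_mono) auto
  finally show "bform A C (unitv y) h \<le> (gconst * (\<kappa> - \<gamma>) + r) * ln (real N)" .
  have low: "(gconst * (\<kappa> - \<gamma>) - r) * ln (real N) \<le> (gconst * (\<kappa> - (\<gamma> + r / 2)) - \<epsilon>) * ln (real N)"
  proof (rule mult_right_mono[OF _ L])
    have "gconst * (r / 2) \<le> 1 * (r / 2)" using gconst_bounds r by (intro mult_right_mono) auto
    then show "gconst * (\<kappa> - \<gamma>) - r \<le> gconst * (\<kappa> - (\<gamma> + r / 2)) - \<epsilon>"
    proof -
      have "gconst * (\<kappa> - (\<gamma> + r / 2)) = gconst * (\<kappa> - \<gamma>) - gconst * (r / 2)" by (simp add: algebra_simps)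
      moreover have "gconst * (r / 2) \<le> r / 2" using \<open>gconst * (r / 2) \<le> 1 * (r / 2)\<close> by simp
      ultimately show ?thesis using r(1) by linarith
    qed
  qed
  show "(gconst * (\<kappa> - \<gamma>) - r) * ln (real N) \<le> bform A C (unitv z) h"
    if z: "z \<in> A" "edist y z \<le> 2 * exp (\<gamma> * ln (real N))" for z
  proof -
    have "(gconst * (\<kappa> - (\<gamma> + r / 2)) - \<epsilon>) * ln (real N) \<le> bform A C (unitv z) h"
      unfolding h_def
    proof (rule cov_avg_ge[OF lc m p z(1)])
      fix j assume "j \<in> {1..m}"
      then have "logd z (ring_pt y (scale N \<gamma>) j) \<le> \<gamma> * ln (real N) + ln (8 * real m)"
        by (rule logd_near_ring[OF z(2)])
      then show "logd z (ring_pt y (scale N \<gamma>) j) \<le> (\<gamma> + r / 2) * ln (real N)"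
        using lm by (simp add: algebra_simps)
    qed
    with low show ?thesis by linarith
  qed
  have "(gconst * (\<kappa> - (\<gamma> + r / 2)) - \<epsilon>) * ln (real N) \<le> bform A C h h"
    unfolding h_def
  proof (rule var_avg_ge[OF lc m p])
    fix i j assume "i \<in> {1..m}" "j \<in> {1..m}"
    then have "logd (ring_pt y (scale N \<gamma>) i) (ring_pt y (scale N \<gamma>) j) \<le> \<gamma> * ln (real N) + ln (8 * real m)"
      by (rule logd_ring_ring_le)
    then show "logd (ring_pt y (scale N \<gamma>) i) (ring_pt y (scale N \<gamma>) j) \<le> (\<gamma> + r / 2) * ln (real N)"
      using lm by (simp add: algebra_simps)
  qed
  with low show "(gconst * (\<kappa> - \<gamma>) - r) * ln (real N) \<le> bform A C h h" by linarith
qed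

end

section \<open>Counting lattice points scale by scale\<close>

lemma card_edist_ball:
  assumes "\<rho> \<ge> 0" and S: "\<And>z. z \<in> S \<Longrightarrow> edist y z \<le> \<rho>"
  shows "finite S" "real (card S) \<le> (2 * \<rho> + 1)\<^sup>2"
proof -
  define n where "n = nat \<lfloor>\<rho>\<rfloor>"
  have n: "real n \<le> \<rho>" "int n = \<lfloor>\<rho>\<rfloor>" using assms(1) by (auto simp: n_def)
  have sub: "S \<subseteq> {fst y - int n..fst y + int n} \<times> {snd y - int n..snd y + int n}"
  proof
    fix z assume z: "z \<in> S"
    have "\<bar>real_of_int (fst y - fst z)\<bar> \<le> edist y z" "\<bar>real_of_int (snd y - snd z)\<bar> \<le> edist y z"
      unfolding edist_def by (rule real_le_rsqrt, simp)+
    then have "\<bar>fst y - fst z\<bar> \<le> \<lfloor>\<rho>\<rfloor>" "\<bar>snd y - snd z\<bar> \<le> \<lfloor>\<rho>\<rfloor>"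
      using S[OF z] by (auto simp: le_floor_iff)
    then show "z \<in> {fst y - int n..fst y + int n} \<times> {snd y - int n..snd y + int n}"
      unfolding n(2) by (cases z) auto
  qed
  then show "finite S" by (rule finite_subset) simp
  have "card S \<le> card ({fst y - int n..fst y + int n} \<times> {snd y - int n..snd y + int n})"
    by (intro card_mono sub) simp
  also have "\<dots> = (2 * n + 1) * (2 * n + 1)"
    by (simp add: card_cartesian_product nat_add_distrib nat_mult_distrib)
  finally have "card S \<le> (2 * n + 1) * (2 * n + 1)" .
  then have "real (card S) \<le> (2 * real n + 1)\<^sup>2"
  proof -
    have "real ((2 * n + 1) * (2 * n + 1)) = (2 * real n + 1)\<^sup>2" by (simp add: power2_eq_square algebra_simps)
    then show ?thesis using \<open>card S \<le> (2 * n + 1) * (2 * n + 1)\<close> by (metis of_nat_le_iff)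
  qed
  also have "\<dots> \<le> (2 * \<rho> + 1)\<^sup>2" using n by (intro power_mono) auto
  finally show "real (card S) \<le> (2 * \<rho> + 1)\<^sup>2" .
qed

text \<open>Taking the least admissible \<open>k\<close> gives the lower bound, because
  \<open>k - 1\<close> fails; for \<open>k = 1\<close> that bound is 0. The slack \<open>c\<close>
  on the upper side absorbs bounded factors in distances.\<close>

lemma scale_class:
  fixes d b L :: real and K :: nat
  assumes "0 \<le> d" "d \<le> b * L + c" "K \<ge> 1" "0 \<le> c" "0 \<le> b * L"
  shows "\<exists>k\<in>{1..K}. (b * real k / real K - b / real K) * L \<le> d \<and> d \<le> b * real k / real K * L + c"
proof -
  define Q where "Q = (\<lambda>k. 1 \<le> k \<and> d \<le> b * real k / real K * L + c)"
  define k where "k = (LEAST k. Q k)"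
  have QK: "Q K" using assms by (simp add: Q_def)
  then have Qk: "Q k" unfolding k_def by (rule LeastI)
  have kK: "k \<le> K" unfolding k_def using QK by (rule Least_le)
  have "(b * real k / real K - b / real K) * L \<le> d"
  proof (cases "k = 1")
    case True then show ?thesis using assms by simp
  next
    case False
    then have "\<not> Q (k - 1)" using Qk unfolding k_def by (intro not_less_Least) (auto simp: Q_def)
    then have "b * real (k - 1) / real K * L + c < d" using False Qk by (auto simp: Q_def)
    moreover have "b * real (k - 1) / real K * L = (b * real k / real K - b / real K) * L"
      using Qk by (simp add: Q_def of_nat_diff diff_divide_distrib right_diff_distrib)
    ultimately show ?thesis using assms by linarith
  qed
  then show ?thesis using Qk kK by (auto simp: Q_def)
qed

text \<open>The largest scale dominates because
  \<open>2 * \<gamma> * (1 - \<alpha>\<^sup>2)\<close> increases with the scale \<open>\<gamma>\<close>.\<close>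

lemma sum_over_scales:
  assumes B: "finite B" and K: "K \<ge> 1" and b: "0 \<le> b" and al: "\<alpha>\<^sup>2 \<le> 1" and L: "0 \<le> L"
    and far: "\<And>z. z \<in> B \<Longrightarrow> logd y z \<le> b * L + ln 2"
    and f: "\<And>z k. z \<in> B \<Longrightarrow> k \<in> {1..K} \<Longrightarrow> (b * real k / real K - b / real K) * L \<le> logd y z \<Longrightarrow>
        logd y z \<le> b * real k / real K * L + ln 2 \<Longrightarrow> f z \<le> exp ((P - 2 * \<alpha>\<^sup>2 * (b * real k / real K)) * L)"
  shows "(\<Sum>z\<in>B. f z) \<le> 25 * real K * exp ((P + 2 * b * (1 - \<alpha>\<^sup>2)) * L)"
proof -
  define g where "g = (\<lambda>k. b * real k / real K)"
  define S where "S = (\<lambda>k. {z\<in>B. (g k - b / real K) * L \<le> logd y z \<and> logd y z \<le> g k * L + ln 2})"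
  define c where "c = (\<lambda>k. exp ((P - 2 * \<alpha>\<^sup>2 * g k) * L))"
  have fS: "finite (S k)" for k using B by (simp add: S_def)
  have "f z \<le> (\<Sum>k\<in>{1..K}. if z \<in> S k then c k else 0)" if z: "z \<in> B" for z
  proof -
    obtain k where k: "k \<in> {1..K}" "(b * real k / real K - b / real K) * L \<le> logd y z" "logd y z \<le> b * real k / real K * L + ln 2"
      using scale_class[OF logd_nonneg far[OF z] K] b L by auto
    have "f z \<le> c k" using f[OF z k] by (simp add: c_def g_def)
    also have "\<dots> = (if z \<in> S k then c k else 0)" using k z by (simp add: S_def g_def)
    also have "\<dots> \<le> (\<Sum>k\<in>{1..K}. if z \<in> S k then c k else 0)"
      using k(1) by (intro member_le_sum) (auto simp: c_def)
    finally show ?thesis .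
  qed
  then have "(\<Sum>z\<in>B. f z) \<le> (\<Sum>z\<in>B. \<Sum>k\<in>{1..K}. if z \<in> S k then c k else 0)"
    by (rule sum_mono)
  also have "\<dots> = (\<Sum>k\<in>{1..K}. \<Sum>z\<in>B. if z \<in> S k then c k else 0)" by (rule sum.swap)
  also have "\<dots> = (\<Sum>k\<in>{1..K}. real (card (S k)) * c k)"
  proof (rule sum.cong[OF refl])
    fix k
    have "B \<inter> {z. z \<in> S k} = S k" by (auto simp: S_def)
    then show "(\<Sum>z\<in>B. if z \<in> S k then c k else 0) = real (card (S k)) * c k"
      using B by (simp add: sum.If_cases)
  qed
  also have "\<dots> \<le> (\<Sum>k\<in>{1..K}. 25 * exp ((P + 2 * b * (1 - \<alpha>\<^sup>2)) * L))"
  proof (rule sum_mono)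
    fix k assume k: "k \<in> {1..K}"
    have g0: "0 \<le> g k" "g k \<le> b"
      using b k K mult_left_mono[of "real k" "real K" b] by (auto simp: g_def field_simps)
    have E1: "1 \<le> exp (g k * L)" using g0 L by simp
    \<comment> \<open>Class \<open>k\<close> lies in a ball of radius
      \<open>2 * exp (g k * L)\<close>. As that exponential is at least 1,
      \<open>(4 * E + 1)^2 <= (5 * E)^2\<close> explains the factor 25.\<close>
    have "real (card (S k)) \<le> (2 * (2 * exp (g k * L)) + 1)\<^sup>2"
    proof (rule card_edist_ball(2))
      fix z assume "z \<in> S k"
      then have "logd y z \<le> g k * L + ln 2" by (simp add: S_def)
      then have "exp (logd y z) \<le> exp (g k * L + ln 2)" by simp
      also have "\<dots> = 2 * exp (g k * L)" by (simp add: exp_add)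
      finally show "edist y z \<le> 2 * exp (g k * L)" using edist_le_exp_logd[of y z] by linarith
    qed simp
    also have "\<dots> \<le> (5 * exp (g k * L))\<^sup>2" using E1 by (intro power_mono) auto
    also have "\<dots> = 25 * exp (2 * g k * L)" by (simp add: power_mult_distrib exp_double[symmetric] mult.assoc)
    finally have "real (card (S k)) * c k \<le> 25 * exp (2 * g k * L) * c k"
      by (intro mult_right_mono) (auto simp: c_def)
    also have "\<dots> = 25 * exp ((P + 2 * g k * (1 - \<alpha>\<^sup>2)) * L)"
      by (simp add: c_def exp_add[symmetric] algebra_simps)
    also have "\<dots> \<le> 25 * exp ((P + 2 * b * (1 - \<alpha>\<^sup>2)) * L)"
      using g0 al L by (auto intro!: mult_right_mono mult_left_mono)
    finally show "real (card (S k)) * c k \<le> 25 * exp ((P + 2 * b * (1 - \<alpha>\<^sup>2)) * L)" .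
  qed
  also have "\<dots> = 25 * real K * exp ((P + 2 * b * (1 - \<alpha>\<^sup>2)) * L)" by simp
  finally show ?thesis .
qed

section \<open>High points of a log-correlated field in a block\<close>

definition rect :: "int \<times> int \<Rightarrow> nat \<Rightarrow> nat \<Rightarrow> (int \<times> int) set" where
  "rect x a b = {fst x..<fst x + int a} \<times> {snd x..<snd x + int b}"

lemma card_rect: "card (rect x a b) = a * b"
  by (simp add: rect_def card_cartesian_product)

lemma finite_rect [simp]: "finite (rect x a b)"
  by (simp add: rect_def)

text \<open>The divisor 16 lets a doubled block at distance up to four sides from \<open>x\<close>
  stay within \<open>N powr \<beta> / 4\<close> of it.\<close>

definition blk :: "nat \<Rightarrow> real \<Rightarrow> nat" where
  "blk N \<beta> = nat \<lfloor>exp (\<beta> * ln (real N)) / 16\<rfloor>"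

lemma eventually_ln_dominates:
  assumes "(d::real) > 0"
  shows "\<forall>\<^sub>F N in sequentially. c + 4 * sqrt (ln (real N)) \<le> d * ln (real N)"
  using assms by real_asymp

lemma eventually_ln_ge:
  assumes "(d::real) > 0"
  shows "\<forall>\<^sub>F N in sequentially. c \<le> d * ln (real N)"
  using assms by real_asymp

text \<open>For \<open>\<alpha>\<^sup>2 > 1 / 2\<close> the plain second moment is too large. Points whose local averages are atypically
  high at some scale are therefore discarded, which costs nothing in the first moment. As the covariance is known
  only up to \<open>o(ln N)\<close>, the resulting probability is merely \<open>N powr (- \<zeta>)\<close>.\<close>

lemma core_second_moment:
  fixes \<alpha> \<beta> \<zeta> :: real
  assumes al: "0 < \<alpha>" "\<alpha> < 1" and be: "0 < \<beta>" "\<beta> \<le> 1" and ze: "0 < \<zeta>"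
  shows "\<exists>\<epsilon>>0. \<forall>\<^sub>F N in sequentially. \<forall>(M :: 'a measure) X C x0.
    gaussian_family M (rect x0 (2 * blk N \<beta>) (blk N \<beta>)) X C \<longrightarrow>
    log_cov (rect x0 (2 * blk N \<beta>) (blk N \<beta>)) C \<beta> (ln (real N)) \<epsilon> \<longrightarrow>
    exp (- \<zeta> * ln (real N)) \<le> measure M {\<omega>\<in>space M. exp ((2 * \<beta> * (1 - \<alpha>\<^sup>2) - \<zeta>) * ln (real N))
        \<le> real (card {y\<in>rect x0 (blk N \<beta>) (blk N \<beta>). 2 * sqrt gconst * \<alpha> * \<beta> * ln (real N) \<le> X y \<omega>})}"
    (is "\<exists>\<epsilon>>0. \<forall>\<^sub>F N in sequentially. ?P \<epsilon> N")
proof -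
  \<comment> \<open>\<open>s\<close> is the slack of the truncation. The choice of \<open>r\<close>
    gives \<open>s^2 / 4 = 25 * r\<close>, so truncation gains
    \<open>25 * r - 6 * r = 19 * r\<close>, against a loss of \<open>5 * r\<close> in the lower
    bound for one point and \<open>14 * r\<close> for the union over scales. \<open>K\<close> makes
    the discretisation of scales cost at most \<open>\<zeta> / 4\<close>.\<close>
  define s where "s = min 1 (min (\<zeta> / 10) \<beta>)"
  define r where "r = s\<^sup>2 / 100"
  define \<epsilon> where "\<epsilon> = r / 2"
  define K where "K = nat \<lceil>32 / \<zeta>\<rceil> + 1"
  define m where "m = nat \<lceil>2 / r\<rceil> + 1"
  have s: "0 < s" "s \<le> 1" "s \<le> \<zeta> / 10" "s \<le> \<beta>" using ze be by (auto simp: s_def)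
  have "s\<^sup>2 \<le> s" using s by (simp add: power2_eq_square mult_left_le)
  then have r: "0 < r" "r \<le> s / 100" "s\<^sup>2 / 4 = 25 * r" using s by (auto simp: r_def)
  have m: "m > 0" "2 / r \<le> real m" unfolding m_def by linarith+
  have K: "K \<ge> 1" "32 / \<zeta> \<le> real K" unfolding K_def by linarith+
  have theta: "8 * (\<beta> / real K) \<le> \<zeta> / 4"
  proof -
    have "\<beta> * 32 \<le> 1 * (\<zeta> * real K)" using K be ze by (intro mult_mono) (auto simp: field_simps)
    then show ?thesis using K by (simp add: field_simps)
  qed
  have al2: "\<alpha>\<^sup>2 \<le> 1" "0 \<le> \<alpha>\<^sup>2" using al by (auto simp: power_le_one)
  have pos: "0 < r / 2" "0 < r" "0 < 14 * r" "0 < \<beta>" "0 < \<beta> / real K" "0 < 3 / 10 * \<zeta>"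
    using r be ze K by auto
  have "\<forall>\<^sub>F N in sequentially. ?P \<epsilon> N"
    using eventually_ge_at_top[of 2]
      eventually_ln_ge[OF pos(1), of "ln (8 * real m)"]
      eventually_ln_dominates[OF pos(2), of "2 + ln 2"]
      eventually_ln_ge[OF pos(3), of "ln (real K)"]
      eventually_ln_ge[OF pos(4), of "ln 32"]
      eventually_ln_ge[OF pos(5), of "ln (64 * real m)"]
      eventually_ln_ge[OF pos(6), of "ln (102400 * real K)"]
  proof eventually_elim
    case (elim N)
    define L where "L = ln (real N)"
    have N: "N \<ge> 1" and L: "L > 0" using elim(1) by (auto simp: L_def)
    have A2: "ln (8 * real m) \<le> r / 2 * L"
      and A3: "2 + ln 2 + 4 * sqrt L \<le> r * L"
      and A4: "ln (real K) \<le> 14 * r * L"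
      and A5: "ln 32 \<le> \<beta> * L"
      and A6: "ln (64 * real m) \<le> \<beta> / real K * L"
      and A7: "ln (102400 * real K) \<le> 3 / 10 * \<zeta> * L"
      using elim(2-) r be ze K by (auto simp: L_def)
    define R where "R = blk N \<beta>"
    define E where "E = exp (\<beta> * L)"
    have E32: "32 \<le> E"
    proof -
      have "exp (ln 32) \<le> E" unfolding E_def using A5 by (simp only: exp_le_cancel_iff)
      then show ?thesis by simp
    qed
    have R: "real R \<le> E / 16" "E / 32 \<le> real R"
      using E32 unfolding R_def blk_def E_def L_def by linarith+
    \<comment> \<open>102400 is the product of 4 from Paley-Zygmund, 25 from
      \<open>sum_over_scales\<close> and 1024 from the block area, which is at least
      \<open>(E / 32)^2\<close>.\<close>
    have lnK: "real K \<le> exp (14 * r * L)" "102400 * real K \<le> exp (3 / 10 * \<zeta> * L)"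
    proof -
      have "exp (ln (real K)) \<le> exp (14 * r * L)" "exp (ln (102400 * real K)) \<le> exp (3 / 10 * \<zeta> * L)"
        using A4 A7 by (simp_all only: exp_le_cancel_iff)
      then show "real K \<le> exp (14 * r * L)" "102400 * real K \<le> exp (3 / 10 * \<zeta> * L)" using K by auto
    qed
    show ?case
      unfolding L_def[symmetric] R_def[symmetric]
    proof (intro allI impI)
      fix M :: "'a measure" and X C x0
      \<comment> \<open>The averaging points lie to the right of their centre. Centres are taken
        from the left half \<open>B\<close>, so the averages remain inside the doubled
        block.\<close>
      define A where "A = rect x0 (2 * R) R"
      define B where "B = rect x0 R R"
      assume g: "gaussian_family M (rect x0 (2 * R) R) X C" and lc: "log_cov (rect x0 (2 * R) R) C \<beta> L \<epsilon>"
      note g = g[folded A_def] and lc = lc[folded A_def]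
      interpret M: prob_space M by (rule gaussian_familyD(1)[OF g])
      have BA: "B \<subseteq> A" by (auto simp: A_def B_def rect_def)
      define a where "a = 2 * sqrt gconst * \<alpha> * \<beta> * L"
      define gm where "gm = (\<lambda>k. \<beta> * real k / real K)"
      define h where "h = (\<lambda>y k. avg m (ring_pt y (scale N (gm k))))"
      define t where "t = (\<lambda>k. (2 * sqrt gconst * \<alpha> * (\<beta> - gm k) + s) * L)"
      \<comment> \<open>Only \<open>k < K\<close> is truncated: points at the top scale
        \<open>\<beta>\<close> itself would leave the block, while for smaller \<open>k\<close> the
        margin \<open>\<beta> / K\<close> makes room.\<close>
      define Ev where "Ev = (\<lambda>y. {\<omega>\<in>space M. a \<le> X y \<omega> \<and> (\<forall>k\<in>{1..<K}. (\<Sum>i\<in>A. h y k i * X i \<omega>) \<le> t k)})"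
      note lm [measurable] = gaussian_lin_measurable[OF g]
      have Xm: "X y \<in> borel_measurable M" if "y \<in> B" for y
        by (rule gaussian_familyD(3)[OF g subsetD[OF BA that]])
      have Evm: "Ev y \<in> sets M" if "y \<in> B" for y
        unfolding Ev_def using Xm[OF that] by measurable
      have gmb: "0 \<le> gm k" "gm k \<le> \<beta>" if "k \<le> K" for k
        using that be K mult_left_mono[of "real k" "real K" \<beta>] by (auto simp: gm_def field_simps)
      have ring: "ring_pt y (scale N (gm k)) j \<in> A" if y: "y \<in> B" and k: "k \<in> {1..<K}" and j: "j \<in> {1..m}" for y k j
      proof -
        have "gm k \<le> \<beta> - \<beta> / real K"
        proof -
          have "real k \<le> real K - 1" using k by auto
          then have "\<beta> * real k \<le> \<beta> * (real K - 1)" using be by (intro mult_left_mono) auto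
          then show ?thesis using K by (simp add: gm_def field_simps)
        qed
        then have "gm k * L \<le> (\<beta> - \<beta> / real K) * L" using L by (intro mult_right_mono) auto
        then have "gm k * L \<le> \<beta> * L - ln (64 * real m)" using A6 by (simp add: left_diff_distrib)
        then have "exp (gm k * L) \<le> exp (\<beta> * L - ln (64 * real m))" by simp
        also have "\<dots> = E / (64 * real m)" using m by (simp add: exp_diff E_def)
        finally have e: "exp (gm k * L) \<le> E / (64 * real m)" .
        have "real j * real (scale N (gm k)) \<le> real m * (2 * exp (gm k * L))"
          using j k scale_bounds(2)[OF gmb(1) N, of k] unfolding L_def by (intro mult_mono) auto
        also have "\<dots> \<le> real m * (2 * (E / (64 * real m)))" using e by (intro mult_left_mono) auto
        also have "\<dots> = E / 32" using m by simp
        also have "\<dots> \<le> real R" by (rule R(2))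
        finally have "j * scale N (gm k) \<le> R" by (simp only: of_nat_mult[symmetric] of_nat_le_iff)
        then have "int j * int (scale N (gm k)) \<le> int R" by (simp only: of_nat_mult[symmetric] of_nat_le_iff)
        moreover define w where "w = int j * int (scale N (gm k))"
        ultimately have "w \<le> int R" "0 \<le> w" by simp_all
        then show ?thesis using y by (cases y) (auto simp: A_def B_def rect_def ring_pt_def w_def[symmetric])
      qed
      have avgs: "bform A C (h y k) (h y k) \<le> (gconst * (\<beta> - gm k) + r) * L"
          "bform A C (unitv y) (h y k) \<le> (gconst * (\<beta> - gm k) + r) * L"
          "\<And>z. z \<in> A \<Longrightarrow> edist y z \<le> 2 * exp (gm k * L) \<Longrightarrow> (gconst * (\<beta> - gm k) - r) * L \<le> bform A C (unitv z) (h y k)"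
        if y: "y \<in> B" and k: "k \<in> {1..<K}" for y k
      proof -
        have kk: "0 \<le> gm k" "gm k \<le> \<beta>" using gmb[of k] k by auto
        have yA: "y \<in> A" using y BA by auto
        note ra = ring_avg[OF kk(1) N lc[unfolded L_def] yA kk(2) be(2) m(1) ring[OF y k] _ m(2) r(1) A2[unfolded L_def], folded L_def, folded h_def]
        show "bform A C (h y k) (h y k) \<le> (gconst * (\<beta> - gm k) + r) * L"
          "bform A C (unitv y) (h y k) \<le> (gconst * (\<beta> - gm k) + r) * L"
          "\<And>z. z \<in> A \<Longrightarrow> edist y z \<le> 2 * exp (gm k * L) \<Longrightarrow> (gconst * (\<beta> - gm k) - r) * L \<le> bform A C (unitv z) (h y k)"
          using ra unfolding h_def \<epsilon>_def by auto
      qed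
      have eps: "\<epsilon> \<le> r" using r by (simp add: \<epsilon>_def)
      have PE: "exp (- (2 * \<alpha>\<^sup>2 * \<beta> + 5 * r) * L) \<le> measure M (Ev y)" if y: "y \<in> B" for y
      proof -
        have yA: "y \<in> A" using y BA by auto
        define T where "T = (\<lambda>k. {\<omega>\<in>space M. a \<le> X y \<omega> \<and> t k \<le> (\<Sum>i\<in>A. h y k i * X i \<omega>)})"
        have Tm: "T k \<in> sets M" for k unfolding T_def using Xm[OF y] by measurable
        have PT: "measure M (T k) \<le> exp ((- 2 * \<alpha>\<^sup>2 * \<beta> - 19 * r) * L)" if k: "k \<in> {1..<K}" for k
        proof -
          have kk: "0 \<le> gm k" "gm k \<le> \<beta>" using gmb[of k] k by auto
          have "gconst * (\<beta> - gm k) + r \<le> 1 * 1 + 1"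
            using kk be gconst_bounds r s by (intro add_mono mult_mono) auto
          then have "(gconst * (\<beta> - gm k) + r) * L \<le> 2 * L" using L by (intro mult_right_mono) auto
          with avgs(1)[OF y k] have hv: "bform A C (h y k) (h y k) \<le> 2 * L" by linarith
          have "measure M (T k) \<le> exp ((- 2 * \<alpha>\<^sup>2 * \<beta> - s\<^sup>2 / 4 + 6 * r) * L)"
            using L r s by (intro high_trunc_prob[OF g lc _ yA al eps _ hv avgs(2)[OF y k]])
               (auto simp: T_def a_def t_def)
          moreover have "- 2 * \<alpha>\<^sup>2 * \<beta> - 25 * r + 6 * r = - 2 * \<alpha>\<^sup>2 * \<beta> - 19 * r" by simp
          ultimately show ?thesis unfolding r(3) by metis
        qed
        have "exp (- (2 * \<alpha>\<^sup>2 * \<beta> + 8 * \<epsilon>) * L - 4 * sqrt L - 2) \<le> measure M {\<omega>\<in>space M. a \<le> X y \<omega>}"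
          unfolding a_def using s be r by (intro high_prob_lower[OF g lc L yA al]) (auto simp: \<epsilon>_def)
        also have "\<dots> \<le> measure M (Ev y \<union> (\<Union>k\<in>{1..<K}. T k))"
        proof (rule M.finite_measure_mono)
          show "{\<omega>\<in>space M. a \<le> X y \<omega>} \<subseteq> Ev y \<union> (\<Union>k\<in>{1..<K}. T k)"
            by (force simp: Ev_def T_def)
          show "Ev y \<union> (\<Union>k\<in>{1..<K}. T k) \<in> sets M" using Tm Evm[OF y] by auto
        qed
        also have "\<dots> \<le> measure M (Ev y) + measure M (\<Union>k\<in>{1..<K}. T k)"
          using Tm Evm[OF y] by (intro measure_Un_le) auto
        also have "measure M (\<Union>k\<in>{1..<K}. T k) \<le> (\<Sum>k\<in>{1..<K}. measure M (T k))"
          using Tm by (intro measure_UNION_le) auto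
        also have "\<dots> \<le> (\<Sum>k\<in>{1..<K}. exp ((- 2 * \<alpha>\<^sup>2 * \<beta> - 19 * r) * L))"
          by (rule sum_mono[OF PT])
        also have "\<dots> \<le> exp (14 * r * L) * exp ((- 2 * \<alpha>\<^sup>2 * \<beta> - 19 * r) * L)"
          using lnK(1) by (auto intro!: mult_right_mono)
        also have "\<dots> = exp (- (2 * \<alpha>\<^sup>2 * \<beta> + 5 * r) * L)"
          by (simp add: exp_add[symmetric] algebra_simps)
        finally have 1: "exp (- (2 * \<alpha>\<^sup>2 * \<beta> + 8 * \<epsilon>) * L - 4 * sqrt L - 2) \<le> measure M (Ev y) + exp (- (2 * \<alpha>\<^sup>2 * \<beta> + 5 * r) * L)"
          by simp
        \<comment> \<open>The \<open>ln 2\<close> in \<open>A3\<close> makes the probability of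
          being high at least twice the bound for the discarded part, so at least that bound
          survives the truncation.\<close>
        have "2 * exp (- (2 * \<alpha>\<^sup>2 * \<beta> + 5 * r) * L) = exp (ln 2 - (2 * \<alpha>\<^sup>2 * \<beta> + 5 * r) * L)"
        proof -
          have "2 * exp (- u) = exp (ln 2 - u)" for u :: real
            by (simp add: exp_diff exp_minus divide_inverse)
          then show ?thesis unfolding minus_mult_left[symmetric] .
        qed
        also have "\<dots> \<le> exp (- (2 * \<alpha>\<^sup>2 * \<beta> + 8 * \<epsilon>) * L - 4 * sqrt L - 2)"
          using A3 by (simp add: \<epsilon>_def algebra_simps)
        finally show ?thesis using 1 by linarith
      qed
      define e where "e = 8 * (\<beta> / real K) + 36 * r + 4 * s"
      define Q where "Q = 25 * real K * exp (((e - 2 * \<alpha>\<^sup>2 * \<beta>) + 2 * \<beta> * (1 - \<alpha>\<^sup>2)) * L)"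
      have PEE: "(\<Sum>z\<in>B. measure M (Ev y \<inter> Ev z)) \<le> Q" if y: "y \<in> B" for y
        unfolding Q_def
      proof (rule sum_over_scales[where y=y])
        show "finite B" "K \<ge> 1" "0 \<le> \<beta>" "\<alpha>\<^sup>2 \<le> 1" "0 \<le> L"
          using K be al2 L by (auto simp: B_def)
        fix z assume z: "z \<in> B"
        have yA: "y \<in> A" and zA: "z \<in> A" using y z BA by auto
        have "\<bar>fst y - fst z\<bar> \<le> int R" "\<bar>snd y - snd z\<bar> \<le> int R"
          using y z by (auto simp: B_def rect_def)
        then have "\<bar>real_of_int (fst y - fst z)\<bar> \<le> real R" "\<bar>real_of_int (snd y - snd z)\<bar> \<le> real R" by linarith+
        then have "(real_of_int (fst y - fst z))\<^sup>2 \<le> (real R)\<^sup>2" "(real_of_int (snd y - snd z))\<^sup>2 \<le> (real R)\<^sup>2"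
          by (simp_all add: abs_le_square_iff[symmetric])
        moreover have "(2 * real R)\<^sup>2 = 4 * (real R)\<^sup>2" "0 \<le> (real R)\<^sup>2" by (simp_all add: power_mult_distrib)
        ultimately have "(edist y z)\<^sup>2 \<le> (2 * real R)\<^sup>2" unfolding edist_sq by linarith
        then have "edist y z \<le> 2 * real R" by (rule power2_le_imp_le) simp
        then have "edist y z \<le> 1 * exp (\<beta> * L)" using R(1) unfolding E_def by linarith
        then show "logd y z \<le> \<beta> * L + ln 2" using logd_le_scale[of 1 y z \<beta> L] be L by simp
        fix k assume k: "k \<in> {1..K}" and d1: "(\<beta> * real k / real K - \<beta> / real K) * L \<le> logd y z"
          and d2: "logd y z \<le> \<beta> * real k / real K * L + ln 2"
        have near: "edist y z \<le> 2 * exp (gm k * L)"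
        proof -
          have "exp (logd y z) \<le> exp (gm k * L + ln 2)" using d2 by (simp add: gm_def)
          then show ?thesis using edist_le_exp_logd[of y z] by (simp add: exp_add)
        qed
        \<comment> \<open>The pair is tested against the average around \<open>y\<close> at the
          scale of their own distance, so only one of the truncations in \<open>Ev y\<close> is used
          for each class.\<close>
        have "measure M (Ev y \<inter> Ev z) \<le> exp ((- 2 * \<alpha>\<^sup>2 * (\<beta> + gm k) + 8 * (\<beta> / real K) + 36 * r + 4 * s) * L)"
        proof (cases "k < K")
          case True
          then have k': "k \<in> {1..<K}" using k by auto
          have nyy: "edist y y \<le> 2 * exp (gm k * L)" by (simp add: edist_def)
          show ?thesis
            using L s d1 be by (intro high_pair_prob[OF g lc _ yA zA al eps _ _ avgs(1)[OF y k'] avgs(3)[OF y k' yA nyy] avgs(3)[OF y k' zA near]])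
              (use k' in \<open>auto simp: Ev_def a_def t_def gm_def\<close>)
        next
          \<comment> \<open>At the top scale \<open>\<kappa> - \<gamma> = 0\<close>, so the zero
            vector serves as average and all its covariance requirements hold within
            \<open>r * L\<close>.\<close>
          case False
          then have kK: "gm k = \<beta>" using k K by (simp add: gm_def)
          have d1': "(\<beta> - \<beta> / real K) * L \<le> logd y z" using d1 unfolding kK[unfolded gm_def] .
          have b0: "bform A C (\<lambda>_. 0) (\<lambda>_. 0) = 0" "bform A C c (\<lambda>_. 0) = 0" for c by (simp_all add: bform_def)
          show ?thesis
            using L s d1' be r by (intro high_pair_prob[OF g lc _ yA zA al eps, where h="\<lambda>_. 0"])
              (auto simp: Ev_def a_def kK b0 gm_def[symmetric])
        qed
        also have "(- 2 * \<alpha>\<^sup>2 * (\<beta> + gm k) + 8 * (\<beta> / real K) + 36 * r + 4 * s) = (e - 2 * \<alpha>\<^sup>2 * \<beta>) - 2 * \<alpha>\<^sup>2 * (\<beta> * real k / real K)"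
          by (simp add: e_def gm_def algebra_simps)
        finally show "measure M (Ev y \<inter> Ev z) \<le> exp (((e - 2 * \<alpha>\<^sup>2 * \<beta>) - 2 * \<alpha>\<^sup>2 * (\<beta> * real k / real K)) * L)" .
      qed
      have cB: "real (card B) = (real R)\<^sup>2" by (simp add: B_def card_rect power2_eq_square)
      have cB1: "exp (2 * \<beta> * L) / 1024 \<le> real (card B)"
      proof -
        have "(E / 32)\<^sup>2 \<le> (real R)\<^sup>2" using R E32 by (intro power_mono) auto
        then show ?thesis unfolding cB E_def by (simp add: power_divide exp_double[symmetric] mult.assoc)
      qed
      define m1 where "m1 = (\<Sum>y\<in>B. measure M (Ev y))"
      have m1: "real (card B) * exp (- (2 * \<alpha>\<^sup>2 * \<beta> + 5 * r) * L) \<le> m1"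
        unfolding m1_def using sum_mono[OF PE, of B] by simp
      have cBp: "real (card B) > 0" using cB1 by (smt (verit) exp_gt_zero divide_pos_pos)
      have m1p: "m1 > 0" using m1 cBp by (smt (verit) exp_gt_zero mult_pos_pos)
      define m2 where "m2 = real (card B) * Q"
      have m2: "(\<Sum>y\<in>B. \<Sum>z\<in>B. measure M (Ev y \<inter> Ev z)) \<le> m2"
        unfolding m2_def using sum_mono[OF PEE, of B] by simp
      have pz: "m1\<^sup>2 / (4 * m2) \<le> measure M {\<omega>\<in>space M. m1 / 2 \<le> real (card {y\<in>B. \<omega> \<in> Ev y})}"
        by (rule paley_zygmund_count[OF M.prob_space_axioms _ Evm m1_def m1p m2]) (simp add: B_def)
      have Qp: "Q > 0" using K by (simp add: Q_def)
      \<comment> \<open>The budget: \<open>\<zeta> / 4\<close> for scales,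
        \<open>46 * r + 4 * s\<close> with \<open>r <= s / 100\<close> and
        \<open>s <= \<zeta> / 10\<close>, and \<open>3 * \<zeta> / 10\<close> for numerical
        constants.\<close>
      have tot: "e + 10 * r + 3 / 10 * \<zeta> \<le> \<zeta>"
        using theta r(2) s(1,3) ze unfolding e_def by linarith
      have "exp (- \<zeta> * L) \<le> m1\<^sup>2 / (4 * m2)"
      proof -
        have "(real (card B) * exp (- (2 * \<alpha>\<^sup>2 * \<beta> + 5 * r) * L))\<^sup>2 \<le> m1\<^sup>2"
          using m1 by (intro power_mono) auto
        then have "(real (card B) * exp (- (2 * \<alpha>\<^sup>2 * \<beta> + 5 * r) * L))\<^sup>2 / (4 * m2) \<le> m1\<^sup>2 / (4 * m2)"
          using Qp by (intro divide_right_mono) (auto simp: m2_def)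
        moreover have "(real (card B) * exp (- (2 * \<alpha>\<^sup>2 * \<beta> + 5 * r) * L))\<^sup>2 / (4 * m2)
            = real (card B) * (exp (- (4 * \<alpha>\<^sup>2 * \<beta> + 10 * r) * L) / (4 * Q))"
          using cBp Qp by (simp add: m2_def power2_eq_square exp_add[symmetric] field_simps)
        moreover have "exp (2 * \<beta> * L) / 1024 * (exp (- (4 * \<alpha>\<^sup>2 * \<beta> + 10 * r) * L) / (4 * Q))
            \<le> real (card B) * (exp (- (4 * \<alpha>\<^sup>2 * \<beta> + 10 * r) * L) / (4 * Q))"
          using Qp by (intro mult_right_mono cB1) auto
        moreover have "exp (2 * \<beta> * L) / 1024 * (exp (- (4 * \<alpha>\<^sup>2 * \<beta> + 10 * r) * L) / (4 * Q))
            = exp (- (e + 10 * r) * L) / (102400 * real K)"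
        proof -
          have q: "exp (2 * \<beta> * L) * exp (- (4 * \<alpha>\<^sup>2 * \<beta> + 10 * r) * L) = exp (- (e + 10 * r) * L) * exp (((e - 2 * \<alpha>\<^sup>2 * \<beta>) + 2 * \<beta> * (1 - \<alpha>\<^sup>2)) * L)"
            by (simp add: exp_add[symmetric] algebra_simps)
          have "x / 1024 * (y' / (4 * (25 * k * w))) = v / (102400 * k)" if "x * y' = v * w" "w > 0" "k > 0" for x y' v w k :: real
            using that by (simp add: field_simps)
          from this[OF q exp_gt_zero, of "real K"] show ?thesis using K unfolding Q_def by simp
        qed
        moreover have "exp (- \<zeta> * L) \<le> exp (- (e + 10 * r) * L) / (102400 * real K)"
        proof -
          have "exp (- \<zeta> * L) * (102400 * real K) \<le> exp (- \<zeta> * L) * exp (3 / 10 * \<zeta> * L)"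
            by (intro mult_left_mono lnK) simp
          also have "\<dots> = exp (- (\<zeta> - 3 / 10 * \<zeta>) * L)" by (simp add: exp_add[symmetric] algebra_simps)
          also have "\<dots> \<le> exp (- (e + 10 * r) * L)"
            unfolding exp_le_cancel_iff minus_mult_left[symmetric] neg_le_iff_le
            using tot L by (intro mult_right_mono) auto
          finally show ?thesis using K by (simp add: pos_le_divide_eq)
        qed
        ultimately show ?thesis by linarith
      qed
      moreover have low: "exp ((2 * \<beta> * (1 - \<alpha>\<^sup>2) - \<zeta>) * L) \<le> m1 / 2"
      proof -
        have "exp ((2 * \<beta> * (1 - \<alpha>\<^sup>2) - \<zeta>) * L) * 2048 \<le> exp ((2 * \<beta> * (1 - \<alpha>\<^sup>2) - \<zeta>) * L) * exp (3 / 10 * \<zeta> * L)"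
          using lnK(2) K by (intro mult_left_mono) auto
        also have "\<dots> = exp ((2 * \<beta> * (1 - \<alpha>\<^sup>2) - \<zeta> + 3 / 10 * \<zeta>) * L)" by (simp add: exp_add[symmetric] algebra_simps)
        also have "\<dots> \<le> exp ((2 * \<beta> * (1 - \<alpha>\<^sup>2) - 5 * r) * L)"
          using L ze r(1,2) s(1,3) by (auto intro!: mult_right_mono)
        also have "\<dots> = exp (2 * \<beta> * L) * exp (- (2 * \<alpha>\<^sup>2 * \<beta> + 5 * r) * L)"
          by (simp add: exp_add[symmetric] algebra_simps)
        finally have "exp ((2 * \<beta> * (1 - \<alpha>\<^sup>2) - \<zeta>) * L) * 2 \<le> exp (2 * \<beta> * L) / 1024 * exp (- (2 * \<alpha>\<^sup>2 * \<beta> + 5 * r) * L)"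
          by simp
        also have "\<dots> \<le> real (card B) * exp (- (2 * \<alpha>\<^sup>2 * \<beta> + 5 * r) * L)"
          by (intro mult_right_mono cB1) simp
        finally show ?thesis using m1 by linarith
      qed
      moreover have "measure M {\<omega>\<in>space M. m1 / 2 \<le> real (card {y\<in>B. \<omega> \<in> Ev y})}
          \<le> measure M {\<omega>\<in>space M. exp ((2 * \<beta> * (1 - \<alpha>\<^sup>2) - \<zeta>) * L) \<le> real (card {y\<in>B. a \<le> X y \<omega>})}"
      proof (rule M.finite_measure_mono)
        show "{\<omega>\<in>space M. m1 / 2 \<le> real (card {y\<in>B. \<omega> \<in> Ev y})} \<subseteq> {\<omega>\<in>space M. exp ((2 * \<beta> * (1 - \<alpha>\<^sup>2) - \<zeta>) * L) \<le> real (card {y\<in>B. a \<le> X y \<omega>})}"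
        proof safe
          fix \<omega> assume "m1 / 2 \<le> real (card {y\<in>B. \<omega> \<in> Ev y})"
          also have "\<dots> \<le> real (card {y\<in>B. a \<le> X y \<omega>})"
            unfolding of_nat_le_iff by (intro card_mono) (auto simp: Ev_def B_def)
          finally show "exp ((2 * \<beta> * (1 - \<alpha>\<^sup>2) - \<zeta>) * L) \<le> real (card {y\<in>B. a \<le> X y \<omega>})" using low by linarith
        qed
        have "(\<lambda>\<omega>. \<Sum>y\<in>B. indicator {a..} (X y \<omega>) :: real) \<in> borel_measurable M"
          using Xm by (intro borel_measurable_sum) auto
        moreover have "real (card {y\<in>B. a \<le> X y \<omega>}) = (\<Sum>y\<in>B. indicator {a..} (X y \<omega>))" for \<omega>
          by (simp add: indicator_def sum.If_cases Int_def B_def)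
        ultimately show "{\<omega>\<in>space M. exp ((2 * \<beta> * (1 - \<alpha>\<^sup>2) - \<zeta>) * L) \<le> real (card {y\<in>B. a \<le> X y \<omega>})} \<in> sets M"
          by simp
      qed
      ultimately show "exp (- \<zeta> * L) \<le> measure M {\<omega>\<in>space M. exp ((2 * \<beta> * (1 - \<alpha>\<^sup>2) - \<zeta>) * L)
          \<le> real (card {y\<in>rect x0 R R. 2 * sqrt gconst * \<alpha> * \<beta> * L \<le> X y \<omega>})}"
        using pz unfolding B_def a_def by linarith
    qed
  qed
  then show ?thesis using r by (intro exI[of _ \<epsilon>]) (auto simp: \<epsilon>_def)
qed

lemma gaussian_family_subset:
  assumes g: "gaussian_family M I X C" and J: "J \<subseteq> I"
  shows "gaussian_family M J X C"
proof -
  have fI: "finite I" by (rule gaussian_familyD(2)[OF g])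
  have fJ: "finite J" by (rule finite_subset[OF J fI])
  have e: "(\<Sum>i\<in>I. unitv j i * X i \<omega>) = X j \<omega>" "bform I C (unitv j) (unitv k) = C j k" if "j \<in> J" "k \<in> J" for j k \<omega>
    using that J fI by (auto simp: sum_unitv intro!: bform_unitv)
  have "(CLINT \<omega>|M. iexp (\<Sum>j\<in>J. c j * X j \<omega>)) = complex_of_real (exp (- bform J C c c / 2))" for c
  proof -
    have "(\<Sum>j\<in>J. c j * (\<Sum>i\<in>I. unitv j i * X i \<omega>)) = (\<Sum>j\<in>J. c j * X j \<omega>)" for \<omega>
      by (intro sum.cong refl) (simp add: e)
    moreover have "bform J (\<lambda>j k. bform I C (unitv j) (unitv k)) c c = bform J C c c"
      unfolding bform_def[of J] by (intro sum.cong refl) (simp add: e)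
    ultimately show ?thesis
      using gaussian_familyD(6)[OF gaussian_linear_image[OF g fJ, of unitv], of c] by simp
  qed
  then show ?thesis
    using gaussian_familyD(1,3,4)[OF g] fJ subsetD[OF J] unfolding gaussian_family_def by blast
qed

lemma log_cov_mono: "log_cov A C \<kappa> L \<epsilon> \<Longrightarrow> \<epsilon> \<le> \<epsilon>' \<Longrightarrow> 0 \<le> L \<Longrightarrow> log_cov A C \<kappa> L \<epsilon>'"
  unfolding log_cov_def by (meson mult_right_mono order_trans)

text \<open>Concentration fails with probability at most \<open>N powr (- c)\<close>, with \<open>c\<close> independent of \<open>\<zeta>\<close>; this upgrades
  the weak second moment bound.\<close>

lemma core_high_count:
  fixes \<alpha> \<beta> \<eta> \<tau> :: real
  assumes al: "0 < \<alpha>" "\<alpha> < 1" and be: "0 < \<beta>" "\<beta> \<le> 1" and et: "0 < \<eta>" and ta: "0 < \<tau>"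
  shows "\<exists>\<epsilon>>0. \<forall>\<^sub>F N in sequentially. \<forall>(M :: 'a measure) X C x0.
    gaussian_family M (rect x0 (2 * blk N \<beta>) (blk N \<beta>)) X C \<longrightarrow>
    log_cov (rect x0 (2 * blk N \<beta>) (blk N \<beta>)) C \<beta> (ln (real N)) \<epsilon> \<longrightarrow>
    measure M {\<omega>\<in>space M. real (card {y\<in>rect x0 (blk N \<beta>) (blk N \<beta>). (2 * sqrt gconst * \<alpha> * \<beta> - \<eta>) * ln (real N) \<le> X y \<omega>})
       \<le> exp ((2 * \<beta> * (1 - \<alpha>\<^sup>2) - \<eta>) * ln (real N))} \<le> \<tau>"
    (is "\<exists>\<epsilon>>0. \<forall>\<^sub>F N in sequentially. ?P \<epsilon> N")
proof -
  \<comment> \<open>\<open>\<theta> * \<eta> = 2 + \<eta>\<close> makes all points far below the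
    level contribute at most \<open>N powr (- \<eta>)\<close>, as there are at most
    \<open>N^2\<close> of them. \<open>\<kappa>\<close> makes the quadratic term of the
    concentration bound, with variances up to \<open>2 * L\<close>, at most half of the linear term;
    \<open>\<zeta>\<close> then loses at most half of what remains.\<close>
  define \<theta> where "\<theta> = (2 + \<eta>) / \<eta>"
  define \<rho> where "\<rho> = \<eta> / 4"
  define \<kappa> where "\<kappa> = \<rho> / (8 * \<theta>\<^sup>2)"
  define \<zeta> where "\<zeta> = min (\<eta> / 4) (\<kappa> * \<rho> / 4)"
  have th: "\<theta> > 0" "\<theta> * \<eta> = 2 + \<eta>" using et by (auto simp: \<theta>_def)
  have rh: "\<rho> > 0" and ka: "\<kappa> > 0" using et th by (auto simp: \<rho>_def \<kappa>_def)
  have ze: "\<zeta> > 0" "\<zeta> \<le> \<eta> / 4" "\<zeta> \<le> \<kappa> * \<rho> / 4" using et rh ka by (auto simp: \<zeta>_def)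
  obtain \<epsilon>0 where e0: "\<epsilon>0 > 0" and sm: "\<forall>\<^sub>F N in sequentially. \<forall>(M :: 'a measure) X C x0.
    gaussian_family M (rect x0 (2 * blk N \<beta>) (blk N \<beta>)) X C \<longrightarrow>
    log_cov (rect x0 (2 * blk N \<beta>) (blk N \<beta>)) C \<beta> (ln (real N)) \<epsilon>0 \<longrightarrow>
    exp (- \<zeta> * ln (real N)) \<le> measure M {\<omega>\<in>space M. exp ((2 * \<beta> * (1 - \<alpha>\<^sup>2) - \<zeta>) * ln (real N))
        \<le> real (card {y\<in>rect x0 (blk N \<beta>) (blk N \<beta>). 2 * sqrt gconst * \<alpha> * \<beta> * ln (real N) \<le> X y \<omega>})}"
    using core_second_moment[OF al be ze(1)] by blast
  define \<epsilon> where "\<epsilon> = min \<epsilon>0 1"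
  have ep: "\<epsilon> > 0" "\<epsilon> \<le> \<epsilon>0" "\<epsilon> \<le> 1" using e0 by (auto simp: \<epsilon>_def)
  have pos: "0 < \<eta> / 2" "0 < \<kappa> * \<rho> / 4" using et ka rh by auto
  have "\<forall>\<^sub>F N in sequentially. ?P \<epsilon> N"
    using sm eventually_ge_at_top[of 2] eventually_ln_ge[OF pos(1), of "ln 4"] eventually_ln_ge[OF be(1), of "ln 32"]
      eventually_ln_ge[OF pos(2), of "- ln \<tau>"]
  proof eventually_elim
    case (elim N)
    define L where "L = ln (real N)"
    define R where "R = blk N \<beta>"
    have L: "L > 0" using elim(2) by (simp add: L_def)
    have A2: "ln 4 \<le> \<eta> / 2 * L" and A3: "ln 32 \<le> \<beta> * L" and A4: "- ln \<tau> \<le> \<kappa> * \<rho> / 4 * L"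
      using elim(3-) by (simp_all add: L_def)
    have E: "32 \<le> exp (\<beta> * L)"
    proof -
      have "exp (ln 32) \<le> exp (\<beta> * L)" using A3 by (simp only: exp_le_cancel_iff)
      then show ?thesis by simp
    qed
    have R: "real R \<le> exp (\<beta> * L)" "R \<ge> 1"
      using E unfolding R_def blk_def L_def by linarith+
    show ?case
      unfolding L_def[symmetric] R_def[symmetric]
    proof (intro allI impI)
      fix M :: "'a measure" and X C x0
      assume g: "gaussian_family M (rect x0 (2 * R) R) X C" and lc: "log_cov (rect x0 (2 * R) R) C \<beta> L \<epsilon>"
      define B where "B = rect x0 R R"
      have BA: "B \<subseteq> rect x0 (2 * R) R" by (auto simp: B_def rect_def)
      have gB: "gaussian_family M B X C" by (rule gaussian_family_subset[OF g BA])
      have "B \<noteq> {}" using R(2) by (auto simp: B_def rect_def)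
      define a where "a = 2 * sqrt gconst * \<alpha> * \<beta> * L"
      define D where "D = 2 * \<beta> * (1 - \<alpha>\<^sup>2)"
      have D0: "D \<ge> 0" using be al by (simp add: D_def power_le_one)
      define k where "k = exp ((D - \<zeta>) * L)"
      define n where "n = exp ((D - \<eta>) * L)"
      have Cle: "C y z \<le> 2 * L" if "y \<in> B" "z \<in> B" for y z
      proof -
        have "C y z \<le> gconst * (\<beta> * L - logd y z) + \<epsilon> * L"
          using log_covD(1)[OF lc] that BA by blast
        also have "gconst * (\<beta> * L - logd y z) \<le> gconst * (\<beta> * L)"
          using gconst_bounds logd_nonneg[of y z] by (intro mult_left_mono) auto
        also have "\<dots> \<le> 1 * (1 * L)" using gconst_bounds be L by (intro mult_mono) auto
        also have "\<epsilon> * L \<le> 1 * L" using ep L by (intro mult_right_mono) auto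
        finally show ?thesis by simp
      qed
      have p1: "exp (- \<zeta> * L) \<le> measure M {\<omega>\<in>space M. k \<le> real (card {y\<in>B. a \<le> X y \<omega>})}"
        using elim(1)[unfolded L_def[symmetric] R_def[symmetric], rule_format, OF g log_cov_mono[OF lc ep(2) less_imp_le[OF L]]]
        unfolding k_def D_def a_def B_def .
      have small: "n + real (card B) * exp (- (\<theta> * (\<eta> * L))) \<le> k / 2 * exp (- (\<rho> * L))"
      proof -
        have four: "4 * exp ((D - \<eta>) * L) \<le> exp ((D - \<eta> / 2) * L)"
        proof -
          have "4 * exp ((D - \<eta>) * L) = exp (ln 4 + (D - \<eta>) * L)" by (simp add: exp_add)
          also have "\<dots> \<le> exp ((D - \<eta> / 2) * L)" using A2 by (simp add: algebra_simps)
          finally show ?thesis .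
        qed
        have "real (card B) = (real R)\<^sup>2" by (simp add: B_def card_rect power2_eq_square)
        also have "\<dots> \<le> (exp (\<beta> * L))\<^sup>2" using R by (intro power_mono) auto
        also have "\<dots> = exp (2 * (\<beta> * L))" by (simp add: exp_double)
        also have "\<dots> \<le> exp (2 * L)" using be L by (simp add: mult_le_cancel_right1)
        finally have "real (card B) * exp (- (\<theta> * (\<eta> * L))) \<le> exp (2 * L) * exp (- (\<theta> * (\<eta> * L)))"
          by (intro mult_right_mono) auto
        also have "\<dots> = exp (- \<eta> * L)"
        proof -
          have "\<theta> * (\<eta> * L) = (2 + \<eta>) * L" using th(2) by (simp add: mult.assoc[symmetric])
          then show ?thesis by (simp add: exp_add[symmetric] algebra_simps)
        qed
        also have "\<dots> \<le> exp ((D - \<eta>) * L)" using mult_nonneg_nonneg[of D L] D0 L by (simp add: left_diff_distrib)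
        finally have "n + real (card B) * exp (- (\<theta> * (\<eta> * L))) \<le> 2 * exp ((D - \<eta>) * L)"
          by (simp add: n_def)
        also have "\<dots> \<le> exp ((D - \<eta> / 2) * L) / 2" using four by simp
        also have "\<dots> \<le> exp ((D - \<zeta> - \<rho>) * L) / 2"
          using ze(2) L by (simp add: \<rho>_def mult_right_mono)
        also have "\<dots> = k / 2 * exp (- (\<rho> * L))" by (simp add: k_def exp_add[symmetric] algebra_simps)
        finally show ?thesis .
      qed
      define p where "p = measure M {\<omega>\<in>space M. real (card {y\<in>B. a - \<eta> * L \<le> X y \<omega>}) \<le> n}"
      have p0: "p \<ge> 0" by (simp add: p_def)
      have "p * exp (- \<zeta> * L) \<le> p * measure M {\<omega>\<in>space M. k \<le> real (card {y\<in>B. a \<le> X y \<omega>})}"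
        by (intro mult_left_mono p1 p0)
      also have "\<dots> \<le> exp ((pi / 2 * \<kappa> * \<theta>)\<^sup>2 * (2 * L) / 2 - \<kappa> * (\<rho> * L))"
        unfolding p_def
        by (rule high_count_boost[OF gB \<open>B \<noteq> {}\<close> _ _ Cle _ _ small]) (use th ka L in \<open>auto simp: k_def n_def\<close>)
      also have "\<dots> \<le> exp (- (\<kappa> * \<rho> / 2) * L)"
      proof -
        have "(pi / 2 * \<kappa> * \<theta>)\<^sup>2 \<le> (2 * \<kappa> * \<theta>)\<^sup>2"
          using pi_less_4 ka th by (intro power_mono mult_right_mono) auto
        also have "\<dots> = \<kappa> * (4 * \<kappa> * \<theta>\<^sup>2)" by (simp add: power2_eq_square)
        also have "4 * \<kappa> * \<theta>\<^sup>2 = \<rho> / 2" using th by (simp add: \<kappa>_def)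
        finally have "(pi / 2 * \<kappa> * \<theta>)\<^sup>2 * L \<le> \<kappa> * (\<rho> / 2) * L" using L by (intro mult_right_mono) auto
        then show ?thesis by simp
      qed
      finally have "p * exp (- \<zeta> * L) * exp (\<zeta> * L) \<le> exp (- (\<kappa> * \<rho> / 2) * L) * exp (\<zeta> * L)"
        by (intro mult_right_mono) auto
      then have "p \<le> exp (- (\<kappa> * \<rho> / 2) * L + \<zeta> * L)"
        by (simp add: mult.assoc exp_add[symmetric])
      also have "\<dots> \<le> exp (- (\<kappa> * \<rho> / 4 * L))"
      proof -
        have "\<zeta> * L \<le> \<kappa> * \<rho> / 4 * L" using ze(3) L by (intro mult_right_mono) auto
        then show ?thesis by simp
      qed
      also have "\<dots> \<le> exp (ln \<tau>)" using A4 by (simp only: exp_le_cancel_iff)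
      also have "\<dots> = \<tau>" using ta by simp
      finally show "measure M {\<omega>\<in>space M. real (card {y\<in>rect x0 R R. (2 * sqrt gconst * \<alpha> * \<beta> - \<eta>) * L \<le> X y \<omega>})
          \<le> exp ((2 * \<beta> * (1 - \<alpha>\<^sup>2) - \<eta>) * L)} \<le> \<tau>"
        unfolding p_def a_def n_def D_def B_def left_diff_distrib .
    qed
  qed
  then show ?thesis using ep(1) by blast
qed

section \<open>The free field as a Gaussian family, and its bulk region\<close>

lemma GFF_gaussian_family:
  assumes "is_GFF M N \<Phi>"
  shows "gaussian_family M (intr N) \<Phi> (green N)"
proof -
  have m: "\<Phi> x \<in> borel_measurable M" if "x \<in> intr N" for x
    using assms that intr_subset_box unfolding is_GFF_def by blast
  have "(CLINT \<omega>|M. iexp (\<Sum>i\<in>intr N. c i * \<Phi> i \<omega>)) = complex_of_real (exp (- bform (intr N) (green N) c c / 2))" for c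
  proof -
    have lm: "(\<lambda>\<omega>. \<Sum>i\<in>intr N. c i * \<Phi> i \<omega>) \<in> borel_measurable M"
      using m by (intro borel_measurable_sum borel_measurable_times) auto
    have "char (distr M borel (\<lambda>\<omega>. \<Sum>x\<in>intr N. c x * \<Phi> x \<omega>)) 1 = complex_of_real (exp (- (1\<^sup>2 * bform (intr N) (green N) c c) / 2))"
      using assms unfolding is_GFF_def bform_def by blast
    moreover have "char (distr M borel (\<lambda>\<omega>. \<Sum>x\<in>intr N. c x * \<Phi> x \<omega>)) 1 = (CLINT \<omega>|M. iexp (1 * (\<Sum>i\<in>intr N. c i * \<Phi> i \<omega>)))"
      unfolding char_def by (rule integral_distr[OF lm]) simp
    ultimately show ?thesis by simp
  qed
  then show ?thesis
    using assms m green_sym unfolding gaussian_family_def is_GFF_def by auto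
qed

text \<open>The distance to the complement is realised along one of the four axis directions, at the
  coordinates 0 and \<open>N + 1\<close>; hence the 1 in the upper bounds.\<close>

lemma VNl_iff:
  assumes "l \<ge> 0"
  shows "x \<in> VNl N l \<longleftrightarrow> x \<in> box N \<and> l * real N \<le> real_of_int (fst x) \<and> real_of_int (fst x) \<le> real N + 1 - l * real N
     \<and> l * real N \<le> real_of_int (snd x) \<and> real_of_int (snd x) \<le> real N + 1 - l * real N"
proof -
  let ?S = "{edist x y | y. y \<notin> box N}"
  have bd: "bdd_below ?S" by (rule bdd_belowI[of _ 0]) (auto simp: edist_nonneg)
  have ge: "\<bar>real_of_int (fst x - fst y)\<bar> \<le> edist x y" "\<bar>real_of_int (snd x - snd y)\<bar> \<le> edist x y" for y
    unfolding edist_def by (rule real_le_rsqrt, simp)+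
  have out: "(0, snd x) \<notin> box N" "(int N + 1, snd x) \<notin> box N" "(fst x, 0) \<notin> box N" "(fst x, int N + 1) \<notin> box N"
    by (auto simp: box_def)
  have dist_eq: "edist x (0, snd x) = \<bar>real_of_int (fst x)\<bar>" "edist x (int N + 1, snd x) = \<bar>real_of_int (fst x - (int N + 1))\<bar>"
     "edist x (fst x, 0) = \<bar>real_of_int (snd x)\<bar>" "edist x (fst x, int N + 1) = \<bar>real_of_int (snd x - (int N + 1))\<bar>"
    unfolding edist_def by simp_all
  show ?thesis
  proof (cases "x \<in> box N")
    case True
    have lo: "dist_compl N x \<le> edist x y" if "y \<notin> box N" for y
      unfolding dist_compl_def using that by (intro cInf_lower bd) blast
    have "l * real N \<le> dist_compl N x \<longleftrightarrow> l * real N \<le> real_of_int (fst x) \<and> real_of_int (fst x) \<le> real N + 1 - l * real N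
     \<and> l * real N \<le> real_of_int (snd x) \<and> real_of_int (snd x) \<le> real N + 1 - l * real N"
    proof
      assume a: "l * real N \<le> dist_compl N x"
      show "l * real N \<le> real_of_int (fst x) \<and> real_of_int (fst x) \<le> real N + 1 - l * real N \<and> l * real N \<le> real_of_int (snd x) \<and> real_of_int (snd x) \<le> real N + 1 - l * real N"
        using a lo[OF out(1)] lo[OF out(2)] lo[OF out(3)] lo[OF out(4)] True unfolding dist_eq
        by (auto simp: box_def abs_if split: if_splits)
    next
      assume a: "l * real N \<le> real_of_int (fst x) \<and> real_of_int (fst x) \<le> real N + 1 - l * real N \<and> l * real N \<le> real_of_int (snd x) \<and> real_of_int (snd x) \<le> real N + 1 - l * real N"
      show "l * real N \<le> dist_compl N x"
        unfolding dist_compl_def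
      proof (rule cInf_greatest)
        show "?S \<noteq> {}" using out(1) by blast
        fix d assume "d \<in> ?S"
        then obtain y where y: "y \<notin> box N" "d = edist x y" by auto
        then have "fst y \<le> 0 \<or> fst y \<ge> int N + 1 \<or> snd y \<le> 0 \<or> snd y \<ge> int N + 1" by (cases y) (auto simp: box_def)
        then have "real_of_int (fst y) \<le> 0 \<or> real_of_int (fst y) \<ge> real N + 1 \<or> real_of_int (snd y) \<le> 0 \<or> real_of_int (snd y) \<ge> real N + 1"
          by linarith
        then show "l * real N \<le> d" using ge[of y] a unfolding y(2) of_int_diff by linarith
      qed
    qed
    then show ?thesis using True by (simp add: VNl_def)
  qed (simp add: VNl_def)
qed

text \<open>Halving \<open>l\<close> leaves room for a neighbourhood of radius
  \<open>l * N / 4\<close>; a further quarter, at least 1 by assumption, absorbs the offset between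
  \<open>N + 1\<close> here and \<open>N\<close> in \<open>bulk\<close>.\<close>

lemma near_VNl_bulk:
  assumes l: "0 < l" and N: "4 \<le> l * real N" and x: "x \<in> VNl N l" and y: "edist x y \<le> l * real N / 4"
  shows "y \<in> bulk N (l / 2)"
proof -
  note x' = x[unfolded VNl_iff[OF less_imp_le[OF l]]]
  have ge: "\<bar>real_of_int (fst x - fst y)\<bar> \<le> edist x y" "\<bar>real_of_int (snd x - snd y)\<bar> \<le> edist x y"
    unfolding edist_def by (rule real_le_rsqrt, simp)+
  have *: "l / 2 * real N \<le> real_of_int (fst y)" "real_of_int (fst y) \<le> real N - l / 2 * real N" "l / 2 * real N \<le> real_of_int (snd y)" "real_of_int (snd y) \<le> real N - l / 2 * real N"
    using ge y x' N unfolding of_int_diff by linarith+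
  moreover have "l / 2 * real N \<ge> 2" using N by simp
  ultimately have "2 \<le> fst y" "fst y \<le> int N - 1" "2 \<le> snd y" "snd y \<le> int N - 1" by linarith+
  then have "y \<in> intr N" unfolding intr_eq by (cases y) auto
  with * show ?thesis by (simp add: bulk_def)
qed

section \<open>High points near a high point\<close>

lemma card_indicator_sum: "finite B \<Longrightarrow> real (card {y\<in>B. P y}) = (\<Sum>y\<in>B. if P y then 1 else 0)"
  by (simp add: sum.If_cases Int_def)

lemma count_measurable:
  assumes "finite B" "\<And>y. y \<in> B \<Longrightarrow> X y \<in> borel_measurable M"
  shows "(\<lambda>\<omega>. real (card {y\<in>B. (t::real) \<le> X y \<omega>})) \<in> borel_measurable M"
  unfolding card_indicator_sum[OF assms(1)] using assms(2)
  by (intro borel_measurable_sum measurable_If) auto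

section \<open>Upper bound for the count around a high point\<close>

lemma markov_count:
  assumes M: "prob_space M" and B: "finite B" and E [measurable]: "\<And>y. y \<in> B \<Longrightarrow> E y \<in> sets M" and v: "v > 0"
  shows "measure M {\<omega>\<in>space M. v \<le> real (card {y\<in>B. \<omega> \<in> E y})} \<le> (\<Sum>y\<in>B. measure M (E y)) / v"
proof -
  interpret M: prob_space M by fact
  let ?A = "{\<omega>\<in>space M. v \<le> real (card {y\<in>B. \<omega> \<in> E y})}"
  have c: "real (card {y\<in>B. \<omega> \<in> E y}) = (\<Sum>y\<in>B. indicator (E y) \<omega>)" for \<omega>
    by (simp add: card_indicator_sum[OF B] indicator_def of_bool_def)
  have [measurable]: "?A \<in> sets M" unfolding c by measurable
  have "v * measure M ?A = (LINT \<omega>|M. v * indicator ?A \<omega>)" by simp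
  also have "\<dots> \<le> (LINT \<omega>|M. (\<Sum>y\<in>B. indicator (E y) \<omega>))"
  proof (rule integral_mono)
    fix \<omega>
    have "0 \<le> (\<Sum>y\<in>B. indicator (E y) \<omega> :: real)" by (intro sum_nonneg) auto
    then show "v * indicator ?A \<omega> \<le> (\<Sum>y\<in>B. indicator (E y) \<omega> :: real)"
      by (auto simp: indicator_def c)
  qed (auto intro!: Bochner_Integration.integrable_sum integrable_real_indicator integrable_mult_right simp: M.emeasure_eq_measure)
  also have "\<dots> = (\<Sum>y\<in>B. measure M (E y))"
    by (subst Bochner_Integration.integral_sum) (auto simp: M.emeasure_eq_measure)
  finally show ?thesis using v by (simp add: field_simps)
qed

text \<open>Only averages around \<open>x\<close> are truncated. Atypical ones are rarer than
  \<open>x\<close> being high by a power of \<open>N\<close>; on the rest, a first moment over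
  \<open>y\<close> and Markov's inequality suffice. Both parts are measured against the lower bound
  for the probability that \<open>x\<close> is high, so no division by a small number
  occurs.\<close>

lemma upper_count:
  fixes l \<alpha> \<beta> \<delta> \<tau> :: real
  assumes l: "0 < l" and al: "0 < \<alpha>" "\<alpha> < 1" and be: "0 < \<beta>" "\<beta> < 1" and de: "0 < \<delta>" and ta: "0 < \<tau>"
  shows "\<exists>\<epsilon>>0. \<forall>\<^sub>F N in sequentially. \<forall>(M :: 'a measure) X C. \<forall>x\<in>VNl N l.
    gaussian_family M (bulk N (l / 2)) X C \<longrightarrow> log_cov (bulk N (l / 2)) C 1 (ln (real N)) \<epsilon> \<longrightarrow>
    measure M {\<omega>\<in>space M. 2 * sqrt gconst * \<alpha> * ln (real N) \<le> X x \<omega> \<and>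
        exp ((2 * \<beta> * (1 - \<alpha>\<^sup>2) + \<delta>) * ln (real N))
          \<le> real (card {y\<in>{y\<in>VNl N l. edist x y \<le> exp (\<beta> * ln (real N))}. 2 * sqrt gconst * \<alpha> * ln (real N) \<le> X y \<omega>})}
     \<le> \<tau> * measure M {\<omega>\<in>space M. 2 * sqrt gconst * \<alpha> * ln (real N) \<le> X x \<omega>}"
    (is "\<exists>\<epsilon>>0. \<forall>\<^sub>F N in sequentially. ?P \<epsilon> N")
proof -
  \<comment> \<open>The same calibration as for the second moment, with \<open>\<delta>\<close> in
    the role of \<open>\<zeta>\<close>.\<close>
  define s where "s = min 1 (\<delta> / 10)"
  define r where "r = s\<^sup>2 / 100"
  define \<epsilon> where "\<epsilon> = r / 2"
  define K where "K = nat \<lceil>32 / \<delta>\<rceil> + 1"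
  define m where "m = nat \<lceil>2 / r\<rceil> + 1"
  have s: "0 < s" "s \<le> 1" "s \<le> \<delta> / 10" using de by (auto simp: s_def)
  have "s\<^sup>2 \<le> s" using s by (simp add: power2_eq_square mult_left_le)
  then have r: "0 < r" "r \<le> s / 100" "s\<^sup>2 / 4 = 25 * r" using s by (auto simp: r_def)
  have m: "m > 0" "2 / r \<le> real m" unfolding m_def by linarith+
  have K: "K \<ge> 1" "32 / \<delta> \<le> real K" unfolding K_def by linarith+
  have theta: "8 * (\<beta> / real K) \<le> \<delta> / 4"
  proof -
    have "\<beta> * 32 \<le> 1 * (\<delta> * real K)" using K be de by (intro mult_mono) (auto simp: field_simps)
    then show ?thesis using K by (simp add: field_simps)
  qed
  have al2: "\<alpha>\<^sup>2 \<le> 1" "0 \<le> \<alpha>\<^sup>2" using al by (auto simp: power_le_one)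
  have pos: "0 < r / 2" "0 < r" "0 < 14 * r" "0 < 3 / 10 * \<delta>" "0 < 1 - \<beta>"
    using r be de K by auto
  have "\<forall>\<^sub>F N in sequentially. 4 \<le> l * real N" using l by real_asymp
  then have "\<forall>\<^sub>F N in sequentially. ?P \<epsilon> N"
    using eventually_ge_at_top[of 2]
      eventually_ln_ge[OF pos(1), of "ln (8 * real m)"]
      eventually_ln_dominates[OF pos(2), of "2"]
      eventually_ln_ge[OF pos(3), of "ln (2 * real K / \<tau>)"]
      eventually_ln_ge[OF pos(4), of "ln (50 * real K / \<tau>)"]
      eventually_ln_ge[OF pos(5), of "ln (8 * real m / l)"]
  proof eventually_elim
    case (elim N)
    define L where "L = ln (real N)"
    have N: "N \<ge> 1" and L: "L > 0" using elim(2) by (auto simp: L_def)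
    have lN: "4 \<le> l * real N" by (rule elim(1))
    have A2: "ln (8 * real m) \<le> r / 2 * L" and A3: "2 + 4 * sqrt L \<le> r * L"
      and A4: "ln (2 * real K / \<tau>) \<le> 14 * r * L" and A7: "ln (50 * real K / \<tau>) \<le> 3 / 10 * \<delta> * L"
      and A8: "ln (8 * real m / l) \<le> (1 - \<beta>) * L"
      using elim(3-) by (simp_all add: L_def)
    have exps: "2 * real K / \<tau> \<le> exp (14 * r * L)" "50 * real K / \<tau> \<le> exp (3 / 10 * \<delta> * L)"
      "8 * real m / l \<le> exp ((1 - \<beta>) * L)"
    proof -
      have "exp (ln (2 * real K / \<tau>)) \<le> exp (14 * r * L)" "exp (ln (50 * real K / \<tau>)) \<le> exp (3 / 10 * \<delta> * L)"
        "exp (ln (8 * real m / l)) \<le> exp ((1 - \<beta>) * L)"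
        using A4 A7 A8 by (simp_all only: exp_le_cancel_iff)
      then show "2 * real K / \<tau> \<le> exp (14 * r * L)" "50 * real K / \<tau> \<le> exp (3 / 10 * \<delta> * L)"
        "8 * real m / l \<le> exp ((1 - \<beta>) * L)" using K m l ta by auto
    qed
    have room: "real m * (2 * exp (\<beta> * L)) \<le> l * real N / 4"
    proof -
      have "8 * real m / l * exp (\<beta> * L) \<le> exp ((1 - \<beta>) * L) * exp (\<beta> * L)"
        using exps(3) by (intro mult_right_mono) auto
      also have "\<dots> = exp L" by (simp add: exp_add[symmetric] algebra_simps)
      also have "\<dots> = real N" using N by (simp add: L_def)
      finally show ?thesis using l by (simp add: field_simps)
    qed
    show ?case
      unfolding L_def[symmetric]
    proof (intro allI ballI impI)
      fix M :: "'a measure" and X C x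
      define A where "A = bulk N (l / 2)"
      assume x: "x \<in> VNl N l" and g: "gaussian_family M (bulk N (l / 2)) X C" and lc: "log_cov (bulk N (l / 2)) C 1 L \<epsilon>"
      note g = g[folded A_def] and lc = lc[folded A_def]
      interpret M: prob_space M by (rule gaussian_familyD(1)[OF g])
      define B where "B = {y\<in>VNl N l. edist x y \<le> exp (\<beta> * L)}"
      have near: "y \<in> A" if "edist x y \<le> l * real N / 4" for y
        unfolding A_def by (rule near_VNl_bulk[OF l lN x that])
      have xA: "x \<in> A" using lN by (intro near) (simp add: edist_def)
      have BA: "B \<subseteq> A"
      proof
        fix y assume "y \<in> B"
        have "1 * exp (\<beta> * L) \<le> real m * (2 * exp (\<beta> * L))" using m by (intro mult_mono) auto
        then have "exp (\<beta> * L) \<le> l * real N / 4" using room by linarith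
        moreover have "edist x y \<le> exp (\<beta> * L)" using \<open>y \<in> B\<close> by (simp add: B_def)
        ultimately show "y \<in> A" by (intro near) linarith
      qed
      have finA: "finite A" using lc by (simp add: log_cov_def)
      then have finB: "finite B" using BA finite_subset by blast
      define a where "a = 2 * sqrt gconst * \<alpha> * L"
      define gm where "gm = (\<lambda>k. \<beta> * real k / real K)"
      define h where "h = (\<lambda>k. avg m (ring_pt x (scale N (gm k))))"
      define t where "t = (\<lambda>k. (2 * sqrt gconst * \<alpha> * (1 - gm k) + s) * L)"
      note lm [measurable] = gaussian_lin_measurable[OF g]
      have Xm: "X y \<in> borel_measurable M" if "y \<in> A" for y by (rule gaussian_familyD(3)[OF g that])
      have [measurable]: "X x \<in> borel_measurable M" by (rule Xm[OF xA])
      have gmb: "0 \<le> gm k" "gm k \<le> \<beta>" if "k \<le> K" for k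
        using that be K mult_left_mono[of "real k" "real K" \<beta>] by (auto simp: gm_def field_simps)
      \<comment> \<open>Here \<open>k = K\<close> is included: since \<open>\<beta> < 1\<close>,
        points at scale \<open>N powr \<beta>\<close> around \<open>x\<close> stay in the
        bulk.\<close>
      have ring: "ring_pt x (scale N (gm k)) j \<in> A" if k: "k \<in> {1..K}" and j: "j \<in> {1..m}" for k j
      proof (rule near)
        have "real (scale N (gm k)) \<le> 2 * exp (gm k * L)"
          using scale_bounds(2)[OF gmb(1) N, of k] k unfolding L_def by auto
        also have "\<dots> \<le> 2 * exp (\<beta> * L)" using gmb(2)[of k] k L by (auto intro: mult_right_mono)
        finally have "real j * real (scale N (gm k)) \<le> real m * (2 * exp (\<beta> * L))"
          using j by (intro mult_mono) auto
        then show "edist x (ring_pt x (scale N (gm k)) j) \<le> l * real N / 4"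
          unfolding edist_ring using room by linarith
      qed
      have avgs: "bform A C (h k) (h k) \<le> (gconst * (1 - gm k) + r) * L"
          "bform A C (unitv x) (h k) \<le> (gconst * (1 - gm k) + r) * L"
          "\<And>z. z \<in> A \<Longrightarrow> edist x z \<le> 2 * exp (gm k * L) \<Longrightarrow> (gconst * (1 - gm k) - r) * L \<le> bform A C (unitv z) (h k)"
        if k: "k \<in> {1..K}" for k
      proof -
        have kk: "0 \<le> gm k" "gm k \<le> 1" using gmb[of k] k be by auto
        note ra = ring_avg[OF kk(1) N lc[unfolded L_def] xA kk(2) order_refl m(1) ring[OF k] _ m(2) r(1) A2[unfolded L_def], folded L_def, folded h_def]
        show "bform A C (h k) (h k) \<le> (gconst * (1 - gm k) + r) * L"
          "bform A C (unitv x) (h k) \<le> (gconst * (1 - gm k) + r) * L"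
          "\<And>z. z \<in> A \<Longrightarrow> edist x z \<le> 2 * exp (gm k * L) \<Longrightarrow> (gconst * (1 - gm k) - r) * L \<le> bform A C (unitv z) (h k)"
          using ra unfolding h_def \<epsilon>_def by auto
      qed
      have eps: "\<epsilon> \<le> r" using r by (simp add: \<epsilon>_def)
      define T where "T = (\<lambda>k. {\<omega>\<in>space M. a \<le> X x \<omega> \<and> t k \<le> (\<Sum>i\<in>A. h k i * X i \<omega>)})"
      have Tm: "T k \<in> sets M" for k unfolding T_def by measurable
      have PT: "measure M (T k) \<le> exp ((- 2 * \<alpha>\<^sup>2 - 19 * r) * L)" if k: "k \<in> {1..K}" for k
      proof -
        have kk: "0 \<le> gm k" "gm k \<le> 1" using gmb[of k] k be by auto
        have "gconst * (1 - gm k) + r \<le> 1 * 1 + 1"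
          using kk be gconst_bounds r s by (intro add_mono mult_mono) auto
        then have "(gconst * (1 - gm k) + r) * L \<le> 2 * L" using L by (intro mult_right_mono) auto
        with avgs(1)[OF k] have hv: "bform A C (h k) (h k) \<le> 2 * L" by linarith
        have "measure M (T k) \<le> exp ((- 2 * \<alpha>\<^sup>2 * 1 - s\<^sup>2 / 4 + 6 * r) * L)"
          using L r s by (intro high_trunc_prob[OF g lc _ xA al eps _ hv avgs(2)[OF k]])
             (auto simp: T_def a_def t_def)
        moreover have "- 2 * \<alpha>\<^sup>2 * 1 - 25 * r + 6 * r = - 2 * \<alpha>\<^sup>2 - 19 * r" by simp
        ultimately show ?thesis unfolding r(3) by metis
      qed
      define p where "p = measure M {\<omega>\<in>space M. a \<le> X x \<omega>}"
      have p: "exp (- (2 * \<alpha>\<^sup>2 + 5 * r) * L) \<le> p"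
      proof -
        have "exp (- (2 * \<alpha>\<^sup>2 + 5 * r) * L) \<le> exp (- (2 * \<alpha>\<^sup>2 * 1 + 8 * \<epsilon>) * L - 4 * sqrt L - 2)"
          using A3 by (simp add: \<epsilon>_def algebra_simps)
        also have "\<dots> \<le> measure M {\<omega>\<in>space M. 2 * sqrt gconst * \<alpha> * 1 * L \<le> X x \<omega>}"
          using s r by (intro high_prob_lower[OF g lc L xA al]) (auto simp: \<epsilon>_def)
        finally show ?thesis by (simp add: p_def a_def)
      qed
      define F where "F = (\<lambda>y. {\<omega>\<in>space M. a \<le> X x \<omega> \<and> a \<le> X y \<omega> \<and> (\<forall>k\<in>{1..K}. (\<Sum>i\<in>A. h k i * X i \<omega>) \<le> t k)})"
      have Fm: "F y \<in> sets M" if "y \<in> B" for y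
        unfolding F_def using Xm[OF subsetD[OF BA that]] by measurable
      define e where "e = 8 * (\<beta> / real K) + 36 * r + 4 * s"
      have PF: "(\<Sum>y\<in>B. measure M (F y)) \<le> 25 * real K * exp (((e - 2 * \<alpha>\<^sup>2) + 2 * \<beta> * (1 - \<alpha>\<^sup>2)) * L)"
      proof (rule sum_over_scales[where y=x])
        show "finite B" "K \<ge> 1" "0 \<le> \<beta>" "\<alpha>\<^sup>2 \<le> 1" "0 \<le> L"
          using finB K be al2 L by auto
        fix z assume z: "z \<in> B"
        have zA: "z \<in> A" using z BA by auto
        show "logd x z \<le> \<beta> * L + ln 2"
          using z logd_le_scale[of 1 x z \<beta> L] be L unfolding B_def by simp
        fix k assume k: "k \<in> {1..K}" and d1: "(\<beta> * real k / real K - \<beta> / real K) * L \<le> logd x z"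
          and d2: "logd x z \<le> \<beta> * real k / real K * L + ln 2"
        have near: "edist x z \<le> 2 * exp (gm k * L)"
        proof -
          have "exp (logd x z) \<le> exp (gm k * L + ln 2)" using d2 by (simp add: gm_def)
          then show ?thesis using edist_le_exp_logd[of x z] by (simp add: exp_add)
        qed
        have nxx: "edist x x \<le> 2 * exp (gm k * L)" by (simp add: edist_def)
        have "measure M (F z) \<le> exp ((- 2 * \<alpha>\<^sup>2 * (1 + gm k) + 8 * (\<beta> / real K) + 36 * r + 4 * s) * L)"
          using L s d1 be by (intro high_pair_prob[OF g lc _ xA zA al eps _ _ avgs(1)[OF k] avgs(3)[OF k xA nxx] avgs(3)[OF k zA near]])
            (use k in \<open>auto simp: F_def a_def t_def gm_def\<close>)
        also have "(- 2 * \<alpha>\<^sup>2 * (1 + gm k) + 8 * (\<beta> / real K) + 36 * r + 4 * s) = (e - 2 * \<alpha>\<^sup>2) - 2 * \<alpha>\<^sup>2 * (\<beta> * real k / real K)"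
          by (simp add: e_def gm_def algebra_simps)
        finally show "measure M (F z) \<le> exp (((e - 2 * \<alpha>\<^sup>2) - 2 * \<alpha>\<^sup>2 * (\<beta> * real k / real K)) * L)" .
      qed
      define v where "v = exp ((2 * \<beta> * (1 - \<alpha>\<^sup>2) + \<delta>) * L)"
      have tot: "e + 5 * r + 3 / 10 * \<delta> \<le> \<delta>"
        using theta r(1,2) s(1,3) de unfolding e_def by linarith
      \<comment> \<open>Outside the events \<open>T k\<close> all truncations at \<open>x\<close>
        hold, and there the truncated count equals the full count.\<close>
      have "measure M {\<omega>\<in>space M. a \<le> X x \<omega> \<and> v \<le> real (card {y\<in>B. a \<le> X y \<omega>})}
          \<le> measure M ({\<omega>\<in>space M. v \<le> real (card {y\<in>B. \<omega> \<in> F y})} \<union> (\<Union>k\<in>{1..K}. T k))"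
      proof (rule M.finite_measure_mono)
        show "{\<omega>\<in>space M. v \<le> real (card {y\<in>B. \<omega> \<in> F y})} \<union> (\<Union>k\<in>{1..K}. T k) \<in> sets M"
        proof -
          have "real (card {y\<in>B. \<omega> \<in> F y}) = (\<Sum>y\<in>B. indicator (F y) \<omega>)" for \<omega>
            by (simp add: card_indicator_sum[OF finB] indicator_def of_bool_def)
          moreover have "(\<lambda>\<omega>. \<Sum>y\<in>B. indicator (F y) \<omega> :: real) \<in> borel_measurable M"
            using Fm by (intro borel_measurable_sum) auto
          ultimately show ?thesis using Tm by auto
        qed
        show "{\<omega>\<in>space M. a \<le> X x \<omega> \<and> v \<le> real (card {y\<in>B. a \<le> X y \<omega>})}
          \<subseteq> {\<omega>\<in>space M. v \<le> real (card {y\<in>B. \<omega> \<in> F y})} \<union> (\<Union>k\<in>{1..K}. T k)"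
        proof
          fix \<omega> assume w: "\<omega> \<in> {\<omega>\<in>space M. a \<le> X x \<omega> \<and> v \<le> real (card {y\<in>B. a \<le> X y \<omega>})}"
          show "\<omega> \<in> {\<omega>\<in>space M. v \<le> real (card {y\<in>B. \<omega> \<in> F y})} \<union> (\<Union>k\<in>{1..K}. T k)"
          proof (cases "\<omega> \<in> (\<Union>k\<in>{1..K}. T k)")
            case False
            then have "\<forall>k\<in>{1..K}. (\<Sum>i\<in>A. h k i * X i \<omega>) \<le> t k" using w by (fastforce simp: T_def)
            then have "{y\<in>B. \<omega> \<in> F y} = {y\<in>B. a \<le> X y \<omega>}" using w by (auto simp: F_def)
            then show ?thesis using w by simp
          qed simp
        qed
      qed
      also have "\<dots> \<le> measure M {\<omega>\<in>space M. v \<le> real (card {y\<in>B. \<omega> \<in> F y})} + measure M (\<Union>k\<in>{1..K}. T k)"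
      proof (rule measure_Un_le)
        have "real (card {y\<in>B. \<omega> \<in> F y}) = (\<Sum>y\<in>B. indicator (F y) \<omega>)" for \<omega>
          by (simp add: card_indicator_sum[OF finB] indicator_def of_bool_def)
        moreover have "(\<lambda>\<omega>. \<Sum>y\<in>B. indicator (F y) \<omega> :: real) \<in> borel_measurable M"
          using Fm by (intro borel_measurable_sum) auto
        ultimately show "{\<omega>\<in>space M. v \<le> real (card {y\<in>B. \<omega> \<in> F y})} \<in> sets M" by simp
      qed (use Tm in auto)
      also have "\<dots> \<le> \<tau> / 2 * exp (- (2 * \<alpha>\<^sup>2 + 5 * r) * L) + \<tau> / 2 * exp (- (2 * \<alpha>\<^sup>2 + 5 * r) * L)"
      proof (rule add_mono)
        have "measure M {\<omega>\<in>space M. v \<le> real (card {y\<in>B. \<omega> \<in> F y})} \<le> (\<Sum>y\<in>B. measure M (F y)) / v"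
          by (rule markov_count[OF M.prob_space_axioms finB Fm]) (simp_all add: v_def)
        also have "\<dots> \<le> 25 * real K * exp (((e - 2 * \<alpha>\<^sup>2) + 2 * \<beta> * (1 - \<alpha>\<^sup>2)) * L) / v"
          by (intro divide_right_mono PF) (simp add: v_def)
        also have "\<dots> = 25 * real K * exp ((e - 2 * \<alpha>\<^sup>2 - \<delta>) * L)"
        proof -
          have "c * exp u / exp w = c * exp (u - w)" for c u w :: real by (simp add: exp_diff)
          moreover have "((e - 2 * \<alpha>\<^sup>2) + 2 * \<beta> * (1 - \<alpha>\<^sup>2)) * L - (2 * \<beta> * (1 - \<alpha>\<^sup>2) + \<delta>) * L = (e - 2 * \<alpha>\<^sup>2 - \<delta>) * L"
            by (simp add: algebra_simps)
          ultimately show ?thesis unfolding v_def by presburger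
        qed
        also have "\<dots> \<le> \<tau> / 2 * exp (3 / 10 * \<delta> * L) * exp ((e - 2 * \<alpha>\<^sup>2 - \<delta>) * L)"
          using exps(2) ta by (intro mult_right_mono) (auto simp: field_simps)
        also have "\<dots> = \<tau> / 2 * exp ((3 / 10 * \<delta> + e - 2 * \<alpha>\<^sup>2 - \<delta>) * L)"
          by (simp add: exp_add[symmetric] algebra_simps)
        also have "\<dots> \<le> \<tau> / 2 * exp (- (2 * \<alpha>\<^sup>2 + 5 * r) * L)"
        proof -
          have "(3 / 10 * \<delta> + e - 2 * \<alpha>\<^sup>2 - \<delta>) * L \<le> - (2 * \<alpha>\<^sup>2 + 5 * r) * L"
            using tot L by (intro mult_right_mono) linarith+
          then show ?thesis using ta by simp
        qed
        finally show "measure M {\<omega>\<in>space M. v \<le> real (card {y\<in>B. \<omega> \<in> F y})} \<le> \<tau> / 2 * exp (- (2 * \<alpha>\<^sup>2 + 5 * r) * L)" .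
        have "measure M (\<Union>k\<in>{1..K}. T k) \<le> (\<Sum>k\<in>{1..K}. measure M (T k))"
          using Tm by (intro measure_UNION_le) auto
        also have "\<dots> \<le> (\<Sum>k\<in>{1..K}. exp ((- 2 * \<alpha>\<^sup>2 - 19 * r) * L))"
          by (rule sum_mono[OF PT])
        also have "\<dots> = real K * exp ((- 2 * \<alpha>\<^sup>2 - 19 * r) * L)" by simp
        also have "\<dots> \<le> \<tau> / 2 * exp (14 * r * L) * exp ((- 2 * \<alpha>\<^sup>2 - 19 * r) * L)"
          using exps(1) ta by (intro mult_right_mono) (auto simp: field_simps)
        also have "\<dots> = \<tau> / 2 * exp (- (2 * \<alpha>\<^sup>2 + 5 * r) * L)"
          by (simp add: exp_add[symmetric] algebra_simps)
        finally show "measure M (\<Union>k\<in>{1..K}. T k) \<le> \<tau> / 2 * exp (- (2 * \<alpha>\<^sup>2 + 5 * r) * L)" .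
      qed
      also have "\<dots> = \<tau> * exp (- (2 * \<alpha>\<^sup>2 + 5 * r) * L)" by simp
      also have "\<dots> \<le> \<tau> * p" using p ta by (intro mult_left_mono) auto
      finally show "measure M {\<omega>\<in>space M. 2 * sqrt gconst * \<alpha> * L \<le> X x \<omega> \<and>
          exp ((2 * \<beta> * (1 - \<alpha>\<^sup>2) + \<delta>) * L)
          \<le> real (card {y\<in>{y\<in>VNl N l. edist x y \<le> exp (\<beta> * L)}. 2 * sqrt gconst * \<alpha> * L \<le> X y \<omega>})}
        \<le> \<tau> * measure M {\<omega>\<in>space M. 2 * sqrt gconst * \<alpha> * L \<le> X x \<omega>}"
        unfolding p_def a_def v_def B_def .
    qed
  qed
  then show ?thesis using r by (intro exI[of _ \<epsilon>]) (auto simp: \<epsilon>_def)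
qed

section \<open>Lower bound for the count around a high point\<close>

lemma block_exists:
  assumes l: "0 < l" and x: "x \<in> VNl N l" and R: "6 * real R \<le> (1 - 2 * l) * real N"
  shows "\<exists>x0. rect x0 R R \<subseteq> VNl N l \<and> (\<forall>y\<in>rect x0 (2 * R) R. real R \<le> edist x y \<and> edist x y \<le> 4 * real R)"
proof -
  note x' = x[unfolded VNl_iff[OF less_imp_le[OF l]]]
  have R': "6 * real R \<le> real N - 2 * (l * real N)" using R by (simp add: algebra_simps)
  \<comment> \<open>The doubled block occupies \<open>[R, 3 * R)\<close> or
    \<open>[- 3 * R, - R)\<close> horizontally relative to \<open>x\<close>, so it keeps distance
    \<open>R\<close> from \<open>x\<close>; the assumption on \<open>R\<close> guarantees that one
    of the two choices leaves \<open>B\<close> in the bulk.\<close>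
  obtain u where u: "u = 1 \<or> u = - 3" and u1: "l * real N \<le> real_of_int (fst x + u * int R)" "real_of_int (fst x + u * int R) + real R \<le> real N + 1 - l * real N"
  proof (cases "real_of_int (fst x) + 2 * real R \<le> real N + 1 - l * real N")
    case True
    show ?thesis by (rule that[of 1]) (use True x' in auto)
  next
    case False
    show ?thesis by (rule that[of "-3"]) (use False x' R' in auto)
  qed
  obtain w where w: "w = 0 \<or> w = - 1" and w1: "l * real N \<le> real_of_int (snd x + w * int R)" "real_of_int (snd x + w * int R) + real R \<le> real N + 1 - l * real N"
  proof (cases "real_of_int (snd x) + real R \<le> real N + 1 - l * real N")
    case True
    show ?thesis by (rule that[of 0]) (use True x' in auto)
  next
    case False
    show ?thesis by (rule that[of "-1"]) (use False x' R' in auto)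
  qed
  define x0 where "x0 = (fst x + u * int R, snd x + w * int R)"
  have "rect x0 R R \<subseteq> VNl N l"
  proof
    fix y assume "y \<in> rect x0 R R"
    then have y: "fst x0 \<le> fst y" "fst y < fst x0 + int R" "snd x0 \<le> snd y" "snd y < snd x0 + int R"
      by (auto simp: rect_def)
    then have y': "real_of_int (fst x0) \<le> real_of_int (fst y)" "real_of_int (fst y) < real_of_int (fst x0) + real R"
      "real_of_int (snd x0) \<le> real_of_int (snd y)" "real_of_int (snd y) < real_of_int (snd x0) + real R" by linarith+
    have c: "l * real N \<le> real_of_int (fst y)" "real_of_int (fst y) \<le> real N + 1 - l * real N"
      "l * real N \<le> real_of_int (snd y)" "real_of_int (snd y) \<le> real N + 1 - l * real N"
      using y' u1 w1 unfolding x0_def fst_conv snd_conv by linarith+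
    have R0: "real N \<noteq> 0" using x' by (auto simp: box_def)
    then have "l * real N > 0" using l by simp
    then have "fst y \<ge> 1" "snd y \<ge> 1" "fst y \<le> int N" "snd y \<le> int N" using c by linarith+
    then have "y \<in> box N" by (cases y) (auto simp: box_def)
    then show "y \<in> VNl N l" using c by (simp add: VNl_iff[OF less_imp_le[OF l]])
  qed
  moreover have "real R \<le> edist x y \<and> edist x y \<le> 4 * real R" if "y \<in> rect x0 (2 * R) R" for y
  proof -
    have y: "fst x + u * int R \<le> fst y" "fst y < fst x + u * int R + 2 * int R" "snd x + w * int R \<le> snd y" "snd y < snd x + w * int R + int R"
      using that by (auto simp: rect_def x0_def)
    have a: "int R \<le> \<bar>fst x - fst y\<bar>" "\<bar>fst x - fst y\<bar> \<le> 3 * int R" "\<bar>snd x - snd y\<bar> \<le> int R"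
      using y u w by auto
    then have a': "real R \<le> \<bar>real_of_int (fst x - fst y)\<bar>" "\<bar>real_of_int (fst x - fst y)\<bar> \<le> 3 * real R" "\<bar>real_of_int (snd x - snd y)\<bar> \<le> real R"
      by linarith+
    have "\<bar>real_of_int (fst x - fst y)\<bar> \<le> edist x y"
      unfolding edist_def by (rule real_le_rsqrt) simp
    moreover have "edist x y \<le> \<bar>real_of_int (fst x - fst y)\<bar> + \<bar>real_of_int (snd x - snd y)\<bar>"
      unfolding edist_def of_int_add of_int_power by (rule sqrt_sum_squares_le_sum_abs)
    ultimately show ?thesis using a' by linarith
  qed
  ultimately show ?thesis by blast
qed

text \<open>Rests on the identity \<open>X y = T y - T' + (C x y / C x x) * X x\<close>. The forms
  \<open>T y\<close> and \<open>T'\<close> are orthogonal to \<open>X x\<close> and keep their laws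
  under conditioning, while the last term supplies about \<open>1 - \<beta>\<close> of the level. It
  remains that many \<open>T y\<close> exceed slightly more than the fraction \<open>\<beta>\<close>
  and that \<open>T'\<close> is small.\<close>

lemma lower_count:
  fixes l \<alpha> \<beta> \<delta> \<tau> :: real
  assumes l: "0 < l" "l < 1 / 2" and al: "0 < \<alpha>" "\<alpha> < 1" and be: "0 < \<beta>" "\<beta> < 1" and de: "0 < \<delta>" and ta: "0 < \<tau>"
  shows "\<exists>\<epsilon>>0. \<forall>\<^sub>F N in sequentially. \<forall>(M :: 'a measure) X C. \<forall>x\<in>VNl N l.
    gaussian_family M (bulk N (l / 2)) X C \<longrightarrow> log_cov (bulk N (l / 2)) C 1 (ln (real N)) \<epsilon> \<longrightarrow>
    measure M {\<omega>\<in>space M. 2 * sqrt gconst * \<alpha> * ln (real N) \<le> X x \<omega> \<and>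
        real (card {y\<in>{y\<in>VNl N l. edist x y \<le> exp (\<beta> * ln (real N))}. 2 * sqrt gconst * \<alpha> * ln (real N) \<le> X y \<omega>})
          \<le> exp ((2 * \<beta> * (1 - \<alpha>\<^sup>2) - \<delta>) * ln (real N))}
     \<le> \<tau> * measure M {\<omega>\<in>space M. 2 * sqrt gconst * \<alpha> * ln (real N) \<le> X x \<omega>}"
    (is "\<exists>\<epsilon>>0. \<forall>\<^sub>F N in sequentially. ?P \<epsilon> N")
proof -
  \<comment> \<open>Raising \<open>\<alpha>\<close> by \<open>u\<close> buys
    \<open>2 * sqrt gconst * \<beta> * u >= 4 * \<eta>\<close> in the level, enough for
    \<open>2 * \<eta>\<close> lost to \<open>T y\<close> and \<open>T'\<close> and
    \<open>\<eta>\<close> lost to the regression coefficient. The bound \<open>\<delta> / 16\<close>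
    keeps the change of the exponent below \<open>\<delta>\<close>.\<close>
  define u where "u = min ((1 - \<alpha>) / 2) (\<delta> / 16)"
  define \<alpha>1 where "\<alpha>1 = \<alpha> + u"
  define \<eta> where "\<eta> = \<beta> * u / 4"
  have u: "0 < u" "u \<le> (1 - \<alpha>) / 2" "u \<le> \<delta> / 16"
    using al de by (auto simp: u_def min_def)
  have al1: "0 < \<alpha>1" "\<alpha>1 < 1" using u al by (auto simp: \<alpha>1_def)
  have et: "0 < \<eta>" "4 * \<eta> = \<beta> * u" using be u by (auto simp: \<eta>_def)
  have et2: "\<eta> \<le> \<delta> / 64"
  proof -
    have "\<beta> * u \<le> 1 * (\<delta> / 16)" using be u by (intro mult_mono) auto
    then show ?thesis using et(2) by linarith
  qed
  have expo: "2 * \<beta> * (1 - \<alpha>\<^sup>2) - \<delta> \<le> 2 * \<beta> * (1 - \<alpha>1\<^sup>2) - \<eta>"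
  proof -
    have "\<alpha>1\<^sup>2 - \<alpha>\<^sup>2 = (\<alpha>1 + \<alpha>) * u" by (simp add: \<alpha>1_def power2_eq_square algebra_simps)
    also have "\<dots> \<le> 2 * (\<delta> / 16)" using al al1 u by (intro mult_mono) auto
    finally have "\<beta> * (\<alpha>1\<^sup>2 - \<alpha>\<^sup>2) \<le> \<beta> * (2 * (\<delta> / 16))" using be by (intro mult_left_mono) auto
    also have "\<dots> \<le> 1 * (2 * (\<delta> / 16))" using be de by (intro mult_right_mono) auto
    finally have "2 * (\<beta> * (\<alpha>1\<^sup>2 - \<alpha>\<^sup>2)) \<le> \<delta> / 4" by simp
    then show ?thesis using et2 de by (simp add: algebra_simps)
  qed
  obtain \<epsilon>1 where e1: "\<epsilon>1 > 0" and core: "\<forall>\<^sub>F N in sequentially. \<forall>(M :: 'a measure) X C x0.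
    gaussian_family M (rect x0 (2 * blk N \<beta>) (blk N \<beta>)) X C \<longrightarrow>
    log_cov (rect x0 (2 * blk N \<beta>) (blk N \<beta>)) C \<beta> (ln (real N)) \<epsilon>1 \<longrightarrow>
    measure M {\<omega>\<in>space M. real (card {y\<in>rect x0 (blk N \<beta>) (blk N \<beta>). (2 * sqrt gconst * \<alpha>1 * \<beta> - \<eta>) * ln (real N) \<le> X y \<omega>})
       \<le> exp ((2 * \<beta> * (1 - \<alpha>1\<^sup>2) - \<eta>) * ln (real N))} \<le> \<tau> / 2"
    using core_high_count[OF al1 be(1) less_imp_le[OF be(2)] et(1), of "\<tau> / 2"] ta by auto
  \<comment> \<open>\<open>\<epsilon>1 / 5\<close> covers the error terms in the covariance of
    \<open>T\<close>; \<open>1 / 16\<close> keeps its projection term below \<open>r * L\<close>;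
    \<open>\<eta> / 8\<close> and \<open>(1 - \<beta>) / 4\<close> control the regression
    coefficient.\<close>
  define r where "r = min (min (\<epsilon>1 / 5) (1 / 16)) (min (\<eta> / 8) ((1 - \<beta>) / 4))"
  define \<epsilon> where "\<epsilon> = r / 2"
  define m where "m = nat \<lceil>2 / r\<rceil> + 1"
  have r: "0 < r" "5 * r \<le> \<epsilon>1" "r \<le> 1 / 16" "8 * r \<le> \<eta>" "4 * r \<le> 1 - \<beta>"
    using e1 et be unfolding r_def by (auto simp: min_def)
  have m: "m > 0" "2 / r \<le> real m" unfolding m_def by linarith+
  have pos: "0 < r / 2" "0 < \<beta>" "0 < 1 - \<beta>" "0 < \<eta>\<^sup>2 / 4" using r be et by auto
  have "\<forall>\<^sub>F N in sequentially. 4 \<le> l * real N" using l by real_asymp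
  then have "\<forall>\<^sub>F N in sequentially. ?P \<epsilon> N"
    using core eventually_ge_at_top[of 2]
      eventually_ln_ge[OF pos(1), of "ln (8 * real m)"]
      eventually_ln_ge[OF pos(1), of "ln 32"]
      eventually_ln_ge[OF pos(2), of "ln 32"]
      eventually_ln_ge[OF pos(3), of "ln (8 * real m / l)"]
      eventually_ln_ge[OF pos(3), of "ln (1 / (1 - 2 * l))"]
      eventually_ln_ge[OF pos(4), of "- ln (\<tau> / 2)"]
  proof eventually_elim
    case (elim N)
    define L where "L = ln (real N)"
    define R where "R = blk N \<beta>"
    have N: "N \<ge> 1" and L: "L > 0" using elim(3) by (auto simp: L_def)
    have lN: "4 \<le> l * real N" by (rule elim(1))
    have A2: "ln (8 * real m) \<le> r / 2 * L" and A3: "ln 32 \<le> r / 2 * L" and A5: "ln 32 \<le> \<beta> * L"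
      and A8: "ln (8 * real m / l) \<le> (1 - \<beta>) * L" and A9: "ln (1 / (1 - 2 * l)) \<le> (1 - \<beta>) * L"
      and A10: "- ln (\<tau> / 2) \<le> \<eta>\<^sup>2 / 4 * L"
      using elim(4-) by (simp_all add: L_def)
    define E where "E = exp (\<beta> * L)"
    have exps: "8 * real m / l \<le> exp ((1 - \<beta>) * L)" "1 / (1 - 2 * l) \<le> exp ((1 - \<beta>) * L)" "32 \<le> E"
    proof -
      have "exp (ln (8 * real m / l)) \<le> exp ((1 - \<beta>) * L)" "exp (ln (1 / (1 - 2 * l))) \<le> exp ((1 - \<beta>) * L)"
        "exp (ln 32) \<le> exp (\<beta> * L)"
        using A8 A9 A5 by (simp_all only: exp_le_cancel_iff)
      then show "8 * real m / l \<le> exp ((1 - \<beta>) * L)" "1 / (1 - 2 * l) \<le> exp ((1 - \<beta>) * L)" "32 \<le> E"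
        using m l by (auto simp: E_def)
    qed
    have EN: "exp ((1 - \<beta>) * L) * E = real N"
    proof -
      have "exp ((1 - \<beta>) * L) * E = exp L" unfolding E_def by (simp add: exp_add[symmetric] algebra_simps)
      then show ?thesis using N by (simp add: L_def)
    qed
    have room: "real m * (2 * E) \<le> l * real N / 4"
    proof -
      have "8 * real m / l * E \<le> real N"
        unfolding EN[symmetric] using exps(1,3) by (intro mult_right_mono) auto
      then show ?thesis using l by (simp add: field_simps)
    qed
    have R: "real R \<le> E / 16" "E / 32 \<le> real R"
      using exps(3) unfolding R_def blk_def E_def L_def by linarith+
    have R6: "6 * real R \<le> (1 - 2 * l) * real N"
    proof -
      have "1 / (1 - 2 * l) * E \<le> real N"
        unfolding EN[symmetric] using exps(2,3) by (intro mult_right_mono) auto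
      then have "E \<le> (1 - 2 * l) * real N" using l by (simp add: field_simps)
      then show ?thesis using R(1) exps(3) by linarith
    qed
    show ?case
      unfolding L_def[symmetric]
    proof (intro allI ballI impI)
      fix M :: "'a measure" and X C x
      define I where "I = bulk N (l / 2)"
      assume x: "x \<in> VNl N l" and g: "gaussian_family M (bulk N (l / 2)) X C" and lc: "log_cov (bulk N (l / 2)) C 1 L \<epsilon>"
      note g = g[folded I_def] and lc = lc[folded I_def]
      interpret M: prob_space M by (rule gaussian_familyD(1)[OF g])
      have finI: "finite I" by (rule gaussian_familyD(2)[OF g])
      note lm [measurable] = gaussian_lin_measurable[OF g]
      have near: "y \<in> I" if "edist x y \<le> l * real N / 4" for y
        unfolding I_def by (rule near_VNl_bulk[OF l(1) lN x that])
      have EN4: "E \<le> l * real N / 4"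
      proof -
        have "1 * E \<le> real m * (2 * E)" using m exps(3) by (intro mult_mono) auto
        then show ?thesis using room by linarith
      qed
      have xI: "x \<in> I" using lN by (intro near) (simp add: edist_def)
      obtain x0 where BV: "rect x0 R R \<subseteq> VNl N l"
        and Ad: "\<And>y. y \<in> rect x0 (2 * R) R \<Longrightarrow> real R \<le> edist x y" "\<And>y. y \<in> rect x0 (2 * R) R \<Longrightarrow> edist x y \<le> 4 * real R"
        using block_exists[OF l(1) x R6] by blast
      define A where "A = rect x0 (2 * R) R"
      define B where "B = rect x0 R R"
      note Ad = Ad[folded A_def] and BV = BV[folded B_def]
      have BA: "B \<subseteq> A" by (auto simp: A_def B_def rect_def)
      have dE: "edist x y \<le> E / 4" if "y \<in> A" for y using Ad(2)[OF that] R(1) by linarith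
      have AI: "A \<subseteq> I"
      proof
        fix y assume "y \<in> A"
        from dE[OF this] show "y \<in> I" using EN4 exps(3) by (intro near) linarith
      qed
      \<comment> \<open>One average around \<open>x\<close> serves for all \<open>y\<close> in the
        block: the block lies within \<open>E / 4\<close> of \<open>x\<close>, while the averaging
        points are at least \<open>E\<close> away from \<open>x\<close>.\<close>
      define h where "h = avg m (ring_pt x (scale N \<beta>))"
      have ring_d: "edist x (ring_pt x (scale N \<beta>) j) \<le> l * real N / 4" "E \<le> edist x (ring_pt x (scale N \<beta>) j)" if j: "j \<in> {1..m}" for j
      proof -
        have sb: "E \<le> real (scale N \<beta>)" "real (scale N \<beta>) \<le> 2 * E"
          using scale_bounds(1,2)[of \<beta> N] be N unfolding L_def E_def by auto
        have "real j * real (scale N \<beta>) \<le> real m * (2 * E)" using j sb by (intro mult_mono) auto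
        then show "edist x (ring_pt x (scale N \<beta>) j) \<le> l * real N / 4"
          unfolding edist_ring using room by linarith
        have "1 * E \<le> real j * real (scale N \<beta>)" using j sb exps(3) by (intro mult_mono) auto
        then show "E \<le> edist x (ring_pt x (scale N \<beta>) j)" unfolding edist_ring by simp
      qed
      have ring: "ring_pt x (scale N \<beta>) j \<in> I" if j: "j \<in> {1..m}" for j
        by (rule near[OF ring_d(1)[OF j]])
      have eps: "\<epsilon> \<le> r / 2" "0 \<le> \<epsilon>" using r by (simp_all add: \<epsilon>_def)
      note ra0 = ring_avg[OF less_imp_le[OF be(1)] N lc[unfolded L_def] xI less_imp_le[OF be(2)] order_refl m(1) ring eps(1) m(2) r(1) A2[unfolded L_def], folded L_def, folded h_def, folded E_def]
      have ra: "bform I C h h \<le> (gconst * (1 - \<beta>) + r) * L" "bform I C (unitv x) h \<le> (gconst * (1 - \<beta>) + r) * L"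
        "\<And>z. z \<in> I \<Longrightarrow> edist x z \<le> 2 * E \<Longrightarrow> (gconst * (1 - \<beta>) - r) * L \<le> bform I C (unitv z) h"
        "(gconst * (1 - \<beta>) - r) * L \<le> bform I C h h"
        using ra0 by auto
      define G where "G = gconst * (1 - \<beta>) * L"
      define b where "b = bform I C"
      have hh: "b h h \<le> G + r * L" "G - r * L \<le> b h h" and xh: "b (unitv x) h \<le> G + r * L" "G - r * L \<le> b (unitv x) h"
        using ra(1,2,4) ra(3)[OF xI] exps(3) unfolding b_def G_def by (auto simp: distrib_right left_diff_distrib edist_def)
      have yh: "b (unitv y) h \<le> G + r * L" "G - r * L \<le> b (unitv y) h" if y: "y \<in> A" for y
      proof -
        have yI: "y \<in> I" using AI y by auto
        have "edist x y \<le> 2 * E" using dE[OF y] exps(3) by linarith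
        from ra(3)[OF yI this]
        show "G - r * L \<le> b (unitv y) h" unfolding b_def G_def by (simp add: left_diff_distrib)
        have "bform I C (unitv y) h \<le> (gconst * (1 - (\<beta> - r / 2)) + \<epsilon>) * L"
          unfolding h_def
        proof (rule cov_avg_le[OF lc m(1) ring yI])
          fix j assume j: "j \<in> {1..m}"
          have "edist x (ring_pt x (scale N \<beta>) j) \<le> edist x y + edist y (ring_pt x (scale N \<beta>) j)"
            by (rule edist_triangle)
          then have d: "E / 32 \<le> edist y (ring_pt x (scale N \<beta>) j)" using ring_d(2)[OF j] dE[OF y] exps(3) by linarith
          have "(\<beta> - r / 2) * L \<le> ln (E / 32)"
            using A3 by (simp add: E_def ln_div left_diff_distrib)
          also have "\<dots> \<le> logd y (ring_pt x (scale N \<beta>) j)"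
            using d exps(3) by (intro logd_ge_ln) auto
          finally show "(\<beta> - r / 2) * L \<le> logd y (ring_pt x (scale N \<beta>) j)" .
        qed
        also have "\<dots> \<le> (gconst * (1 - \<beta>) + r) * L"
        proof (rule mult_right_mono)
          have "gconst * (r / 2) \<le> 1 * (r / 2)" using gconst_bounds r by (intro mult_right_mono) auto
          then show "gconst * (1 - (\<beta> - r / 2)) + \<epsilon> \<le> gconst * (1 - \<beta>) + r"
            using eps(1) by (simp add: algebra_simps)
        qed (use L in simp)
        finally show "b (unitv y) h \<le> G + r * L" by (simp add: b_def G_def distrib_right)
      qed
      \<comment> \<open>Every block point has distance \<open>N powr \<beta>\<close> from
        \<open>x\<close> up to bounded factors, so its covariance with \<open>X x\<close> agrees
        with that of the average up to \<open>2 * r * L\<close>.\<close>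
      have xy: "C x y \<le> G + r * L" "G - r * L \<le> C x y" if y: "y \<in> A" for y
      proof -
        have yI: "y \<in> I" using AI y by auto
        have E0: "E > 0" using exps(3) by linarith
        have "(\<beta> - r / 2) * L \<le> ln (E / 32)"
          using A3 by (simp add: E_def ln_div left_diff_distrib)
        also have "\<dots> \<le> logd x y" using E0 Ad(1)[OF y] R(2) by (intro logd_ge_ln) auto
        finally have d1: "(\<beta> - r / 2) * L \<le> logd x y" .
        have "edist x y \<le> 1 * exp (\<beta> * L)" using dE[OF y] E0 unfolding E_def by linarith
        then have "logd x y \<le> \<beta> * L + ln 2" using logd_le_scale[of 1 x y \<beta> L] be L by simp
        also have "ln 2 \<le> ln (32::real)" by simp
        finally have d2: "logd x y \<le> (\<beta> + r / 2) * L" using A3 by (simp add: distrib_right)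
        have gr: "gconst * (r / 2 * L) \<le> r / 2 * L"
          using gconst_bounds r L by (intro mult_left_le_one_le) auto
        have el: "\<epsilon> * L \<le> r / 2 * L" using eps L by (intro mult_right_mono) auto
        have "gconst * (1 * L - logd x y) \<le> gconst * (L - (\<beta> - r / 2) * L)"
          using d1 gconst_bounds by (intro mult_left_mono) auto
        then show "C x y \<le> G + r * L"
          using log_covD(1)[OF lc xI yI] gr el unfolding G_def by (simp add: algebra_simps)
        have "gconst * (L - (\<beta> + r / 2) * L) \<le> gconst * (1 * L - logd x y)"
          using d2 gconst_bounds by (intro mult_left_mono) auto
        then show "G - r * L \<le> C x y"
          using log_covD(2)[OF lc xI yI] gr el unfolding G_def by (simp add: algebra_simps)
      qed
      have xx: "C x x \<le> (gconst + r) * L" "L / 4 \<le> C x x"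
      proof -
        have 0: "logd x x = 0" by (simp add: logd_def edist_def)
        have el: "\<epsilon> * L \<le> r * L" "\<epsilon> * L \<le> 1 / 16 * L" using eps r L by (auto intro!: mult_right_mono)
        show "C x x \<le> (gconst + r) * L"
          using log_covD(1)[OF lc xI xI] el by (simp add: 0 algebra_simps)
        have "1 / 2 * L \<le> gconst * L" using gconst_bounds L by (intro mult_right_mono) auto
        moreover have "gconst * L - \<epsilon> * L \<le> C x x"
          using log_covD(2)[OF lc xI xI] by (simp add: 0)
        ultimately show "L / 4 \<le> C x x" using el(2) L by linarith
      qed
      have xx0: "C x x > 0" using xx(2) L by linarith
      have bs: "b c d = b d c" for c d unfolding b_def by (rule bform_sym[OF gaussian_familyD(5)[OF g]])
      have bev: "b (unitv y) (unitv z) = C y z" if "y \<in> I" "z \<in> I" for y z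
        unfolding b_def using that finI by (simp add: bform_unitv)
      note lin = bform_diff_left[of I C, folded b_def] bform_diff_right[of I C, folded b_def]
        bform_cmult_left[of I C, folded b_def] bform_cmult_right[of I C, folded b_def]
      \<comment> \<open>The covariance of \<open>X x\<close> with \<open>X y\<close> minus the
        average. It is \<open>O(r * L)\<close>, so the projection barely changes the recentred
        field.\<close>
      define w where "w = (\<lambda>y. C x y - b (unitv x) h)"
      define wh where "wh = b (unitv x) h"
      \<comment> \<open>\<open>T y\<close> is the field at \<open>y\<close> recentred by its average at scale \<open>N powr \<beta>\<close> and projected off the value at \<open>x\<close>,
        so that conditioning on that value does not change its law.\<close>
      define T where "T = (\<lambda>y i. unitv y i - h i - (w y / C x x) * unitv x i)"
      define T' where "T' = (\<lambda>i. (wh / C x x) * unitv x i - h i)"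
      have orth: "b (unitv x) (T y) = 0" if "y \<in> A" for y
        using that AI xI xx0 unfolding T_def lin by (simp add: bev w_def subsetD)
      have orth': "b (unitv x) T' = 0"
        using xI xx0 unfolding T'_def lin by (simp add: bev wh_def)
      have TT: "b (T y) (T z) = C y z - b (unitv y) h - b (unitv z) h + b h h - w y * w z / C x x" if y: "y \<in> A" and z: "z \<in> A" for y z
      proof -
        have yI: "y \<in> I" and zI: "z \<in> I" using y z AI by auto
        \<comment> \<open>As \<open>T y\<close> is orthogonal to \<open>X x\<close>, the projection
          part of \<open>T z\<close> drops out.\<close>
        have "b (T y) (T z) = b (T y) (\<lambda>i. unitv z i - h i)"
        proof -
          have Tz: "T z = (\<lambda>i. (unitv z i - h i) - (w z / C x x) * unitv x i)" by (simp add: T_def)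
          have "b (T y) (unitv x) = 0" using orth[OF y] bs by metis
          then show ?thesis unfolding Tz lin by simp
        qed
        also have "\<dots> = C y z - b (unitv y) h - (b h (unitv z) - b h h) - w y / C x x * (C x z - b (unitv x) h)"
          unfolding T_def lin using yI zI xI by (simp add: bev algebra_simps)
        finally show ?thesis using bs[of h "unitv z"] by (simp add: w_def)
      qed
      have TT': "b T' T' \<le> 2 * L"
      proof -
        have "b T' T' = - b h T'"
        proof -
          have "b T' T' = (wh / C x x) * b (unitv x) T' - b h T'" by (subst (1) T'_def) (simp only: lin)
          then show ?thesis using orth' by simp
        qed
        also have "\<dots> = b h h - wh * wh / C x x"
          unfolding T'_def lin using bs[of h "unitv x"] by (simp add: wh_def)
        also have "\<dots> \<le> b h h" using xx0 by simp
        also have "\<dots> \<le> G + r * L" by (rule hh)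
        also have "\<dots> \<le> 1 * (1 * L) + 1 * L"
          unfolding G_def mult.assoc using gconst_bounds be L r by (intro add_mono mult_mono) auto
        finally show ?thesis by simp
      qed
      have wb: "\<bar>w y\<bar> \<le> 2 * r * L" if "y \<in> A" for y
        using xy[OF that] xh unfolding w_def by (simp add: abs_le_iff algebra_simps)
      have lcA: "log_cov A (\<lambda>y z. b (T y) (T z)) \<beta> L \<epsilon>1"
        unfolding log_cov_def
      proof (intro conjI ballI)
        show "finite A" by (simp add: A_def)
        fix y z assume y: "y \<in> A" and z: "z \<in> A"
        have yI: "y \<in> I" and zI: "z \<in> I" using y z AI by auto
        have "\<bar>w y * w z / C x x\<bar> \<le> (2 * r * L) * (2 * r * L) / (L / 4)"
          unfolding abs_divide abs_mult using wb[OF y] wb[OF z] xx xx0 L r by (intro frac_le mult_mono) auto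
        also have "\<dots> = 16 * r * (r * L)" using L by (simp add: field_simps)
        also have "\<dots> \<le> 1 * (r * L)" using r L by (intro mult_right_mono) auto
        finally have 1: "\<bar>w y * w z / C x x\<bar> \<le> r * L" by simp
        have 2: "\<bar>C y z - gconst * (1 * L - logd y z)\<bar> \<le> r / 2 * L"
        proof -
          have "\<epsilon> * L \<le> r / 2 * L" using eps L by (intro mult_right_mono) auto
          then show ?thesis using lc yI zI unfolding log_cov_def by (meson order_trans)
        qed
        have 3: "5 * (r * L) \<le> \<epsilon>1 * L" using r L by (simp add: mult.assoc[symmetric])
        have 4: "gconst * (\<beta> * L - logd y z) = gconst * (1 * L - logd y z) - G"
          by (simp add: G_def algebra_simps)
        have 5: "0 \<le> r * L" using r L by simp
        show "\<bar>b (T y) (T z) - gconst * (\<beta> * L - logd y z)\<bar> \<le> \<epsilon>1 * L"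
        proof -
          have arith: "\<bar>c' - y1 - z1 + h1 - e' - (q - G)\<bar> \<le> V"
            if "\<bar>e'\<bar> \<le> \<rho>" "\<bar>c' - q\<bar> \<le> \<rho> / 2" "5 * \<rho> \<le> V" "0 \<le> \<rho>" "y1 \<le> G + \<rho>" "G - \<rho> \<le> y1"
              "z1 \<le> G + \<rho>" "G - \<rho> \<le> z1" "h1 \<le> G + \<rho>" "G - \<rho> \<le> h1" for c' y1 z1 h1 e' q V \<rho> :: real
            using that by linarith
          have 2: "\<bar>C y z - gconst * (1 * L - logd y z)\<bar> \<le> r * L / 2" using 2 by simp
          show ?thesis
            unfolding TT[OF y z] 4 by (rule arith[OF 1 2 3 5 yh[OF y] yh[OF z] hh])
        qed
      qed
      define a where "a = 2 * sqrt gconst * \<alpha> * L"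
      have a0: "a \<ge> 0" using al L gconst_bounds by (simp add: a_def)
      define S where "S = {\<omega>\<in>space M. a \<le> X x \<omega>}"
      have Sx: "S = {\<omega>\<in>space M. a \<le> (\<Sum>i\<in>I. unitv x i * X i \<omega>)}"
        unfolding S_def by (simp add: sum_unitv finI xI)
      have Sm [measurable]: "S \<in> sets M" unfolding Sx by measurable
      have Xm: "X y \<in> borel_measurable M" if "y \<in> I" for y by (rule gaussian_familyD(3)[OF g that])
      define BB where "BB = {y\<in>VNl N l. edist x y \<le> exp (\<beta> * L)}"
      define n where "n = exp ((2 * \<beta> * (1 - \<alpha>\<^sup>2) - \<delta>) * L)"
      define U where "U = {\<omega>\<in>space M. a \<le> X x \<omega> \<and> real (card {y\<in>BB. a \<le> X y \<omega>}) \<le> n}"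
      have "measure M U \<le> \<tau> * measure M S"
      proof (cases "measure M S = 0")
        case True
        have "measure M U \<le> measure M S" by (rule M.finite_measure_mono[OF _ Sm]) (auto simp: U_def S_def)
        then show ?thesis using True by simp
      next
        case False
        then have p: "measure M S > 0" by (simp add: zero_less_measure_iff)
        define M' where "M' = uniform_measure M S"
        have spM': "space M' = space M" "sets M' = sets M" by (simp_all add: M'_def)
        have finA: "finite A" by (simp add: A_def)
        have g1: "gaussian_family M' A (\<lambda>y \<omega>. \<Sum>i\<in>I. T y i * X i \<omega>) (\<lambda>y z. b (T y) (T z))"
          unfolding M'_def b_def
          by (rule gaussian_conditional[OF g finA _ Sx p]) (use orth in \<open>simp add: b_def\<close>)
        \<comment> \<open>\<open>T'\<close> enters through its own tail only, hence a family with
          one index; a union bound combines it with the count of the \<open>T y\<close>.\<close>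
        have g2: "gaussian_family M' {()} (\<lambda>_ \<omega>. \<Sum>i\<in>I. T' i * X i \<omega>) (\<lambda>_ _. b T' T')"
          unfolding M'_def b_def
          by (rule gaussian_conditional[OF g _ _ Sx p, of "{()}" "\<lambda>_. T'"]) (use orth' in \<open>simp_all add: b_def\<close>)
        interpret M': prob_space M' by (rule gaussian_familyD(1)[OF g1])
        define E1 where "E1 = {\<omega>\<in>space M. real (card {y\<in>B. (2 * sqrt gconst * \<alpha>1 * \<beta> - \<eta>) * L \<le> (\<Sum>i\<in>I. T y i * X i \<omega>)})
            \<le> exp ((2 * \<beta> * (1 - \<alpha>1\<^sup>2) - \<eta>) * L)}"
        define E2 where "E2 = {\<omega>\<in>space M. \<eta> * L \<le> (\<Sum>i\<in>I. T' i * X i \<omega>)}"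
        have P1: "measure M' E1 \<le> \<tau> / 2"
          using elim(2)[unfolded L_def[symmetric] R_def[symmetric], rule_format, OF g1[unfolded A_def] lcA[unfolded A_def]]
          unfolding E1_def B_def spM' .
        have P2: "measure M' E2 \<le> \<tau> / 2"
        proof -
          \<comment> \<open>The tilt \<open>\<eta> / 2\<close> is optimal for threshold
            \<open>\<eta> * L\<close> and variance bound \<open>2 * L\<close>.\<close>
          have "measure M' E2 \<le> exp ((\<eta> / 2)\<^sup>2 * bform {()} (\<lambda>_ _. b T' T') (\<lambda>_. 1) (\<lambda>_. 1) / 2 - \<eta> / 2 * (\<eta> * L))"
            using et by (intro gaussian_chernoff_scaled[OF g2]) (auto simp: E2_def spM')
          also have "\<dots> \<le> exp ((\<eta> / 2)\<^sup>2 * (2 * L) / 2 - \<eta> / 2 * (\<eta> * L))"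
          proof -
            have "(\<eta> / 2)\<^sup>2 * b T' T' \<le> (\<eta> / 2)\<^sup>2 * (2 * L)" by (intro mult_left_mono TT') simp
            then show ?thesis unfolding exp_le_cancel_iff bform_def by simp
          qed
          also have "(\<eta> / 2)\<^sup>2 * (2 * L) / 2 - \<eta> / 2 * (\<eta> * L) = - (\<eta>\<^sup>2 / 4 * L)"
            by (simp add: power2_eq_square)
          also have "exp (- (\<eta>\<^sup>2 / 4 * L)) \<le> exp (ln (\<tau> / 2))" using A10 by (simp only: exp_le_cancel_iff)
          finally show ?thesis using ta by simp
        qed
        have E2m: "E2 \<in> sets M" unfolding E2_def by measurable
        have E1m: "E1 \<in> sets M"
        proof -
          have "(\<lambda>\<omega>. real (card {y\<in>B. (2 * sqrt gconst * \<alpha>1 * \<beta> - \<eta>) * L \<le> (\<Sum>i\<in>I. T y i * X i \<omega>)})) \<in> borel_measurable M"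
            by (rule count_measurable) (auto simp: B_def lm)
          then show ?thesis unfolding E1_def by simp
        qed
        have cond: "measure M (S \<inter> Q) = measure M S * measure M' Q" if "Q \<in> sets M" for Q
          using p that unfolding M'_def by (subst measure_uniform_measure) (auto simp: M.emeasure_eq_measure)
        have "U \<subseteq> (S \<inter> E1) \<union> (S \<inter> E2)"
        proof
          fix \<omega> assume wU: "\<omega> \<in> U"
          then have wS: "\<omega> \<in> space M" "a \<le> X x \<omega>" "real (card {y\<in>BB. a \<le> X y \<omega>}) \<le> n" by (auto simp: U_def)
          show "\<omega> \<in> (S \<inter> E1) \<union> (S \<inter> E2)"
          proof (rule ccontr)
            assume "\<omega> \<notin> (S \<inter> E1) \<union> (S \<inter> E2)"
            then have c1: "exp ((2 * \<beta> * (1 - \<alpha>1\<^sup>2) - \<eta>) * L) < real (card {y\<in>B. (2 * sqrt gconst * \<alpha>1 * \<beta> - \<eta>) * L \<le> (\<Sum>i\<in>I. T y i * X i \<omega>)})"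
              and c2: "(\<Sum>i\<in>I. T' i * X i \<omega>) < \<eta> * L"
              using wS by (auto simp: S_def E1_def E2_def)
            have sub: "{y\<in>B. (2 * sqrt gconst * \<alpha>1 * \<beta> - \<eta>) * L \<le> (\<Sum>i\<in>I. T y i * X i \<omega>)} \<subseteq> {y\<in>BB. a \<le> X y \<omega>}"
            proof safe
              fix y assume yB: "y \<in> B" and psi: "(2 * sqrt gconst * \<alpha>1 * \<beta> - \<eta>) * L \<le> (\<Sum>i\<in>I. T y i * X i \<omega>)"
              have yA: "y \<in> A" using yB BA by auto
              have yI: "y \<in> I" using yA AI by auto
              have E0: "E > 0" using exps(3) by linarith
              have "edist x y \<le> E" using dE[OF yA] E0 by linarith
              then show "y \<in> BB" using yB BV by (auto simp: BB_def E_def)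
              have t1: "(\<Sum>i\<in>I. T y i * X i \<omega>) = X y \<omega> - (\<Sum>i\<in>I. h i * X i \<omega>) - w y / C x x * X x \<omega>"
                unfolding T_def by (simp only: left_diff_distrib sum_subtractf mult.assoc sum_distrib_left[symmetric] sum_unitv[OF finI yI] sum_unitv[OF finI xI])
              have t2: "(\<Sum>i\<in>I. T' i * X i \<omega>) = wh / C x x * X x \<omega> - (\<Sum>i\<in>I. h i * X i \<omega>)"
                unfolding T'_def by (simp only: left_diff_distrib sum_subtractf mult.assoc sum_distrib_left[symmetric] sum_unitv[OF finI xI])
              have eqX: "X y \<omega> = (\<Sum>i\<in>I. T y i * X i \<omega>) - (\<Sum>i\<in>I. T' i * X i \<omega>) + C x y / C x x * X x \<omega>"
                unfolding t1 t2 w_def wh_def by (simp add: diff_divide_distrib left_diff_distrib)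
              \<comment> \<open>The loss \<open>4 * r\<close> suffices because
                \<open>gconst > 1/2\<close>: the gain \<open>4 * r * gconst\<close> exceeds
                \<open>2 * r\<close>, the sum of the errors in \<open>C x x\<close> and
                \<open>C x y\<close> relative to \<open>L\<close>.\<close>
              have cge: "1 - \<beta> - 4 * r \<le> C x y / C x x"
              proof -
                have "(1 - \<beta> - 4 * r) * C x x \<le> (1 - \<beta> - 4 * r) * ((gconst + r) * L)"
                  using r xx by (intro mult_left_mono) auto
                also have "\<dots> = G - r * L + ((1 - \<beta>) * r - 4 * r * gconst - 4 * r * r + r) * L"
                  by (simp add: G_def algebra_simps)
                also have "\<dots> \<le> G - r * L + 0 * L"
                proof (intro add_left_mono mult_right_mono)
                  have "(1 - \<beta>) * r \<le> 1 * r" using be r by (intro mult_right_mono) auto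
                  moreover have "r * (1 / 2) \<le> r * gconst" using gconst_bounds r by (intro mult_left_mono) auto
                  moreover have "0 \<le> r * r" by simp
                  ultimately show "(1 - \<beta>) * r - 4 * r * gconst - 4 * r * r + r \<le> 0"
                    unfolding mult.assoc[of 4] by linarith
                qed (use L in simp)
                also have "\<dots> \<le> C x y" using xy(2)[OF yA] by simp
                finally show ?thesis using xx0 by (simp add: pos_le_divide_eq)
              qed
              have "(1 - \<beta> - 4 * r) * a \<le> C x y / C x x * X x \<omega>"
                using cge wS(2) a0 r(5) by (intro mult_mono) auto
              then have "X y \<omega> \<ge> (2 * sqrt gconst * \<alpha>1 * \<beta> - \<eta>) * L - \<eta> * L + (1 - \<beta> - 4 * r) * a"
                using eqX psi c2 by linarith
              moreover have "a \<le> (2 * sqrt gconst * \<alpha>1 * \<beta> - \<eta>) * L - \<eta> * L + (1 - \<beta> - 4 * r) * a"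
              proof -
                \<comment> \<open>The balance of levels after cancelling \<open>a\<close>: the gain
                  from raising \<open>\<alpha>\<close> against \<open>2 * \<eta>\<close> and the
                  loss in the regression coefficient.\<close>
                have "0 \<le> (2 * sqrt gconst * (\<beta> * u) - 2 * \<eta> - 8 * r * (sqrt gconst * \<alpha>)) * L"
                proof (rule mult_nonneg_nonneg)
                  have "1 / 2 * (\<beta> * u) \<le> sqrt gconst * (\<beta> * u)" using sqrt_gconst_bounds be u by (intro mult_right_mono) auto
                  moreover have "sqrt gconst * \<alpha> \<le> 1 * 1" using sqrt_gconst_bounds al by (intro mult_mono) auto
                  then have "8 * r * (sqrt gconst * \<alpha>) \<le> 8 * r * 1" using r by (intro mult_left_mono) auto
                  ultimately show "0 \<le> 2 * sqrt gconst * (\<beta> * u) - 2 * \<eta> - 8 * r * (sqrt gconst * \<alpha>)"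
                    using et r(4) by simp
                qed (use L in simp)
                then show ?thesis unfolding a_def \<alpha>1_def by (simp add: algebra_simps)
              qed
              ultimately show "a \<le> X y \<omega>" by linarith
            qed
            have "finite {y\<in>BB. a \<le> X y \<omega>}" by (rule finite_subset[of _ "box N"]) (auto simp: BB_def VNl_def)
            from card_mono[OF this sub] have "exp ((2 * \<beta> * (1 - \<alpha>1\<^sup>2) - \<eta>) * L) < n" using c1 wS(3) by linarith
            moreover have "n \<le> exp ((2 * \<beta> * (1 - \<alpha>1\<^sup>2) - \<eta>) * L)"
              unfolding n_def using expo L by (simp add: mult_right_mono)
            ultimately show False by linarith
          qed
        qed
        then have "measure M U \<le> measure M ((S \<inter> E1) \<union> (S \<inter> E2))"
          using E1m E2m by (intro M.finite_measure_mono) auto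
        also have "\<dots> \<le> measure M (S \<inter> E1) + measure M (S \<inter> E2)"
          using E1m E2m by (intro measure_Un_le) auto
        also have "\<dots> = measure M S * (measure M' E1 + measure M' E2)"
          by (simp add: cond E1m E2m distrib_left)
        also have "\<dots> \<le> measure M S * (\<tau> / 2 + \<tau> / 2)"
          using P1 P2 by (intro mult_left_mono add_mono) auto
        finally show ?thesis by (simp add: mult.commute)
      qed
      then show "measure M {\<omega>\<in>space M. 2 * sqrt gconst * \<alpha> * L \<le> X x \<omega> \<and>
          real (card {y\<in>{y\<in>VNl N l. edist x y \<le> exp (\<beta> * L)}. 2 * sqrt gconst * \<alpha> * L \<le> X y \<omega>})
          \<le> exp ((2 * \<beta> * (1 - \<alpha>\<^sup>2) - \<delta>) * L)}
        \<le> \<tau> * measure M {\<omega>\<in>space M. 2 * sqrt gconst * \<alpha> * L \<le> X x \<omega>}"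
        unfolding U_def S_def BB_def a_def n_def .
    qed
  qed
  then show ?thesis using r by (intro exI[of _ \<epsilon>]) (auto simp: \<epsilon>_def)
qed

section \<open>Conclusion for the conditional probabilities\<close>

lemma VNl_nonempty:
  assumes "0 < l" "l < 1 / 2" "2 / (1 - 2 * l) \<le> real N" "1 \<le> l * real N"
  shows "VNl N l \<noteq> {}"
proof -
  define c where "c = \<lceil>l * real N\<rceil>"
  have "2 \<le> (1 - 2 * l) * real N" using assms by (simp add: field_simps)
  then have "2 \<le> real N - 2 * (l * real N)" by (simp add: algebra_simps)
  then have c: "l * real N \<le> real_of_int c" "real_of_int c \<le> real N + 1 - l * real N"
    unfolding c_def using assms(4) by linarith+
  then have "1 \<le> c" "c \<le> int N" using assms(4) by linarith+
  then have "(c, c) \<in> VNl N l" using c assms(1) by (simp add: VNl_iff box_def)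
  then show ?thesis by blast
qed

theorem theorem1p5:
  fixes l \<alpha> \<beta> \<delta> :: real
    and M :: "nat \<Rightarrow> 'a measure"
    and \<Phi> :: "nat \<Rightarrow> int \<times> int \<Rightarrow> 'a \<Rightarrow> real"
  assumes "0 < l" "l < 1/2" "0 < \<alpha>" "\<alpha> < 1" "0 < \<beta>" "\<beta> < 1" "0 < \<delta>"
    and "\<forall>N. is_GFF (M N) N (\<Phi> N)"
  shows "(\<lambda>N. Max ((\<lambda>x.
            measure (M N) {\<omega> \<in> space (M N).
               \<bar>ln (real (card (high N l \<alpha> (\<lambda>y. \<Phi> N y \<omega>) \<inter> disc N x (real N powr \<beta>))))
                  / ln (real N) - 2 * \<beta> * (1 - \<alpha>^2)\<bar> > \<delta>
               \<and> x \<in> high N l \<alpha> (\<lambda>y. \<Phi> N y \<omega>)}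
            / measure (M N) {\<omega> \<in> space (M N). x \<in> high N l \<alpha> (\<lambda>y. \<Phi> N y \<omega>)})
          ` VNl N l))
         \<longlonglongrightarrow> 0"
proof -
  define W where "W = (\<lambda>N x. {\<omega> \<in> space (M N).
               \<bar>ln (real (card (high N l \<alpha> (\<lambda>y. \<Phi> N y \<omega>) \<inter> disc N x (real N powr \<beta>))))
                  / ln (real N) - 2 * \<beta> * (1 - \<alpha>^2)\<bar> > \<delta>
               \<and> x \<in> high N l \<alpha> (\<lambda>y. \<Phi> N y \<omega>)})"
  define f where "f = (\<lambda>N x. measure (M N) (W N x) / measure (M N) {\<omega> \<in> space (M N). x \<in> high N l \<alpha> (\<lambda>y. \<Phi> N y \<omega>)})"
  have "(\<lambda>N. Max (f N ` VNl N l)) \<longlonglongrightarrow> 0"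
  proof (rule tendstoI)
    fix e :: real assume e: "e > 0"
    \<comment> \<open>Too many and too few high points cost \<open>\<tau>\<close> each, and
      \<open>2 * \<tau> < e\<close>.\<close>
    define \<tau> where "\<tau> = e / 3"
    have ta: "\<tau> > 0" using e by (simp add: \<tau>_def)
    note up = upper_count[OF assms(1,3-7) ta, where 'a='a]
    note lo = lower_count[OF assms(1-7) ta, where 'a='a]
    obtain \<epsilon>1 where e1: "\<epsilon>1 > 0" and up: "\<forall>\<^sub>F N in sequentially. \<forall>(M :: 'a measure) X C. \<forall>x\<in>VNl N l.
      gaussian_family M (bulk N (l / 2)) X C \<longrightarrow> log_cov (bulk N (l / 2)) C 1 (ln (real N)) \<epsilon>1 \<longrightarrow>
      measure M {\<omega>\<in>space M. 2 * sqrt gconst * \<alpha> * ln (real N) \<le> X x \<omega> \<and>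
          exp ((2 * \<beta> * (1 - \<alpha>\<^sup>2) + \<delta>) * ln (real N))
            \<le> real (card {y\<in>{y\<in>VNl N l. edist x y \<le> exp (\<beta> * ln (real N))}. 2 * sqrt gconst * \<alpha> * ln (real N) \<le> X y \<omega>})}
       \<le> \<tau> * measure M {\<omega>\<in>space M. 2 * sqrt gconst * \<alpha> * ln (real N) \<le> X x \<omega>}"
      using up by blast
    obtain \<epsilon>2 where e2: "\<epsilon>2 > 0" and lo: "\<forall>\<^sub>F N in sequentially. \<forall>(M :: 'a measure) X C. \<forall>x\<in>VNl N l.
      gaussian_family M (bulk N (l / 2)) X C \<longrightarrow> log_cov (bulk N (l / 2)) C 1 (ln (real N)) \<epsilon>2 \<longrightarrow>
      measure M {\<omega>\<in>space M. 2 * sqrt gconst * \<alpha> * ln (real N) \<le> X x \<omega> \<and>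
          real (card {y\<in>{y\<in>VNl N l. edist x y \<le> exp (\<beta> * ln (real N))}. 2 * sqrt gconst * \<alpha> * ln (real N) \<le> X y \<omega>})
            \<le> exp ((2 * \<beta> * (1 - \<alpha>\<^sup>2) - \<delta>) * ln (real N))}
       \<le> \<tau> * measure M {\<omega>\<in>space M. 2 * sqrt gconst * \<alpha> * ln (real N) \<le> X x \<omega>}"
      using lo by blast
    define \<epsilon> where "\<epsilon> = min \<epsilon>1 \<epsilon>2"
    have ep: "\<epsilon> > 0" "\<epsilon> \<le> \<epsilon>1" "\<epsilon> \<le> \<epsilon>2" using e1 e2 by (auto simp: \<epsilon>_def)
    have gr: "\<forall>\<^sub>F N in sequentially. \<forall>x\<in>intr N. \<forall>y\<in>bulk N (l / 2).
             \<bar>green N x y - gconst * (ln (real N) - logd x y)\<bar> \<le> \<epsilon> * ln (real N)"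
      using assms(1,2) by (intro green_asymp ep) auto
    have n1: "\<forall>\<^sub>F N in sequentially. 2 / (1 - 2 * l) \<le> real N" using assms(2) by real_asymp
    have n2: "\<forall>\<^sub>F N in sequentially. 4 \<le> l * real N" using assms(1) by real_asymp
    show "\<forall>\<^sub>F N in sequentially. dist (Max (f N ` VNl N l)) 0 < e"
      using up lo gr n1 n2 eventually_ge_at_top[of 2]
    proof eventually_elim
      case (elim N)
      define L where "L = ln (real N)"
      have L: "L > 0" using elim(6) by (simp add: L_def)
      define D where "D = 2 * \<beta> * (1 - \<alpha>\<^sup>2)"
      define a where "a = 2 * sqrt gconst * \<alpha> * L"
      define I where "I = bulk N (l / 2)"
      have g: "gaussian_family (M N) I (\<Phi> N) (green N)"
        unfolding I_def using assms(8) by (intro gaussian_family_subset[OF GFF_gaussian_family bulk_intr]) auto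
      have finI: "finite I" by (rule gaussian_familyD(2)[OF g])
      have "log_cov I (green N) 1 L \<epsilon>"
        unfolding log_cov_def using elim(3) bulk_intr finI unfolding I_def L_def by auto
      then have lc: "log_cov I (green N) 1 L \<epsilon>1" "log_cov I (green N) 1 L \<epsilon>2"
        using log_cov_mono ep L by fastforce+
      interpret M: prob_space "M N" by (rule gaussian_familyD(1)[OF g])
      define BB where "BB = (\<lambda>x. {y\<in>VNl N l. edist x y \<le> exp (\<beta> * L)})"
      define S where "S = (\<lambda>x. {\<omega>\<in>space (M N). a \<le> \<Phi> N x \<omega>})"
      define U1 where "U1 = (\<lambda>x. {\<omega>\<in>space (M N). a \<le> \<Phi> N x \<omega> \<and> exp ((D + \<delta>) * L) \<le> real (card {y\<in>BB x. a \<le> \<Phi> N y \<omega>})})"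
      define U2 where "U2 = (\<lambda>x. {\<omega>\<in>space (M N). a \<le> \<Phi> N x \<omega> \<and> real (card {y\<in>BB x. a \<le> \<Phi> N y \<omega>}) \<le> exp ((D - \<delta>) * L)})"
      have b: "measure (M N) (U1 x) \<le> \<tau> * measure (M N) (S x)" "measure (M N) (U2 x) \<le> \<tau> * measure (M N) (S x)" if "x \<in> VNl N l" for x
        using elim(1)[folded L_def I_def, rule_format, OF that g lc(1)] elim(2)[folded L_def I_def, rule_format, OF that g lc(2)]
        unfolding U1_def U2_def S_def BB_def a_def D_def .
      have finV: "finite (VNl N l)" by (rule finite_subset[of _ "box N"]) (auto simp: VNl_def)
      have VI: "y \<in> I" if "y \<in> VNl N l" for y
        unfolding I_def by (rule near_VNl_bulk[OF assms(1) elim(5) that]) (use elim(5) in \<open>simp add: edist_def\<close>)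
      have Xm: "\<Phi> N y \<in> borel_measurable (M N)" if "y \<in> VNl N l" for y
        by (rule gaussian_familyD(3)[OF g VI[OF that]])
      have high: "y \<in> high N l \<alpha> (\<lambda>y. \<Phi> N y \<omega>) \<longleftrightarrow> y \<in> VNl N l \<and> a \<le> \<Phi> N y \<omega>" for y \<omega>
        by (simp add: high_def a_def L_def)
      have f: "0 \<le> f N x \<and> f N x \<le> 2 * \<tau>" if x: "x \<in> VNl N l" for x
      proof -
        have cards: "high N l \<alpha> (\<lambda>y. \<Phi> N y \<omega>) \<inter> disc N x (real N powr \<beta>) = {y\<in>BB x. a \<le> \<Phi> N y \<omega>}" for \<omega>
          using elim(6) by (auto simp: high disc_def BB_def powr_def L_def VNl_def)
        have Sx: "{\<omega> \<in> space (M N). x \<in> high N l \<alpha> (\<lambda>y. \<Phi> N y \<omega>)} = S x"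
          using x by (simp add: high S_def)
        have finBB: "finite (BB x)" using finV by (simp add: BB_def)
        have cm: "(\<lambda>\<omega>. real (card {y\<in>BB x. a \<le> \<Phi> N y \<omega>})) \<in> borel_measurable (M N)"
          using Xm by (intro count_measurable[OF finBB]) (auto simp: BB_def)
        have Um: "U1 x \<in> sets (M N)" "U2 x \<in> sets (M N)"
          unfolding U1_def U2_def using cm Xm[OF x] by measurable
        have "W N x \<subseteq> U1 x \<union> U2 x"
        proof
          fix \<omega> assume "\<omega> \<in> W N x"
          then have w: "\<omega> \<in> space (M N)" "a \<le> \<Phi> N x \<omega>" and dev: "\<delta> < \<bar>ln (real (card {y\<in>BB x. a \<le> \<Phi> N y \<omega>})) / L - D\<bar>"
            unfolding W_def cards high by (auto simp: L_def D_def)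
          define c where "c = real (card {y\<in>BB x. a \<le> \<Phi> N y \<omega>})"
          \<comment> \<open>The high point \<open>x\<close> counts itself, so the logarithm is taken
            at a positive number and exponentiation is reversible.\<close>
          have "x \<in> {y\<in>BB x. a \<le> \<Phi> N y \<omega>}" using x w by (simp add: BB_def edist_def)
          moreover have "finite {y\<in>BB x. a \<le> \<Phi> N y \<omega>}" using finBB by simp
          ultimately have "card {y\<in>BB x. a \<le> \<Phi> N y \<omega>} > 0" by (metis card_gt_0_iff emptyE)
          then have c: "c > 0" by (simp add: c_def)
          have "D + \<delta> \<le> ln c / L \<or> ln c / L \<le> D - \<delta>" using dev unfolding c_def[symmetric] by linarith
          then have "(D + \<delta>) * L \<le> ln c \<or> ln c \<le> (D - \<delta>) * L" using L by (simp add: field_simps)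
          then have "exp ((D + \<delta>) * L) \<le> exp (ln c) \<or> exp (ln c) \<le> exp ((D - \<delta>) * L)"
            by (simp only: exp_le_cancel_iff)
          then have "exp ((D + \<delta>) * L) \<le> c \<or> c \<le> exp ((D - \<delta>) * L)" unfolding exp_ln[OF c] .
          then show "\<omega> \<in> U1 x \<union> U2 x" using w by (auto simp: U1_def U2_def c_def)
        qed
        then have "measure (M N) (W N x) \<le> measure (M N) (U1 x \<union> U2 x)"
          using Um by (intro M.finite_measure_mono) auto
        also have "\<dots> \<le> measure (M N) (U1 x) + measure (M N) (U2 x)" by (rule measure_Un_le[OF Um])
        also have "\<dots> \<le> 2 * \<tau> * measure (M N) (S x)" using b[OF x] by simp
        \<comment> \<open>If \<open>x\<close> is high with probability 0, the quotient is 0 by the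
          convention for division, so the bound holds in that case too.\<close>
        finally have "f N x \<le> 2 * \<tau>"
          unfolding f_def Sx using ta by (cases "measure (M N) (S x) = 0") (auto simp: pos_divide_le_eq zero_less_measure_iff)
        moreover have "0 \<le> f N x" unfolding f_def by simp
        ultimately show ?thesis by simp
      qed
      \<comment> \<open>\<open>Max\<close> is meaningful only on a nonempty image, hence the size
        condition on \<open>N\<close>.\<close>
      have ne: "VNl N l \<noteq> {}" using elim(4,5) assms(1,2) by (intro VNl_nonempty) auto
      have "Max (f N ` VNl N l) \<in> f N ` VNl N l" using finV ne by (intro Max_in) auto
      then have "0 \<le> Max (f N ` VNl N l) \<and> Max (f N ` VNl N l) \<le> 2 * \<tau>" using f by auto
      then show ?case
        unfolding dist_real_def using e by (auto simp: \<tau>_def)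
    qed
  qed
  then show ?thesis unfolding f_def W_def .
qed

end
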